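(* Let $\Omega\subset\mathbb{R}^N$ be a bounded regular domain, let $\varepsilon_0>0$ and let $F:\Gamma_{\varepsilon_0}\to\mathbb{R}$ be Lipschitz continuous. For $0<\varepsilon<\varepsilon_0$ let $u^\varepsilon$ be the value function of the Pay or Leave Tug-of-War game with step size $\varepsilon$ and terminal payoff $F$. Then, as $\varepsilon\to0$, $$u^\varepsilon\to u\quad\text{uniformly in }\overline\Omega,$$ where $u$ is the unique viscosity solution to $$\max\left\{-\Delta_\infty u,\ \chi_{\{u>0\}}-|\nabla u|\right\}=0\ \text{ in }\Omega,\qquad u=F\ \text{ on }\partial\Omega.$$
   Context: "Regular domain" means a domain with smooth boundary. $\Delta_\infty u=\nabla u^T D^2u\,\nabla u$. For $\varepsilon>0$, $\Gamma_\varepsilon=\{x\in\mathbb{R}^N\setminus\Omega:\operatorname{dist}(x,\partial\Omega)<\varepsilon\}$; $B_\varepsilon(x)$ is the open ball. The game (Pay or Leave Tug-of-War) with step $\varepsilon$ and payoff $F$: a token starts at $x_0\in\Omega$. At each turn, with token at $x_k\in\Omega$, Player II (the minimizer) either plays Tug-of-War (a fair coin is tossed and the winner moves the token to any $x_{k+1}\in B_\varepsilon(x_k)$) or passes the turn to Player I (the maximizer), who then either moves the token to any $x_{k+1}\in B_\varepsilon(x_k)$ paying $\varepsilon$, or ends the game immediately with no further payoff. Otherwise the game ends when the token first leaves $\Omega$, at a point of $\Gamma_\varepsilon$. Formally, strategies $S_{\rm I},S_{\rm II}$ are (measurable) functions of partial histories with $S(x_0,\dots,x_k)\in B_\varepsilon(x_k)$,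 and decision variables $\theta_{\rm I},\theta_{\rm II}$ are $\{0,1\}$-valued functions of partial histories: $\theta_{\rm II}=1$ means Player II passes, $\theta_{\rm I}=1$ means Player I ends the game if given the turn. The game ends at $x_k\in\Omega$ if $\theta_{\rm I}=\theta_{\rm II}=1$ there; otherwise the transition probability is $$\tfrac12(1-\theta_{\rm II})\big(\delta_{S_{\rm I}(x_0,\dots,x_k)}+\delta_{S_{\rm II}(x_0,\dots,x_k)}\big)+\theta_{\rm II}(1-\theta_{\rm I})\delta_{S_{\rm I}(x_0,\dots,x_k)},$$ with $\theta_{\rm I},\theta_{\rm II}$ evaluated at $(x_0,\dots,x_k)$. Let $\tau$ be the time at which the game ends and extend $F$ by $0$ in $\Omega$. The expected payoff is $$E(S_{\rm I},\theta_{\rm I},S_{\rm II},\theta_{\rm II})=\mathbb{E}^{x_0}\Big[F(x_\tau)-\varepsilon\sum_{k=0}^{\tau-1}\theta_{\rm II}(x_0,\dots,x_k)(1-\theta_{\rm I}(x_0,\dots,x_k))\Big].$$ Put $u_{\rm I}(x_0)=\sup_{S_{\rm I},\theta_{\rm I}}\inf_{S_{\rm II},\theta_{\rm II}}E$ and $u_{\rm II}(x_0)=\inf_{S_{\rm II},\theta_{\rm II}}\sup_{S_{\rm I},\theta_{\rm I}}E$, where if the game does not end almost surely $E$ is set to $-\infty$ in $u_{\rm I}$ and $+\infty$ in $u_{\rm II}$; on $\Gamma_\varepsilon$ both equal $F$. The game has a value, $u^\varepsilon:=u_{\rm I}=u_{\rm II}$. Viscosity solutions of $\max\{-\Delta_\infty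 u,\chi_{\{u>0\}}-|\nabla u|\}=0$ in $\Omega$: an upper semicontinuous $u$ is a subsolution if, whenever $x_0\in\Omega$, $\varphi\in C^2(\Omega)$ and $u-\varphi$ has a strict local maximum at $x_0$, then $\max\{-\Delta_\infty\varphi(x_0),\chi_{\{u>0\}}(x_0)-|\nabla\varphi(x_0)|\}\le0$; a lower semicontinuous $u$ is a supersolution if, whenever $u-\varphi$ has a strict local minimum at $x_0$, then $\max\{-\Delta_\infty\varphi(x_0),\chi_{\{u\ge0\}}(x_0)-|\nabla\varphi(x_0)|\}\ge0$. A solution is a continuous function that is both, with $u\in C(\overline\Omega)$ equal to the boundary datum on $\partial\Omega$. *)

theory Defs
  imports "HOL-Probability.Probability"
begin

subsection \<open>Differential operators and regular domains\<close>

definition pd :: "'a::euclidean_space \<Rightarrow> ('a \<Rightarrow> real) \<Rightarrow> 'a \<Rightarrow> real" where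
  "pd i f x = frechet_derivative f (at x) i"

definition grad :: "('a::euclidean_space \<Rightarrow> real) \<Rightarrow> 'a \<Rightarrow> 'a" where
  "grad f x = (\<Sum>i\<in>Basis. pd i f x *\<^sub>R i)"

definition inf_laplacian :: "('a::euclidean_space \<Rightarrow> real) \<Rightarrow> 'a \<Rightarrow> real" where
  "inf_laplacian f x = (\<Sum>i\<in>Basis. \<Sum>j\<in>Basis. pd i f x * pd i (pd j f) x * pd j f x)"

text \<open>The class \<open>C\<^sup>k(S)\<close>, meant for open \<open>S\<close>.\<close>

primrec Ck_on :: "nat \<Rightarrow> ('a::euclidean_space \<Rightarrow> real) \<Rightarrow> 'a set \<Rightarrow> bool" where
  "Ck_on 0 f S \<longleftrightarrow> continuous_on S f"
| "Ck_on (Suc k) f S \<longleftrightarrow> (\<forall>x\<in>S. f differentiable (at x)) \<and> (\<forall>i\<in>Basis. Ck_on k (pd i f) S)"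

definition smooth_on :: "('a::euclidean_space \<Rightarrow> real) \<Rightarrow> 'a set \<Rightarrow> bool" where
  "smooth_on f S \<longleftrightarrow> (\<forall>k. Ck_on k f S)"

text \<open>
  Smoothness of the boundary is expressed by local defining functions: near each boundary
  point, \<open>\<Omega>\<close> is the negativity set of a smooth function with nonvanishing gradient.
\<close>

definition regular_domain :: "'a::euclidean_space set \<Rightarrow> bool" where
  "regular_domain \<Omega> \<longleftrightarrow> open \<Omega> \<and> connected \<Omega> \<and> \<Omega> \<noteq> {} \<and>
     (\<forall>p\<in>frontier \<Omega>. \<exists>U \<rho>. open U \<and> p \<in> U \<and> smooth_on \<rho> U \<and> (\<forall>x\<in>U. grad \<rho> x \<noteq> 0) \<and>
        \<Omega> \<inter> U = {x\<in>U. \<rho> x < 0})"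

definition outer_strip :: "'a::euclidean_space set \<Rightarrow> real \<Rightarrow> 'a set" where
  "outer_strip \<Omega> \<epsilon> = {x. x \<notin> \<Omega> \<and> infdist x (frontier \<Omega>) < \<epsilon>}"


subsection \<open>Viscosity solutions\<close>

definition usc_on :: "'a::metric_space set \<Rightarrow> ('a \<Rightarrow> real) \<Rightarrow> bool" where
  "usc_on S u \<longleftrightarrow> (\<forall>x\<in>S. \<forall>e>0. \<forall>\<^sub>F y in at x within S. u y < u x + e)"

definition lsc_on :: "'a::metric_space set \<Rightarrow> ('a \<Rightarrow> real) \<Rightarrow> bool" where
  "lsc_on S u \<longleftrightarrow> (\<forall>x\<in>S. \<forall>e>0. \<forall>\<^sub>F y in at x within S. u x - e < u y)"

definition strict_local_max_at :: "'a::metric_space set \<Rightarrow> ('a \<Rightarrow> real) \<Rightarrow> 'a \<Rightarrow> bool" where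
  "strict_local_max_at S g x \<longleftrightarrow> (\<exists>r>0. \<forall>y\<in>S \<inter> ball x r. y \<noteq> x \<longrightarrow> g y < g x)"

definition strict_local_min_at :: "'a::metric_space set \<Rightarrow> ('a \<Rightarrow> real) \<Rightarrow> 'a \<Rightarrow> bool" where
  "strict_local_min_at S g x \<longleftrightarrow> (\<exists>r>0. \<forall>y\<in>S \<inter> ball x r. y \<noteq> x \<longrightarrow> g x < g y)"

definition viscosity_subsolution :: "'a::euclidean_space set \<Rightarrow> ('a \<Rightarrow> real) \<Rightarrow> bool" where
  "viscosity_subsolution \<Omega> u \<longleftrightarrow> usc_on \<Omega> u \<and>
     (\<forall>x\<in>\<Omega>. \<forall>\<phi>. Ck_on 2 \<phi> \<Omega> \<and> strict_local_max_at \<Omega> (\<lambda>y. u y - \<phi> y) x \<longrightarrow>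
        max (- inf_laplacian \<phi> x) (indicator {y. u y > 0} x - norm (grad \<phi> x)) \<le> 0)"

definition viscosity_supersolution :: "'a::euclidean_space set \<Rightarrow> ('a \<Rightarrow> real) \<Rightarrow> bool" where
  "viscosity_supersolution \<Omega> u \<longleftrightarrow> lsc_on \<Omega> u \<and>
     (\<forall>x\<in>\<Omega>. \<forall>\<phi>. Ck_on 2 \<phi> \<Omega> \<and> strict_local_min_at \<Omega> (\<lambda>y. u y - \<phi> y) x \<longrightarrow>
        max (- inf_laplacian \<phi> x) (indicator {y. u y \<ge> 0} x - norm (grad \<phi> x)) \<ge> 0)"

definition viscosity_solution ::
    "'a::euclidean_space set \<Rightarrow> ('a \<Rightarrow> real) \<Rightarrow> ('a \<Rightarrow> real) \<Rightarrow> bool" where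
  "viscosity_solution \<Omega> F u \<longleftrightarrow> continuous_on (closure \<Omega>) u \<and>
     viscosity_subsolution \<Omega> u \<and> viscosity_supersolution \<Omega> u \<and> (\<forall>x\<in>frontier \<Omega>. u x = F x)"


subsection \<open>The Pay or Leave Tug-of-War game\<close>

text \<open>
  A partial history \<open>(x\<^sub>0, \<dots>, x\<^sub>k)\<close> is a point of the product space \<open>histories k\<close>. A player's
  policy is a pair \<open>(S, \<theta>)\<close> of a strategy and a decision variable, both families indexed by the
  stage \<open>k\<close>; the value 1 of a decision variable is \<open>True\<close>.
\<close>

type_synonym 'a strategy = "nat \<Rightarrow> (nat \<Rightarrow> 'a) \<Rightarrow> 'a"
type_synonym 'a decision = "nat \<Rightarrow> (nat \<Rightarrow> 'a) \<Rightarrow> bool"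

abbreviation histories :: "nat \<Rightarrow> (nat \<Rightarrow> 'a::euclidean_space) measure" where
  "histories k \<equiv> PiM {0..<Suc k} (\<lambda>_. borel)"

definition policies :: "real \<Rightarrow> ('a::euclidean_space strategy \<times> 'a decision) set" where
  "policies \<epsilon> = {(S, \<theta>). \<forall>k.
     S k \<in> borel_measurable (histories k) \<and>
     (\<forall>h\<in>space (histories k). S k h \<in> ball (h k) \<epsilon>) \<and>
     \<theta> k \<in> measurable (histories k) (count_space UNIV)}"

definition hist :: "nat \<Rightarrow> (nat \<Rightarrow> 'a) \<Rightarrow> nat \<Rightarrow> 'a" where
  "hist k \<omega> = restrict \<omega> {0..<Suc k}"

definition ends_at ::
    "'a set \<Rightarrow> 'a decision \<Rightarrow> 'a decision \<Rightarrow> (nat \<Rightarrow> 'a) \<Rightarrow> nat \<Rightarrow> bool" where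
  "ends_at \<Omega> \<theta>1 \<theta>2 \<omega> k \<longleftrightarrow> \<omega> k \<notin> \<Omega> \<or> (\<theta>1 k (hist k \<omega>) \<and> \<theta>2 k (hist k \<omega>))"

text \<open>
  Law of \<open>x\<^sub>n\<close> given \<open>(x\<^sub>0, \<dots>, x\<^bsub>n-1\<^esub>)\<close>. Once the game has ended the token is kept in place, which
  makes the position an infinite process without affecting the payoff.
\<close>

primrec transition :: "'a::euclidean_space set \<Rightarrow> 'a strategy \<Rightarrow> 'a decision \<Rightarrow>
    'a strategy \<Rightarrow> 'a decision \<Rightarrow> 'a \<Rightarrow> nat \<Rightarrow> (nat \<Rightarrow> 'a) \<Rightarrow> 'a measure" where
  "transition \<Omega> S1 \<theta>1 S2 \<theta>2 x0 0 h = return borel x0"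
| "transition \<Omega> S1 \<theta>1 S2 \<theta>2 x0 (Suc k) h =
     (if \<exists>j\<le>k. ends_at \<Omega> \<theta>1 \<theta>2 h j then return borel (h k)
      else if \<theta>2 k h then return borel (S1 k h)
      else distr (measure_pmf (bernoulli_pmf (1/2))) borel (\<lambda>b. if b then S1 k h else S2 k h))"

text \<open>The law of the infinite trajectory is the Ionescu-Tulcea measure of these kernels.\<close>

definition game_measure :: "'a::euclidean_space set \<Rightarrow> 'a strategy \<Rightarrow> 'a decision \<Rightarrow>
    'a strategy \<Rightarrow> 'a decision \<Rightarrow> 'a \<Rightarrow> (nat \<Rightarrow> 'a) measure" where
  "game_measure \<Omega> S1 \<theta>1 S2 \<theta>2 x0 =
     projective_family.lim UNIV (Ionescu_Tulcea.CI (transition \<Omega> S1 \<theta>1 S2 \<theta>2 x0) (\<lambda>_. borel))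
       (\<lambda>_. borel)"

lemma measurable_hist:
  assumes "j \<le> k" shows "hist j \<in> measurable (histories k) (histories j)"
  unfolding hist_def using assms by (intro measurable_restrict) auto

lemma measurable_ends_at:
  fixes \<Omega> :: "'a::euclidean_space set"
  assumes [measurable]: "\<Omega> \<in> sets borel" and "j \<le> k"
    and P: "(S1, \<theta>1) \<in> policies \<epsilon>" "(S2, \<theta>2) \<in> policies \<epsilon>"
  shows "Measurable.pred (histories k) (\<lambda>h. ends_at \<Omega> \<theta>1 \<theta>2 h j)"
proof -
  note [measurable] = measurable_hist[OF \<open>j \<le> k\<close>]
  have [measurable]: "\<theta>1 j \<in> measurable (histories j) (count_space UNIV)"
    "\<theta>2 j \<in> measurable (histories j) (count_space UNIV)"
    using P by (auto simp: policies_def)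
  have [measurable]: "(\<lambda>h. h j) \<in> borel_measurable (histories k)"
    using \<open>j \<le> k\<close> by (intro measurable_component_singleton) auto
  show ?thesis unfolding ends_at_def by measurable
qed

lemma Ionescu_Tulcea_transition:
  fixes \<Omega> :: "'a::euclidean_space set"
  assumes \<Omega>: "\<Omega> \<in> sets borel"
    and P: "(S1, \<theta>1) \<in> policies \<epsilon>" "(S2, \<theta>2) \<in> policies \<epsilon>"
  shows "Ionescu_Tulcea (transition \<Omega> S1 \<theta>1 S2 \<theta>2 x0) (\<lambda>_. borel)"
proof (rule Ionescu_Tulcea.intro)
  fix i
  show "transition \<Omega> S1 \<theta>1 S2 \<theta>2 x0 i \<in> measurable (PiM {0..<i} (\<lambda>_. borel)) (subprob_algebra borel)"
  proof (cases i)
    case 0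
    have "transition \<Omega> S1 \<theta>1 S2 \<theta>2 x0 0 = (\<lambda>_. return borel x0)" by (simp add: fun_eq_iff)
    then show ?thesis using 0 by (simp add: measurable_const space_subprob_algebra
          prob_space_imp_subprob_space prob_space_return)
  next
    case (Suc k)
    have [measurable]: "S1 k \<in> borel_measurable (histories k)" "S2 k \<in> borel_measurable (histories k)"
      "\<theta>2 k \<in> measurable (histories k) (count_space UNIV)"
      using P by (auto simp: policies_def)
    have [measurable]: "(\<lambda>h. h k) \<in> borel_measurable (histories k)"
      by (intro measurable_component_singleton) auto
    have [measurable]: "Measurable.pred (histories k) (\<lambda>h. \<exists>j\<le>k. ends_at \<Omega> \<theta>1 \<theta>2 h j)"
    proof -
      have "Measurable.pred (histories k) (\<lambda>h. \<exists>j\<in>{..k}. ends_at \<Omega> \<theta>1 \<theta>2 h j)"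
        using measurable_ends_at[OF \<Omega> _ P] by (intro pred_intros_finite) auto
      then show ?thesis by (simp only: Bex_def atMost_iff)
    qed
    have pmf: "(\<lambda>h. measure_pmf (bernoulli_pmf (1/2)))
        \<in> measurable (histories k) (subprob_algebra (count_space UNIV))"
      by (simp add: measurable_const space_subprob_algebra measure_pmf.subprob_space_axioms)
    have "(\<lambda>h. distr (measure_pmf (bernoulli_pmf (1/2))) borel
         (\<lambda>b. if b then S1 k h else S2 k h)) \<in> measurable (histories k) (subprob_algebra borel)"
      by (rule measurable_distr2[OF _ pmf]) measurable
    have "transition \<Omega> S1 \<theta>1 S2 \<theta>2 x0 (Suc k) = (\<lambda>h.
      (if \<exists>j\<le>k. ends_at \<Omega> \<theta>1 \<theta>2 h j then return borel (h k)
      else if \<theta>2 k h then return borel (S1 k h)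
      else distr (measure_pmf (bernoulli_pmf (1/2))) borel (\<lambda>b. if b then S1 k h else S2 k h)))"
      by (rule ext) (simp only: transition.simps)
    also have "\<dots> \<in> measurable (histories k) (subprob_algebra borel)"
    proof (intro measurable_If)
      show "(\<lambda>h. return borel (h k)) \<in> measurable (histories k) (subprob_algebra borel)"
        "(\<lambda>h. return borel (S1 k h)) \<in> measurable (histories k) (subprob_algebra borel)"
        by (auto intro!: measurable_compose[OF _ return_measurable])
      show "{h \<in> space (histories k). \<theta>2 k h} \<in> sets (histories k)"
        "{h \<in> space (histories k). \<exists>j\<le>k. ends_at \<Omega> \<theta>1 \<theta>2 h j} \<in> sets (histories k)"
        by (rule predE, fact)+
    qed fact
    finally show ?thesis unfolding Suc .
  qed
next
  fix i :: nat and h :: "nat \<Rightarrow> 'a"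
  assume "h \<in> space (PiM {0..<i} (\<lambda>_. borel))"
  show "prob_space (transition \<Omega> S1 \<theta>1 S2 \<theta>2 x0 i h)"
    by (cases i) (auto intro!: prob_space_return measure_pmf.prob_space_distr)
qed

definition game_terminates ::
    "'a set \<Rightarrow> 'a decision \<Rightarrow> 'a decision \<Rightarrow> (nat \<Rightarrow> 'a) \<Rightarrow> bool" where
  "game_terminates \<Omega> \<theta>1 \<theta>2 \<omega> \<longleftrightarrow> (\<exists>k. ends_at \<Omega> \<theta>1 \<theta>2 \<omega> k)"

definition end_time ::
    "'a set \<Rightarrow> 'a decision \<Rightarrow> 'a decision \<Rightarrow> (nat \<Rightarrow> 'a) \<Rightarrow> nat" where
  "end_time \<Omega> \<theta>1 \<theta>2 \<omega> = (LEAST k. ends_at \<Omega> \<theta>1 \<theta>2 \<omega> k)"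

definition payoff :: "'a::euclidean_space set \<Rightarrow> ('a \<Rightarrow> real) \<Rightarrow> real \<Rightarrow>
    'a decision \<Rightarrow> 'a decision \<Rightarrow> (nat \<Rightarrow> 'a) \<Rightarrow> real" where
  "payoff \<Omega> F \<epsilon> \<theta>1 \<theta>2 \<omega> =
     (let \<tau> = end_time \<Omega> \<theta>1 \<theta>2 \<omega> in
      (if \<omega> \<tau> \<in> outer_strip \<Omega> \<epsilon> then F (\<omega> \<tau>) else 0)
      - \<epsilon> * (\<Sum>k<\<tau>. of_bool (\<theta>2 k (hist k \<omega>) \<and> \<not> \<theta>1 k (hist k \<omega>))))"

text \<open>
  The number of payments may fail to be integrable, in which case the expected payoff is
  \<open>-\<infinity>\<close>, whereas the Bochner integral would be 0. Hence the expectation is taken in \<open>ereal\<close>,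
  as the difference of the integrals of the positive and negative parts.
\<close>

definition ereal_expectation :: "'b measure \<Rightarrow> ('b \<Rightarrow> real) \<Rightarrow> ereal" where
  "ereal_expectation M f =
     enn2ereal (\<integral>\<^sup>+\<omega>. ennreal (f \<omega>) \<partial>M) - enn2ereal (\<integral>\<^sup>+\<omega>. ennreal (- f \<omega>) \<partial>M)"

text \<open>The first argument is the value assigned when the game does not end almost surely.\<close>

definition expected_payoff :: "ereal \<Rightarrow> 'a::euclidean_space set \<Rightarrow> ('a \<Rightarrow> real) \<Rightarrow> real \<Rightarrow> 'a \<Rightarrow>
    'a strategy \<times> 'a decision \<Rightarrow> 'a strategy \<times> 'a decision \<Rightarrow> ereal" where
  "expected_payoff c \<Omega> F \<epsilon> x0 p1 p2 =
     (let G = game_measure \<Omega> (fst p1) (snd p1) (fst p2) (snd p2) x0 in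
      if AE \<omega> in G. game_terminates \<Omega> (snd p1) (snd p2) \<omega>
      then ereal_expectation G (payoff \<Omega> F \<epsilon> (snd p1) (snd p2)) else c)"

definition value_I :: "'a::euclidean_space set \<Rightarrow> ('a \<Rightarrow> real) \<Rightarrow> real \<Rightarrow> 'a \<Rightarrow> ereal" where
  "value_I \<Omega> F \<epsilon> x0 =
     (if x0 \<in> \<Omega> then SUP p1\<in>policies \<epsilon>. INF p2\<in>policies \<epsilon>. expected_payoff (-\<infinity>) \<Omega> F \<epsilon> x0 p1 p2
      else ereal (F x0))"

definition value_II :: "'a::euclidean_space set \<Rightarrow> ('a \<Rightarrow> real) \<Rightarrow> real \<Rightarrow> 'a \<Rightarrow> ereal" where
  "value_II \<Omega> F \<epsilon> x0 =
     (if x0 \<in> \<Omega> then INF p2\<in>policies \<epsilon>. SUP p1\<in>policies \<epsilon>. expected_payoff \<infinity> \<Omega> F \<epsilon> x0 p1 p2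
      else ereal (F x0))"

definition is_game_value ::
    "'a::euclidean_space set \<Rightarrow> ('a \<Rightarrow> real) \<Rightarrow> real \<Rightarrow> ('a \<Rightarrow> real) \<Rightarrow> bool" where
  "is_game_value \<Omega> F \<epsilon> v \<longleftrightarrow>
     (\<forall>x\<in>\<Omega> \<union> outer_strip \<Omega> \<epsilon>. value_I \<Omega> F \<epsilon> x = ereal (v x) \<and> value_II \<Omega> F \<epsilon> x = ereal (v x))"

end

theory Submission
  imports Defs "HOL-Complex_Analysis.Great_Picard"
begin

text \<open>
  The value of the game solves the dynamic programming principle
  \<open>v x = min ((sup v + inf v) / 2) (max 0 (sup v - \<epsilon>))\<close>, with suprema and infima over the open ball
  of radius \<open>\<epsilon>\<close> around \<open>x\<close>. Comparison for this equation holds even for discontinuous bounded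
  functions: after a strictly concave change of the unknown of the supersolution, a point where
  the difference is almost maximal is one where the supersolution is almost constant on its ball,
  so all points of the ball are almost maximal too, and finitely many steps along a straight line
  leave the domain. The same argument applies to sequences \<open>u\<^bsub>n+1\<^esub> \<le> T u\<^sub>n\<close>, \<open>w\<^bsub>n+1\<^esub> \<ge> T w\<^sub>n\<close>, so that
  the iterates of an explicit strict subsolution and of an explicit strict supersolution have the
  same uniform limit. Each player can play according to finitely many iterates and then according
  to the strict sub- or supersolution, whose drift makes the expected duration finite; hence the
  limit is the value of the game.

  Barriers and translations make the value Lipschitz continuous up to an error \<open>O(\<epsilon>)\<close>, so
  subsequences converge uniformly, and Taylor expansion shows that limits are viscosity solutions.
  Conversely, for a viscosity solution \<open>u\<close> the functions \<open>max u\<close> and \<open>min u\<close> over closed balls of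
  radius \<open>\<epsilon>\<close> are, by comparison with cones and the growth of \<open>u\<close> where it is positive, a discrete
  subsolution and (up to a small constant) a discrete supersolution. Discrete comparison then
  bounds the distance of \<open>u\<close> from the value of the game, which gives uniqueness and convergence of
  the whole family at once.
\<close>

subsection \<open>The dynamic programming operator and discrete comparison\<close>

text \<open>Three obstacles shape the argument. Functions satisfying the discrete equation may jump,
  so maxima need not be attained: everything is phrased with almost maximal points and explicit
  tolerances, and measurability rests on the openness of the balls. A play that never ends counts
  against the player whose policy is being tested, so a near-optimal policy must force termination
  against every opponent. Exact solutions give no such control; hence the potentials that define
  policies carry an additional gain \<open>\<gamma>\<close> per turn. The operator is flat where
  leaving is optimal and commutes with adding constants in its other branches, so it is not strictly
  monotone. The quadratic change of variable helps in each regime for a different reason: through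
  the spread of the values in tug-of-war, through the cost \<open>\<epsilon>\<close> of a move, and
  through the sign of the two functions when leaving. For limits, the contact tolerance
  \<open>\<epsilon> ^ 3\<close> is below both scales that matter, the first-order cost
  \<open>\<epsilon>\<close> of a move and the second difference of order
  \<open>\<epsilon>\<^sup>2\<close>.\<close>

definition bsup :: "real \<Rightarrow> ('a::euclidean_space \<Rightarrow> real) \<Rightarrow> 'a \<Rightarrow> real" where
  "bsup \<epsilon> f x = (SUP y\<in>ball x \<epsilon>. f y)"

definition binf :: "real \<Rightarrow> ('a::euclidean_space \<Rightarrow> real) \<Rightarrow> 'a \<Rightarrow> real" where
  "binf \<epsilon> f x = (INF y\<in>ball x \<epsilon>. f y)"

text \<open>
  Player II takes the minimum of tug-of-war and of passing, in which case Player I takes the maximum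
  of leaving and of moving at the cost \<open>\<epsilon>\<close>.
\<close>

definition dpp :: "real \<Rightarrow> ('a::euclidean_space \<Rightarrow> real) \<Rightarrow> 'a \<Rightarrow> real" where
  "dpp \<epsilon> f x = min ((bsup \<epsilon> f x + binf \<epsilon> f x) / 2) (max 0 (bsup \<epsilon> f x - \<epsilon>))"

lemma
  fixes f :: "'a::euclidean_space \<Rightarrow> real"
  assumes "\<And>y. y \<in> ball x \<epsilon> \<Longrightarrow> \<bar>f y\<bar> \<le> C"
  shows bsup_upper: "y \<in> ball x \<epsilon> \<Longrightarrow> f y \<le> bsup \<epsilon> f x"
    and binf_lower: "y \<in> ball x \<epsilon> \<Longrightarrow> binf \<epsilon> f x \<le> f y"
proof -
  have "bdd_above (f ` ball x \<epsilon>)" "bdd_below (f ` ball x \<epsilon>)"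
    using assms by (force simp: abs_le_iff intro!: bdd_aboveI[of _ C] bdd_belowI[of _ "- C"])+
  then show "y \<in> ball x \<epsilon> \<Longrightarrow> f y \<le> bsup \<epsilon> f x" "y \<in> ball x \<epsilon> \<Longrightarrow> binf \<epsilon> f x \<le> f y"
    unfolding bsup_def binf_def by (auto intro: cSUP_upper cINF_lower)
qed

lemma bsup_least: "0 < \<epsilon> \<Longrightarrow> (\<And>y. y \<in> ball x \<epsilon> \<Longrightarrow> f y \<le> c) \<Longrightarrow> bsup \<epsilon> f x \<le> c"
  unfolding bsup_def by (intro cSUP_least) auto

lemma binf_greatest: "0 < \<epsilon> \<Longrightarrow> (\<And>y. y \<in> ball x \<epsilon> \<Longrightarrow> c \<le> f y) \<Longrightarrow> c \<le> binf \<epsilon> f x"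
  unfolding binf_def by (intro cINF_greatest) auto

lemma bsup_mono:
  assumes "0 < \<epsilon>" "\<And>y. y \<in> ball x \<epsilon> \<Longrightarrow> \<bar>g y\<bar> \<le> C" "\<And>y. y \<in> ball x \<epsilon> \<Longrightarrow> f y \<le> g y + c"
  shows "bsup \<epsilon> f x \<le> bsup \<epsilon> g x + c"
proof (rule bsup_least[OF assms(1)])
  fix y assume y: "y \<in> ball x \<epsilon>"
  have "g y \<le> bsup \<epsilon> g x" using bsup_upper[of x \<epsilon> g C y] assms(2) y by blast
  then show "f y \<le> bsup \<epsilon> g x + c" using assms(3)[OF y] by simp
qed

lemma binf_mono:
  assumes "0 < \<epsilon>" "\<And>y. y \<in> ball x \<epsilon> \<Longrightarrow> \<bar>f y\<bar> \<le> C" "\<And>y. y \<in> ball x \<epsilon> \<Longrightarrow> f y \<le> g y + c"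
  shows "binf \<epsilon> f x \<le> binf \<epsilon> g x + c"
proof -
  have "binf \<epsilon> f x - c \<le> binf \<epsilon> g x"
    using assms(3) binf_lower[OF assms(2)] by (intro binf_greatest[OF assms(1)]) fastforce
  then show ?thesis by simp
qed

text \<open>The constant must be nonnegative because of the value 0 for leaving: in general
  \<open>max 0 (s + c - \<epsilon>)\<close> is at most \<open>max 0 (s - \<epsilon>) + c\<close>
  only then. So subsolutions may be lowered and supersolutions raised by constants, but not
  conversely.\<close>

lemma dpp_mono:
  assumes "0 < \<epsilon>" "0 \<le> c" "\<And>y. y \<in> ball x \<epsilon> \<Longrightarrow> \<bar>f y\<bar> \<le> C" "\<And>y. y \<in> ball x \<epsilon> \<Longrightarrow> \<bar>g y\<bar> \<le> C'"
    "\<And>y. y \<in> ball x \<epsilon> \<Longrightarrow> f y \<le> g y + c"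
  shows "dpp \<epsilon> f x \<le> dpp \<epsilon> g x + c"
  using bsup_mono[of \<epsilon> x g C' f c] binf_mono[of \<epsilon> x f C g c] assms
  unfolding dpp_def by (auto simp: min_def max_def field_simps)

lemma
  assumes "0 < \<epsilon>" "\<And>y. y \<in> ball x \<epsilon> \<Longrightarrow> \<bar>f y\<bar> \<le> C"
  shows abs_bsup: "\<bar>bsup \<epsilon> f x\<bar> \<le> C" and abs_binf: "\<bar>binf \<epsilon> f x\<bar> \<le> C"
    and binf_le_bsup: "binf \<epsilon> f x \<le> bsup \<epsilon> f x"
proof -
  have x: "x \<in> ball x \<epsilon>" using assms(1) by simp
  have "\<bar>f x\<bar> \<le> C" using assms(2)[OF x] .
  moreover have "f x \<le> bsup \<epsilon> f x" "binf \<epsilon> f x \<le> f x"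
    using bsup_upper[OF assms(2) x] binf_lower[OF assms(2) x] by auto
  moreover have "bsup \<epsilon> f x \<le> C" using assms(2) by (intro bsup_least[OF assms(1)]) (simp add: abs_le_iff)
  moreover have "- C \<le> binf \<epsilon> f x" using assms(2) by (intro binf_greatest[OF assms(1)]) (simp add: abs_le_iff minus_le_iff)
  ultimately show "\<bar>bsup \<epsilon> f x\<bar> \<le> C" "\<bar>binf \<epsilon> f x\<bar> \<le> C" "binf \<epsilon> f x \<le> bsup \<epsilon> f x" by auto
qed

lemma bsup_approx:
  assumes "0 < \<epsilon>" "c < bsup \<epsilon> f x"
  shows "\<exists>y\<in>ball x \<epsilon>. c < f y"
  using bsup_least[OF assms(1), of x f c] assms(2) by force

lemma binf_approx:
  assumes "0 < \<epsilon>" "binf \<epsilon> f x < c"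
  shows "\<exists>y\<in>ball x \<epsilon>. f y < c"
  using binf_greatest[OF assms(1), of x c f] assms(2) by force

section \<open>Comparison for the discrete equation\<close>

lemma concave_transform_mono:
  fixes b C s t :: real
  assumes "0 < b" "2 * b * (2 * C + 1) \<le> 1" "s \<le> t" "\<bar>s\<bar> \<le> C" "\<bar>t\<bar> \<le> C"
  defines "g \<equiv> \<lambda>t. t - b * (t + (C + 1))\<^sup>2"
  shows "g s \<le> g t" "g t - g s \<le> (1 - 2 * b) * (t - s)" "g t - g s \<le> t - s"
proof -
  have eq: "g t - g s = (t - s) * (1 - b * (t + s + 2 * (C + 1)))"
    unfolding g_def by (simp add: power2_eq_square algebra_simps)
  \<comment> \<open>On \<open>[- C, C]\<close> the slope of \<open>g\<close> is
    \<open>1 - 2 * b * (t + C + 1)\<close>. The shift keeps \<open>t + C + 1\<close> at least 1, so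
    the slope is at most \<open>1 - 2 * b\<close>; the smallness of \<open>b\<close> keeps it
    nonnegative.\<close>
  have "t + s + 2 * (C + 1) \<le> 2 * (2 * C + 1)" "2 \<le> t + s + 2 * (C + 1)" using assms by auto
  then have *: "b * (t + s + 2 * (C + 1)) \<le> b * (2 * (2 * C + 1))" "b * 2 \<le> b * (t + s + 2 * (C + 1))"
    using assms by (auto intro!: mult_left_mono)
  then have "b * (t + s + 2 * (C + 1)) \<le> 1" using assms(2) by (simp add: algebra_simps)
  then have "0 \<le> (t - s) * (1 - b * (t + s + 2 * (C + 1)))" using assms by (intro mult_nonneg_nonneg) auto
  then show "g s \<le> g t" using eq by simp
  have "g t - g s \<le> (t - s) * (1 - 2 * b)" unfolding eq using * assms by (intro mult_left_mono) auto
  then show "g t - g s \<le> (1 - 2 * b) * (t - s)" by (simp add: mult.commute)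
  also have "\<dots> \<le> 1 * (t - s)" using assms by (intro mult_right_mono) auto
  finally show "g t - g s \<le> t - s" by simp
qed

text \<open>Each branch of the operator yields its own alternative. If \<open>W\<close> is above the
  average of supremum and infimum of \<open>h\<close>, concavity of \<open>g\<close> gains
  \<open>b\<close> times the square of half the oscillation of \<open>h\<close>, so \<open>h\<close>
  is almost constant unless \<open>V\<close> is well below \<open>d\<close>. If \<open>f\<close> is
  governed by paying, the slope bound \<open>1 - 2 * b\<close> turns the cost
  \<open>\<epsilon>\<close> into a gain \<open>2 * b * \<epsilon>\<close>. If leaving is what bounds
  \<open>U\<close>, then \<open>U \<le> 0 \<le> W\<close> and only the error of \<open>g\<close>
  remains.\<close>

lemma dpp_comparison_step:
  fixes f h :: "'a::euclidean_space \<Rightarrow> real"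
  assumes e: "0 < \<epsilon>" and b: "0 < b" "2 * b * (2 * C + 1) \<le> 1"
    and f: "\<And>y. y \<in> ball x \<epsilon> \<Longrightarrow> \<bar>f y\<bar> \<le> C" and h: "\<And>y. y \<in> ball x \<epsilon> \<Longrightarrow> \<bar>h y\<bar> \<le> C"
    and W: "\<bar>W\<bar> \<le> C"
    and U: "U \<le> dpp \<epsilon> f x" and Wd: "dpp \<epsilon> h x \<le> W"
  defines "g \<equiv> \<lambda>t. t - b * (t + (C + 1))\<^sup>2"
  assumes d: "\<And>y. y \<in> ball x \<epsilon> \<Longrightarrow> f y - g (h y) \<le> d"
  defines "V \<equiv> U - g W"
  shows "V \<le> b * (2 * C + 1)\<^sup>2 \<or> V \<le> d - 2 * b * \<epsilon> \<or>
    V \<le> d \<and> (\<forall>y\<in>ball x \<epsilon>. d - 2 * (d - V) - 2 * sqrt ((d - V) / b) \<le> f y - g (h y))"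
proof -
  define S where "S = bsup \<epsilon> h x"
  define I where "I = binf \<epsilon> h x"
  have SI: "\<bar>S\<bar> \<le> C" "\<bar>I\<bar> \<le> C" "I \<le> S"
    unfolding S_def I_def using abs_bsup[OF e h] abs_binf[OF e h] binf_le_bsup[OF e h] by auto
  have C: "0 \<le> C" using W by linarith
  have gm: "g s \<le> g t" "g t - g s \<le> (1 - 2 * b) * (t - s)" "g t - g s \<le> t - s"
    if "s \<le> t" "\<bar>s\<bar> \<le> C" "\<bar>t\<bar> \<le> C" for s t
    using concave_transform_mono[OF b that] unfolding g_def by auto
  have Sf: "bsup \<epsilon> f x \<le> g S + d"
  proof (intro bsup_least[OF e])
    fix y assume y: "y \<in> ball x \<epsilon>"
    have "h y \<le> S" unfolding S_def using bsup_upper[OF h y] .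
    then have "g (h y) \<le> g S" using gm(1) h[OF y] SI by blast
    then show "f y \<le> g S + d" using d[OF y] by linarith
  qed
  \<comment> \<open>The infimum of \<open>f\<close> is estimated at a point where \<open>h\<close>,
    not \<open>f\<close>, is almost minimal; the gap to \<open>I\<close> costs at most
    \<open>\<eta>\<close> because \<open>g\<close> does not expand increments.\<close>
  have If: "binf \<epsilon> f x \<le> g I + d"
  proof (rule field_le_epsilon)
    fix \<eta> :: real assume "0 < \<eta>"
    then obtain y where y: "y \<in> ball x \<epsilon>" "h y < I + \<eta>"
      using binf_approx[OF e, of h x "I + \<eta>"] I_def by auto
    have "I \<le> h y" unfolding I_def using binf_lower[OF h y(1)] .
    then have "g (h y) \<le> g I + \<eta>" using gm(3)[of I "h y"] h[OF y(1)] SI y by linarith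
    then show "binf \<epsilon> f x \<le> g I + d + \<eta>" using d[OF y(1)] binf_lower[of x \<epsilon> f C, OF f y(1)] by linarith
  qed
  show ?thesis
  proof (cases "(S + I) / 2 \<le> W")
    case True
    define \<sigma> where "\<sigma> = (S - I) / 2"
    have mid: "g ((S + I) / 2) = (g S + g I) / 2 + b * \<sigma>\<^sup>2"
      unfolding g_def \<sigma>_def by (simp add: power2_eq_square field_simps)
    have "g ((S + I) / 2) \<le> g W" using True W SI by (intro gm(1)) auto
    then have gW: "(g S + g I) / 2 + b * \<sigma>\<^sup>2 \<le> g W" using mid by simp
    have U2: "U \<le> (bsup \<epsilon> f x + binf \<epsilon> f x) / 2" using U unfolding dpp_def by simp
    have "0 \<le> b * \<sigma>\<^sup>2" using b by simp
    have dV: "b * \<sigma>\<^sup>2 \<le> d - V" using U2 Sf If gW unfolding V_def by argo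
    then have "\<sigma>\<^sup>2 \<le> (d - V) / b" using b by (simp add: field_simps)
    then have \<sigma>: "\<sigma> \<le> sqrt ((d - V) / b)" by (rule real_le_rsqrt)
    \<comment> \<open>\<open>U\<close> is at most the average for \<open>f\<close>, and the supremum
      of \<open>f\<close> is at most \<open>g S + d\<close>, so the infimum of \<open>f\<close>
      cannot be small. On the other side \<open>g (h y)\<close> exceeds \<open>g I\<close> by at
      most the oscillation \<open>2 * \<sigma>\<close> of \<open>h\<close>.\<close>
    have "d - 2 * (d - V) - 2 * sqrt ((d - V) / b) \<le> f y - g (h y)" if y: "y \<in> ball x \<epsilon>" for y
    proof -
      have "I \<le> h y" "h y \<le> S" unfolding I_def S_def using binf_lower[OF h y] bsup_upper[OF h y] by auto
      then have "g (h y) - g I \<le> 2 * \<sigma>" using gm(3)[of I "h y"] h[OF y] SI \<sigma>_def by auto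
      moreover have "binf \<epsilon> f x \<le> f y" using binf_lower[OF f y] .
      ultimately show ?thesis using U2 Sf gW \<open>0 \<le> b * \<sigma>\<^sup>2\<close> \<sigma> unfolding V_def by argo
    qed
    then show ?thesis using dV \<open>0 \<le> b * \<sigma>\<^sup>2\<close> by auto
  next
    case False
    then have W0: "0 \<le> W" "S - \<epsilon> \<le> W" using Wd unfolding dpp_def S_def[symmetric] I_def[symmetric]
      by (auto simp: min_le_iff_disj)
    show ?thesis
    proof (cases "U \<le> 0")
      case True
      have "(W + (C + 1))\<^sup>2 \<le> (2 * C + 1)\<^sup>2" using W W0 by (intro power_mono) auto
      then have "b * (W + (C + 1))\<^sup>2 \<le> b * (2 * C + 1)\<^sup>2" using b by simp
      then show ?thesis using True W0 unfolding V_def g_def by argo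
    next
      case False
      then have "U \<le> bsup \<epsilon> f x - \<epsilon>" using U unfolding dpp_def by auto
      moreover have "g S - g W \<le> (1 - 2 * b) * \<epsilon>"
      proof (cases "W \<le> S")
        case True
        have "2 * b * 1 \<le> 2 * b * (2 * C + 1)" using b C by (intro mult_left_mono) auto
        then have "2 * b \<le> 1" using b by linarith
        then have "(1 - 2 * b) * (S - W) \<le> (1 - 2 * b) * \<epsilon>" using W0 b by (intro mult_left_mono) auto
        then show ?thesis using gm(2)[OF True] W SI by auto
      next
        case False
        have "2 * b * 1 \<le> 2 * b * (2 * C + 1)" using b C by (intro mult_left_mono) auto
        then have "2 * b \<le> 1" using b by linarith
        then have "0 \<le> (1 - 2 * b) * \<epsilon>" using e by simp
        then show ?thesis using gm(1)[of S W] False W SI by auto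
      qed
      ultimately have "V \<le> d - 2 * b * \<epsilon>" using Sf unfolding V_def by (simp add: algebra_simps)
      then show ?thesis by blast
    qed
  qed
qed

text \<open>The suprema \<open>d n\<close> of the transformed difference decrease to a limit
  \<open>L\<close>. A value close to \<open>L\<close> at time \<open>n + K\<close> is inherited at
  time \<open>n + K - 1\<close>, with a worse tolerance, by every point of the ball. So one may walk
  in a fixed direction while time runs backwards, until \<open>D\<close> is left; but there the
  difference is at most \<open>\<kappa> < L\<close>.\<close>

theorem dpp_iterates_comparison:
  fixes u w :: "nat \<Rightarrow> 'a::euclidean_space \<Rightarrow> real"
  assumes e: "0 < \<epsilon>" and D: "bounded D"
    and u: "\<And>n x y. x \<in> D \<Longrightarrow> y \<in> ball x \<epsilon> \<Longrightarrow> \<bar>u n y\<bar> \<le> C"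
    and w: "\<And>n x y. x \<in> D \<Longrightarrow> y \<in> ball x \<epsilon> \<Longrightarrow> \<bar>w n y\<bar> \<le> C"
    and sub: "\<And>n x. x \<in> D \<Longrightarrow> u (Suc n) x \<le> dpp \<epsilon> (u n) x"
    and super: "\<And>n x. x \<in> D \<Longrightarrow> dpp \<epsilon> (w n) x \<le> w (Suc n) x"
    and bd: "\<And>n x y. x \<in> D \<Longrightarrow> y \<in> ball x \<epsilon> \<Longrightarrow> y \<notin> D \<Longrightarrow> u n y \<le> w n y"
    and m: "0 < m"
  shows "\<exists>N. \<forall>n\<ge>N. \<forall>x\<in>D. u n x \<le> w n x + m"
proof (rule ccontr)
  assume neg: "\<not> ?thesis"
  then obtain x0 where x0: "x0 \<in> D" by blast
  have C: "0 \<le> C" using u[OF x0, of x0 0] e by force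
  \<comment> \<open>The first entry keeps \<open>g\<close> nondecreasing on \<open>[- C, C]\<close>;
    the second gives \<open>\<kappa> \<le> m / 2\<close>, so that the transformation moves values by
    less than \<open>m\<close>.\<close>
  define b where "b = min (1 / (2 * (2 * C + 1))) (m / (2 * (2 * C + 1)\<^sup>2))"
  have b: "0 < b" using C m unfolding b_def by (auto intro!: divide_pos_pos mult_pos_pos)
  have "b * (2 * (2 * C + 1)) \<le> 1" using C unfolding b_def by (subst pos_le_divide_eq[symmetric]) auto
  then have b1: "2 * b * (2 * C + 1) \<le> 1" by (simp add: algebra_simps)
  define \<kappa> where "\<kappa> = b * (2 * C + 1)\<^sup>2"
  have "b * (2 * (2 * C + 1)\<^sup>2) \<le> m" using C unfolding b_def by (subst pos_le_divide_eq[symmetric]) auto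
  then have \<kappa>: "\<kappa> < m" unfolding \<kappa>_def using m by simp
  define g where "g = (\<lambda>t. t - b * (t + (C + 1))\<^sup>2)"
  define V where "V = (\<lambda>n y. u n y - g (w n y))"
  define E where "E = (\<Union>x\<in>D. ball x \<epsilon>)"
  have DE: "D \<subseteq> E" unfolding E_def using e by auto
  have g_bound: "t - g t \<le> \<kappa>" "g t \<le> t" if "\<bar>t\<bar> \<le> C" for t
  proof -
    have "(t + (C + 1))\<^sup>2 \<le> (2 * C + 1)\<^sup>2" using that by (intro power_mono) auto
    then show "t - g t \<le> \<kappa>" unfolding g_def \<kappa>_def using b by simp
    show "g t \<le> t" unfolding g_def using b by simp
  qed
  have uE: "\<bar>u n y\<bar> \<le> C" and wE: "\<bar>w n y\<bar> \<le> C" if "y \<in> E" for n y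
    using that u w unfolding E_def by auto
  have V_outside: "V n y \<le> \<kappa>" if "y \<in> E" "y \<notin> D" for n y
    using bd[of _ y n] that g_bound(1)[OF wE[OF that(1), of n]] unfolding E_def V_def by force
  have V_bdd: "V n y \<le> 2 * C + \<kappa>" if "y \<in> E" for n y
    using uE[OF that, of n] wE[OF that, of n] g_bound(1)[OF wE[OF that, of n]] unfolding V_def by linarith
  define d where "d n = (SUP y\<in>E. V n y)" for n
  have Vd: "V n y \<le> d n" if "y \<in> E" for n y
    unfolding d_def by (rule cSUP_upper[OF that]) (use V_bdd in \<open>auto intro!: bdd_aboveI[of _ "2 * C + \<kappa>"]\<close>)
  have step: "V (Suc n) x \<le> \<kappa> \<or> V (Suc n) x \<le> d n - 2 * b * \<epsilon> \<or>
    V (Suc n) x \<le> d n \<and> (\<forall>y\<in>ball x \<epsilon>. d n - 2 * (d n - V (Suc n) x) - 2 * sqrt ((d n - V (Suc n) x) / b) \<le> V n y)"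
    if x: "x \<in> D" for n x
  proof -
    have "y \<in> E" if "y \<in> ball x \<epsilon>" for y using that x unfolding E_def by blast
    then show ?thesis
      using u[OF x] w[OF x] wE[of x "Suc n"] DE sub[OF x, of n] super[OF x, of n] x Vd[of _ n]
      unfolding V_def g_def \<kappa>_def by (intro dpp_comparison_step[OF e b b1]) blast+
  qed
  have V_le: "V (Suc n) x \<le> max \<kappa> (d n)" if x: "x \<in> E" for n x
  proof (cases "x \<in> D")
    case True
    moreover have "0 < 2 * b * \<epsilon>" using b e by simp
    ultimately show ?thesis using step[of x n] by linarith
  next
    case False
    then show ?thesis using V_outside[OF x] by (simp add: le_max_iff_disj)
  qed
  have EN: "E \<noteq> {}" using x0 DE by auto
  have dec: "max \<kappa> (d (Suc n)) \<le> max \<kappa> (d n)" for n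
    unfolding d_def[of "Suc n"] using V_le by (auto intro!: cSUP_least[OF EN])
  have big: "m < max \<kappa> (d n)" for n
  proof -
    obtain k x where kx: "k \<ge> n" "x \<in> D" "u k x > w k x + m" using neg by (meson not_le_imp_less)
    have "m < V k x" using kx g_bound(2)[OF wE] DE unfolding V_def by (smt (verit) subsetD)
    also have "\<dots> \<le> d k" using Vd DE kx by auto
    also have "\<dots> \<le> max \<kappa> (d k)" by simp
    also have "\<dots> \<le> max \<kappa> (d n)" using lift_Suc_antimono_le[of "\<lambda>n. max \<kappa> (d n)"] dec kx(1) by blast
    finally show ?thesis .
  qed
  then have d_max: "max \<kappa> (d n) = d n" for n using \<kappa> by (smt (verit))
  have d_dec: "d k \<le> d n" if "n \<le> k" for n k
    using lift_Suc_antimono_le[of d] dec that unfolding d_max by blast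
  define L where "L = (INF n. d n)"
  have bd_d: "bdd_below (range d)" using big unfolding d_max by (auto intro!: bdd_belowI[of _ m] less_imp_le)
  have Ld: "L \<le> d n" for n unfolding L_def by (rule cINF_lower[OF bd_d]) auto
  have "m \<le> L" unfolding L_def by (rule cINF_greatest) (use big in \<open>auto simp: d_max less_imp_le\<close>)
  then have L\<kappa>: "\<kappa> < L" using \<kappa> by linarith
  obtain i :: 'a where i: "i \<in> Basis" using nonempty_Basis by blast
  define s where "s = (\<epsilon> / 2) *\<^sub>R i"
  have s: "norm s = \<epsilon> / 2" using i e unfolding s_def by simp
  \<comment> \<open>The tolerance \<open>a\<close> shrinks with \<open>K\<close> but does not depend
    on \<open>n\<close> and \<open>x\<close>; boundedness of \<open>D\<close> will allow one fixed
    \<open>K\<close>.\<close>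
  have chain: "\<exists>a>0. \<forall>n. \<forall>x\<in>D. d n \<le> L + a \<longrightarrow> L - a \<le> V (n + K) x \<longrightarrow> x + real K *\<^sub>R s \<in> D" for K
  proof (induction K)
    case 0
    show ?case by (intro exI[of _ 1]) auto
  next
    case (Suc K)
    then obtain a1 where a1: "a1 > 0"
      "\<And>n x. x \<in> D \<Longrightarrow> d n \<le> L + a1 \<Longrightarrow> L - a1 \<le> V (n + K) x \<Longrightarrow> x + real K *\<^sub>R s \<in> D" by blast
    \<comment> \<open>\<open>a2\<close> keeps the next value above \<open>\<kappa>\<close> and hence
      the next point in \<open>D\<close>. The first two entries of \<open>a\<close> bound each of
      the two losses in the third alternative by \<open>a2 / 2\<close>; the last one excludes a drop
      by \<open>2 * b * \<epsilon>\<close>.\<close>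
    define a2 where "a2 = min a1 ((L - \<kappa>) / 2)"
    have a2: "0 < a2" "a2 \<le> a1" "a2 < L - \<kappa>" unfolding a2_def using a1 L\<kappa> by (auto simp: min_def field_simps)
    define a where "a = Min {a2 / 8, b * a2\<^sup>2 / 32, b * \<epsilon> / 2}"
    have a: "0 < a" "a \<le> a2 / 8" "a \<le> b * a2\<^sup>2 / 32" "a \<le> b * \<epsilon> / 2"
      unfolding a_def using a2 b e by auto
    have "sqrt (2 * a / b) \<le> sqrt ((a2 / 4)\<^sup>2)"
      using a(3) b by (intro real_sqrt_le_mono) (simp add: field_simps power2_eq_square)
    then have sq: "2 * sqrt (2 * a / b) \<le> a2 / 2" using a2 by simp
    show ?case
    proof (intro exI[of _ a] conjI allI ballI impI a(1))
      fix n x assume x: "x \<in> D" and dn: "d n \<le> L + a" and Vx: "L - a \<le> V (n + Suc K) x"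
      let ?y = "x + s" and ?v = "V (Suc (n + K)) x" and ?d = "d (n + K)"
      have dk: "?d \<le> L + a" using d_dec[of n "n + K"] dn by simp
      have be: "0 < b * \<epsilon>" using b e by simp
      have Vx': "L - a \<le> ?v" using Vx by simp
      have "\<not> ?v \<le> \<kappa>" using Vx' a2 a by linarith
      moreover have "\<not> ?v \<le> ?d - 2 * b * \<epsilon>" using Vx' dk a be by argo
      moreover have yb: "?y \<in> ball x \<epsilon>" using s e by (simp add: dist_norm)
      ultimately have lo: "?d - 2 * (?d - ?v) - 2 * sqrt ((?d - ?v) / b) \<le> V (n + K) ?y"
        using step[OF x, of "n + K"] by blast
      have "sqrt ((?d - ?v) / b) \<le> sqrt (2 * a / b)"
        using Vx' dk b by (intro real_sqrt_le_mono divide_right_mono) auto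
      then have V2: "L - a2 \<le> V (n + K) ?y" using lo sq Vx' dk Ld[of "n + K"] a by argo
      have "?y \<in> E" using x yb unfolding E_def by blast
      then have yD: "?y \<in> D" using V_outside[of ?y "n + K"] V2 a2 by force
      have "?y + real K *\<^sub>R s \<in> D" by (rule a1(2)[of _ n, OF yD]) (use dn V2 a2 a in auto)
      then show "x + real (Suc K) *\<^sub>R s \<in> D" by (simp add: algebra_simps)
    qed
  qed
  obtain B where B: "\<And>x. x \<in> D \<Longrightarrow> norm x \<le> B" using D by (auto simp: bounded_iff)
  \<comment> \<open>No set of points of norm at most \<open>B\<close> contains two points at
    distance \<open>K * (\<epsilon> / 2)\<close>.\<close>
  obtain K :: nat where K: "2 * B < real K * (\<epsilon> / 2)"
    using reals_Archimedean3[of "\<epsilon> / 2"] e by (metis half_gt_zero)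
  obtain a where a: "a > 0"
    "\<And>n x. x \<in> D \<Longrightarrow> d n \<le> L + a \<Longrightarrow> L - a \<le> V (n + K) x \<Longrightarrow> x + real K *\<^sub>R s \<in> D"
    using chain[of K] by blast
  obtain n where n: "d n < L + a"
    using a(1) cINF_less_iff[OF _ bd_d, of "L + a"] unfolding L_def by auto
  \<comment> \<open>Exceeding \<open>\<kappa>\<close> as well places the almost maximal point in
    \<open>D\<close>.\<close>
  define c where "c = max \<kappa> (L - a)"
  have "c < d (n + K)" using Ld[of "n + K"] L\<kappa> a unfolding c_def by auto
  then obtain x where x: "x \<in> E" "c < V (n + K) x"
    unfolding d_def by (subst (asm) less_cSUP_iff[OF EN]) (use V_bdd in \<open>auto intro!: bdd_aboveI[of _ "2 * C + \<kappa>"]\<close>)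
  then have xD: "x \<in> D" using V_outside[of x "n + K"] unfolding c_def by force
  have "x + real K *\<^sub>R s \<in> D" using a(2)[OF xD, of n] n x unfolding c_def by auto
  moreover have "norm (real K *\<^sub>R s) \<le> norm (x + real K *\<^sub>R s) + norm x"
    by (metis add_diff_cancel_left' norm_triangle_ineq4)
  ultimately have "real K * (\<epsilon> / 2) \<le> 2 * B" using B[of "x + real K *\<^sub>R s"] B[OF xD] s by simp
  then show False using K by simp
qed

corollary dpp_comparison:
  fixes u w :: "'a::euclidean_space \<Rightarrow> real"
  assumes e: "0 < \<epsilon>" and D: "bounded D"
    and u: "\<And>x y. x \<in> D \<Longrightarrow> y \<in> ball x \<epsilon> \<Longrightarrow> \<bar>u y\<bar> \<le> C"
    and w: "\<And>x y. x \<in> D \<Longrightarrow> y \<in> ball x \<epsilon> \<Longrightarrow> \<bar>w y\<bar> \<le> C"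
    and sub: "\<And>x. x \<in> D \<Longrightarrow> u x \<le> dpp \<epsilon> u x"
    and super: "\<And>x. x \<in> D \<Longrightarrow> dpp \<epsilon> w x \<le> w x"
    and bd: "\<And>x y. x \<in> D \<Longrightarrow> y \<in> ball x \<epsilon> \<Longrightarrow> y \<notin> D \<Longrightarrow> u y \<le> w y"
    and x: "x \<in> D"
  shows "u x \<le> w x"
proof (rule field_le_epsilon)
  fix m :: real assume "0 < m"
  then have "\<exists>N. \<forall>n\<ge>N. \<forall>x\<in>D. (\<lambda>_::nat. u) n x \<le> (\<lambda>_. w) n x + m"
    by (intro dpp_iterates_comparison[OF e D]) (use assms in auto)
  then show "u x \<le> w x + m" using x by blast
qed

subsection \<open>Measurable selections and the law of the game\<close>

text \<open>Total version of the terminal payoff, since the values of \<open>F\<close> off the strip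
  are arbitrary; it vanishes inside the domain, where leaving pays nothing.\<close>

definition strip_payoff :: "'a::euclidean_space set \<Rightarrow> real \<Rightarrow> ('a \<Rightarrow> real) \<Rightarrow> 'a \<Rightarrow> real" where
  "strip_payoff \<Omega> \<epsilon> F x = (if x \<in> outer_strip \<Omega> \<epsilon> then F x else 0)"

text \<open>Whether the supremum over an open ball exceeds \<open>c\<close> is decided by a single
  point of the ball, and being within \<open>\<epsilon>\<close> of that point is an open condition.
  Hence \<open>bsup\<close> is Borel for an arbitrary bounded function, and with it the
  operator.\<close>

lemma bsup_superlevel:
  assumes "0 < \<epsilon>" "\<And>y. \<bar>f y\<bar> \<le> C"
  shows "{x. c < bsup \<epsilon> f x} = (\<Union>y\<in>{y. c < f y}. ball y \<epsilon>)"
proof (intro equalityI subsetI)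
  fix x assume "x \<in> {x. c < bsup \<epsilon> f x}"
  then show "x \<in> (\<Union>y\<in>{y. c < f y}. ball y \<epsilon>)"
    using bsup_approx[OF assms(1), of c f x] by (auto simp: dist_commute)
next
  fix x assume "x \<in> (\<Union>y\<in>{y. c < f y}. ball y \<epsilon>)"
  then obtain y where "c < f y" "y \<in> ball x \<epsilon>" by (auto simp: dist_commute)
  then show "x \<in> {x. c < bsup \<epsilon> f x}" using bsup_upper[of x \<epsilon> f C y] assms(2) by force
qed

lemma borel_measurable_bsup:
  assumes "0 < \<epsilon>" "\<And>y. \<bar>f y\<bar> \<le> C"
  shows "bsup \<epsilon> f \<in> borel_measurable borel"
  unfolding borel_measurable_iff_greater
  by (auto simp: bsup_superlevel[OF assms] intro!: borel_open)

lemma bsup_uminus: "bsup \<epsilon> (\<lambda>y. - f y) x = - binf \<epsilon> f x"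
  unfolding bsup_def binf_def by (simp add: Inf_real_def image_image)

lemma borel_measurable_binf:
  assumes "0 < \<epsilon>" "\<And>y. \<bar>f y\<bar> \<le> C"
  shows "binf \<epsilon> f \<in> borel_measurable borel"
proof -
  have "(\<lambda>x. - bsup \<epsilon> (\<lambda>y. - f y) x) \<in> borel_measurable borel"
    using borel_measurable_bsup[OF assms(1), of "\<lambda>y. - f y" C] assms(2) by simp
  then show ?thesis unfolding bsup_uminus by simp
qed

lemma borel_measurable_dpp:
  assumes "0 < \<epsilon>" "\<And>y. \<bar>f y\<bar> \<le> C"
  shows "dpp \<epsilon> f \<in> borel_measurable borel"
proof -
  note [measurable] = borel_measurable_binf[OF assms] borel_measurable_bsup[OF assms]
  show ?thesis unfolding dpp_def[abs_def] by measurable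
qed

text \<open>
  No regularity of \<open>f\<close> is needed: by the Lindelof property the open balls around the points of
  each superlevel set have a countable subcover, so countably many target points suffice.
\<close>

lemma near_sup_selection:
  fixes f :: "'a::euclidean_space \<Rightarrow> real"
  assumes e: "0 < \<epsilon>" and f: "\<And>y. \<bar>f y\<bar> \<le> C" and "0 < \<eta>"
  shows "\<exists>s\<in>borel_measurable borel. \<forall>x. s x \<in> ball x \<epsilon> \<and> bsup \<epsilon> f x - \<eta> < f (s x)"
proof -
  have "\<exists>T. T \<subseteq> {y. q < f y} \<and> countable T \<and> (\<Union>y\<in>T. ball y \<epsilon>) = (\<Union>y\<in>{y. q < f y}. ball y \<epsilon>)" for q
  proof -
    obtain B where B: "B \<subseteq> (\<lambda>y. ball y \<epsilon>) ` {y. q < f y}" "countable B"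
      "\<Union>B = (\<Union>y\<in>{y. q < f y}. ball y \<epsilon>)"
      using Lindelof[of "(\<lambda>y. ball y \<epsilon>) ` {y. q < f y}"] by auto
    then show ?thesis using countable_subset_image[of B "\<lambda>y. ball y \<epsilon>" "{y. q < f y}"] by metis
  qed
  then obtain T where T: "\<And>q. T q \<subseteq> {y. q < f y}" "\<And>q. countable (T q)"
    "\<And>q. (\<Union>y\<in>T q. ball y \<epsilon>) = (\<Union>y\<in>{y. q < f y}. ball y \<epsilon>)" by metis
  define D where "D = (\<Union>q\<in>\<rat>. T q)"
  have cD: "countable D" unfolding D_def using countable_rat T(2) by auto
  have hit: "\<exists>y\<in>D. y \<in> ball x \<epsilon> \<and> bsup \<epsilon> f x - \<eta> < f y" for x
  proof -
    \<comment> \<open>A rational level strictly below the supremum and above the allowed loss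
      reduces the uncountably many superlevel sets to countably many.\<close>
    obtain q where q: "q \<in> \<rat>" "bsup \<epsilon> f x - \<eta> < q" "q < bsup \<epsilon> f x"
      using Rats_dense_in_real[of "bsup \<epsilon> f x - \<eta>" "bsup \<epsilon> f x"] assms(3) by auto
    have "x \<in> (\<Union>y\<in>T q. ball y \<epsilon>)" unfolding T(3) bsup_superlevel[of \<epsilon> f C q, OF e f, symmetric] using q by simp
    then obtain y where "y \<in> T q" "y \<in> ball x \<epsilon>" by (auto simp: dist_commute)
    then show ?thesis using q T(1)[of q] unfolding D_def by force
  qed
  then have D0: "D \<noteq> {}" by blast
  define d where "d = from_nat_into D"
  have rd: "range d = D" unfolding d_def by (rule range_from_nat_into[OF D0 cD])
  \<comment> \<open>Taking the least admissible index in an enumeration of \<open>D\<close> makes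
    the choice measurable, because each \<open>Q n\<close> is a Borel condition on
    \<open>x\<close>.\<close>
  define Q where "Q n x \<longleftrightarrow> dist x (d n) < \<epsilon> \<and> bsup \<epsilon> f x - \<eta> < f (d n)" for n x
  have Qex: "\<exists>n. Q n x" for x using hit[of x] rd unfolding Q_def by auto
  note [measurable] = borel_measurable_bsup[OF e f]
  have [measurable]: "Measurable.pred borel (Q n)" for n unfolding Q_def[abs_def] by measurable
  have "(\<lambda>x. LEAST n. Q n x) \<in> measurable borel (count_space UNIV)" by measurable
  then have "(\<lambda>x. d (LEAST n. Q n x)) \<in> borel_measurable borel"
    by (rule measurable_compose) simp
  moreover have "Q (LEAST n. Q n x) x" for x using LeastI_ex[OF Qex] .
  then have "d (LEAST n. Q n x) \<in> ball x \<epsilon> \<and> bsup \<epsilon> f x - \<eta> < f (d (LEAST n. Q n x))" for x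
    using Q_def[of "LEAST n. Q n x" x] by simp
  ultimately show ?thesis by (intro bexI[of _ "\<lambda>x. d (LEAST n. Q n x)"]) auto
qed

lemma near_inf_selection:
  fixes f :: "'a::euclidean_space \<Rightarrow> real"
  assumes e: "0 < \<epsilon>" and f: "\<And>y. \<bar>f y\<bar> \<le> C" and "0 < \<eta>"
  shows "\<exists>s\<in>borel_measurable borel. \<forall>x. s x \<in> ball x \<epsilon> \<and> f (s x) < binf \<epsilon> f x + \<eta>"
proof -
  have "\<exists>s\<in>borel_measurable borel. \<forall>x. s x \<in> ball x \<epsilon> \<and> - binf \<epsilon> f x - \<eta> < - f (s x)"
    using near_sup_selection[OF e, of "\<lambda>y. - f y" C \<eta>] f assms(3) unfolding bsup_uminus by auto
  then show ?thesis by (auto simp: algebra_simps)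
qed

section \<open>The law of the trajectory for a fixed pair of policies\<close>

locale game_run =
  fixes \<Omega> :: "'a::euclidean_space set" and \<epsilon> :: real and S1 S2 :: "'a strategy"
    and \<theta>1 \<theta>2 :: "'a decision" and x0 :: 'a
  assumes \<Omega>[measurable]: "\<Omega> \<in> sets borel" and P1: "(S1, \<theta>1) \<in> policies \<epsilon>" and P2: "(S2, \<theta>2) \<in> policies \<epsilon>"
begin

sublocale IT: Ionescu_Tulcea "transition \<Omega> S1 \<theta>1 S2 \<theta>2 x0" "\<lambda>_. borel"
  by (rule Ionescu_Tulcea_transition[OF \<Omega> P1 P2])

abbreviation "M \<equiv> game_measure \<Omega> S1 \<theta>1 S2 \<theta>2 x0"
abbreviation "ends \<equiv> ends_at \<Omega> \<theta>1 \<theta>2"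

definition alive :: "nat \<Rightarrow> (nat \<Rightarrow> 'a) \<Rightarrow> bool" where
  "alive k h \<longleftrightarrow> (\<forall>j\<le>k. \<not> ends h j)"

lemma sets_M: "sets M = sets (PiM UNIV (\<lambda>_. borel))"
  unfolding game_measure_def by simp

lemma space_M: "space M = UNIV"
  using sets_eq_imp_space_eq[OF sets_M] by (simp add: space_PiM)

lemma measurable_hist_M: "hist k \<in> measurable M (histories k)"
  unfolding measurable_cong_sets[OF sets_M refl] hist_def by (intro measurable_restrict) auto

text \<open>The marginals of the projective limit on initial segments are iterated kernels, so
  expectations of functions of a partial history can be computed one transition at a time.\<close>

lemma hist_law: "distr M (histories k) (hist k) = IT.C 0 (Suc k) (\<lambda>_. undefined)"
proof -
  have up: "IT.up_to {0..<Suc k} = Suc k"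
    using IT.up_to_iff[of "{0..<Suc k}" "Suc k"] IT.up_to_less[of "{0..<Suc k}" k] by auto
  have eq: "hist k = (\<lambda>\<omega>. restrict \<omega> {0..<Suc k})" by (simp add: hist_def fun_eq_iff)
  have "distr M (histories k) (hist k) = IT.CI {0..<Suc k}"
    unfolding game_measure_def eq by (rule IT.distr_lim) simp
  also have "\<dots> = IT.C 0 (Suc k) (\<lambda>_. undefined)"
    unfolding IT.CI_def up using IT.distr_C[of "Suc k" "Suc k" "\<lambda>_. undefined" 0] by simp
  finally show ?thesis .
qed

lemma prob_space_M: "prob_space M"
proof (rule prob_space_distrD[OF measurable_hist_M])
  show "prob_space (distr M (histories 0) (hist 0))"
    unfolding hist_law by (rule IT.prob_space_C) simp
qed

lemma hist_hist: "j \<le> k \<Longrightarrow> hist j (hist k \<omega>) = hist j \<omega>"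
  by (auto simp: hist_def fun_eq_iff)

lemma hist_apply: "j \<le> k \<Longrightarrow> hist k \<omega> j = \<omega> j"
  by (simp add: hist_def)

lemma hist_upd: "h \<in> space (histories k) \<Longrightarrow> j \<le> k \<Longrightarrow> hist j (h(Suc k := y)) = hist j h"
  by (auto simp: hist_def fun_eq_iff)

lemma hist_id: "h \<in> space (histories k) \<Longrightarrow> hist k h = h"
  unfolding hist_def space_PiM by (auto simp: PiE_iff extensional_restrict)

lemma ends_hist: "j \<le> k \<Longrightarrow> ends (hist k \<omega>) j = ends \<omega> j"
  by (simp add: ends_at_def hist_hist hist_apply)

lemma ends_upd: "h \<in> space (histories k) \<Longrightarrow> j \<le> k \<Longrightarrow> ends (h(Suc k := y)) j = ends h j"
  by (simp add: ends_at_def hist_upd)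

lemma alive_hist: "j \<le> k \<Longrightarrow> alive j (hist k \<omega>) = alive j \<omega>"
  by (auto simp: alive_def ends_hist)

lemma alive_upd: "h \<in> space (histories k) \<Longrightarrow> j \<le> k \<Longrightarrow> alive j (h(Suc k := y)) = alive j h"
  by (auto simp: alive_def ends_upd)

lemma pred_ends: "j \<le> k \<Longrightarrow> Measurable.pred (histories k) (\<lambda>h. ends h j)"
  by (rule measurable_ends_at[OF \<Omega> _ P1 P2])

lemma pred_alive: "j \<le> k \<Longrightarrow> Measurable.pred (histories k) (alive j)"
proof -
  assume "j \<le> k"
  then have "Measurable.pred (histories k) (\<lambda>h. \<forall>i\<in>{..j}. \<not> ends h i)"
    by (intro pred_intros_finite pred_intros_logic pred_ends) auto
  moreover have "alive j = (\<lambda>h. \<forall>i\<in>{..j}. \<not> ends h i)"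
    unfolding fun_eq_iff alive_def by blast
  ultimately show ?thesis by (simp only:)
qed

lemma pred_decision2: "j \<le> k \<Longrightarrow> Measurable.pred (histories k) (\<lambda>h. \<theta>2 j (hist j h))"
  using P2 measurable_compose[OF measurable_hist] unfolding policies_def by blast

lemma measurable_coord: "j \<le> k \<Longrightarrow> (\<lambda>h. h j) \<in> borel_measurable (histories k)"
  by (intro measurable_component_singleton) auto

lemma integrable_hist:
  fixes f :: "_ \<Rightarrow> real"
  assumes "f \<in> borel_measurable (histories k)" "\<And>h. \<bar>f h\<bar> \<le> B"
  shows "integrable M (\<lambda>\<omega>. f (hist k \<omega>))"
proof -
  interpret prob_space M by (rule prob_space_M)
  show ?thesis
    using assms measurable_compose[OF measurable_hist_M assms(1)] by (intro integrable_const_bound[of _ B]) auto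
qed

lemma integral_transition:
  fixes g :: "'a \<Rightarrow> real"
  assumes h: "h \<in> space (histories k)" and g: "g \<in> borel_measurable borel"
  shows "(\<integral>y. g y \<partial>transition \<Omega> S1 \<theta>1 S2 \<theta>2 x0 (Suc k) h) =
    (if \<not> alive k h then g (h k) else if \<theta>2 k h then g (S1 k h) else (g (S1 k h) + g (S2 k h)) / 2)"
proof -
  have "(\<integral>y. g y \<partial>distr (measure_pmf (bernoulli_pmf (1/2))) borel (\<lambda>b. if b then S1 k h else S2 k h))
      = (\<integral>b. g (if b then S1 k h else S2 k h) \<partial>measure_pmf (bernoulli_pmf (1/2)))"
    using g by (subst integral_distr) auto
  also have "\<dots> = (g (S1 k h) + g (S2 k h)) / 2"
    by (subst integral_bernoulli_pmf) (auto simp: field_simps)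
  finally show ?thesis using g by (auto simp: alive_def integral_return)
qed

lemma expectation_step:
  fixes f0 f1 :: "_ \<Rightarrow> real"
  assumes f0: "f0 \<in> borel_measurable (histories k)" "\<And>h. \<bar>f0 h\<bar> \<le> B"
    and f1: "f1 \<in> borel_measurable (histories (Suc k))" "\<And>h. \<bar>f1 h\<bar> \<le> B"
    and dead: "\<And>h. h \<in> space (histories k) \<Longrightarrow> \<not> alive k h \<Longrightarrow> f0 h \<le> f1 (h(Suc k := h k))"
    and pass: "\<And>h. h \<in> space (histories k) \<Longrightarrow> alive k h \<Longrightarrow> \<theta>2 k h \<Longrightarrow> f0 h \<le> f1 (h(Suc k := S1 k h))"
    and tug: "\<And>h. h \<in> space (histories k) \<Longrightarrow> alive k h \<Longrightarrow> \<not> \<theta>2 k h \<Longrightarrow>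
      f0 h \<le> (f1 (h(Suc k := S1 k h)) + f1 (h(Suc k := S2 k h))) / 2"
  shows "(\<integral>\<omega>. f0 (hist k \<omega>) \<partial>M) \<le> (\<integral>\<omega>. f1 (hist (Suc k) \<omega>) \<partial>M)"
proof -
  define C where "C = distr M (histories k) (hist k)"
  interpret C: prob_space C
    unfolding C_def by (intro prob_space.prob_space_distr prob_space_M measurable_hist_M)
  have setsC: "sets C = sets (histories k)" and spaceC: "space C = space (histories k)"
    unfolding C_def by auto
  have eP: "IT.eP (Suc k) \<in> measurable C (subprob_algebra (histories (Suc k)))"
    unfolding measurable_cong_sets[OF setsC refl] by (rule IT.measurable_eP)
  have meas: "(\<lambda>h. \<integral>y. f1 y \<partial>IT.eP (Suc k) h) \<in> borel_measurable C"
    by (rule measurable_compose[OF eP integral_measurable_subprob_algebra[OF f1(1)]])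
  have upd: "(\<lambda>y. h(Suc k := y)) \<in> measurable borel (histories (Suc k))" if h: "h \<in> space (histories k)" for h
    by (rule measurable_fun_upd[where J="{0..<Suc k}"]) (use h in auto)
  have kernel: "(\<integral>y. f1 y \<partial>IT.eP (Suc k) h) =
      (\<integral>y. f1 (h(Suc k := y)) \<partial>transition \<Omega> S1 \<theta>1 S2 \<theta>2 x0 (Suc k) h)"
    if h: "h \<in> space (histories k)" for h
    unfolding IT.eP_def
  proof (rule integral_distr[OF _ f1(1)])
    show "fun_upd h (Suc k) \<in> measurable (transition \<Omega> S1 \<theta>1 S2 \<theta>2 x0 (Suc k) h) (histories (Suc k))"
      unfolding measurable_cong_sets[OF IT.sets_P[OF h] refl] by (rule upd[OF h])
  qed
  have "(\<integral>\<omega>. f0 (hist k \<omega>) \<partial>M) = (\<integral>h. f0 h \<partial>C)"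
    unfolding C_def by (rule integral_distr[symmetric, OF measurable_hist_M f0(1)])
  also have "\<dots> \<le> (\<integral>h. (\<integral>y. f1 y \<partial>IT.eP (Suc k) h) \<partial>C)"
  proof (rule integral_mono)
    show "integrable C f0"
      by (rule C.integrable_const_bound[of _ B]) (use f0 in \<open>auto simp: measurable_cong_sets[OF setsC refl]\<close>)
    show "integrable C (\<lambda>h. \<integral>y. f1 y \<partial>IT.eP (Suc k) h)"
    proof (rule C.integrable_const_bound[of _ B, OF _ meas], rule AE_I2)
      fix h assume "h \<in> space C"
      then have h: "h \<in> space (histories k)" by (simp only: spaceC)
      interpret p: prob_space "IT.eP (Suc k) h" by (rule IT.prob_space_eP[OF h])
      have "integrable (IT.eP (Suc k) h) f1"
        by (rule p.integrable_const_bound[of _ B])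
          (use f1 in \<open>auto simp only: measurable_cong_sets[OF IT.sets_eP[OF h] refl] real_norm_def intro!: AE_I2\<close>)
      then have "\<bar>\<integral>y. f1 y \<partial>IT.eP (Suc k) h\<bar> \<le> (\<integral>y. \<bar>f1 y\<bar> \<partial>IT.eP (Suc k) h)"
        by (intro integral_abs_bound)
      also have "\<dots> \<le> (\<integral>y. B \<partial>IT.eP (Suc k) h)"
        by (rule integral_mono) (use \<open>integrable (IT.eP (Suc k) h) f1\<close> f1 in auto)
      also have "\<dots> = B" by (simp only: lebesgue_integral_const p.prob_space) simp
      finally show "norm (\<integral>y. f1 y \<partial>IT.eP (Suc k) h) \<le> B" by simp
    qed
    fix h assume "h \<in> space C"
    then have h: "h \<in> space (histories k)" by (simp only: spaceC)
    show "f0 h \<le> (\<integral>y. f1 y \<partial>IT.eP (Suc k) h)"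
      unfolding kernel[OF h] integral_transition[OF h measurable_compose[OF upd[OF h] f1(1)]]
      using dead[OF h] pass[OF h] tug[OF h] by auto
  qed
  also have "\<dots> = (\<integral>h. f1 h \<partial>(C \<bind> IT.eP (Suc k)))"
  proof (rule integral_bind[symmetric, OF f1(1) f1(2) eP, of 1])
    show "AE h in C. emeasure (IT.eP (Suc k) h) (space (IT.eP (Suc k) h)) \<le> ennreal 1"
      using prob_space.emeasure_space_1[OF IT.prob_space_eP, of _ "Suc k"] by (intro AE_I2) (simp only: spaceC, simp)
  qed unfold_locales
  also have "C \<bind> IT.eP (Suc k) = distr M (histories (Suc k)) (hist (Suc k))"
    unfolding hist_law C_def IT.C.simps(2)[of 0 "Suc k"] add_0 ..
  also have "(\<integral>h. f1 h \<partial>distr M (histories (Suc k)) (hist (Suc k))) = (\<integral>\<omega>. f1 (hist (Suc k) \<omega>) \<partial>M)"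
    by (rule integral_distr[OF measurable_hist_M f1(1)])
  finally show ?thesis .
qed

lemma expectation_start:
  fixes f :: "_ \<Rightarrow> real"
  assumes f: "f \<in> borel_measurable (histories 0)"
  shows "(\<integral>\<omega>. f (hist 0 \<omega>) \<partial>M) = f (\<lambda>i\<in>{0..<Suc 0}. x0)"
proof -
  have "IT.C 0 (Suc 0) (\<lambda>_. undefined) = return (PiM {0..<0} (\<lambda>_. borel)) (\<lambda>_. undefined) \<bind> IT.eP 0"
    by simp
  also have "\<dots> = IT.eP 0 (\<lambda>_. undefined)"
    by (rule bind_return[OF IT.measurable_eP]) simp
  finally have "distr M (histories 0) (hist 0) = IT.eP 0 (\<lambda>_. undefined)" using hist_law[of 0] by simp
  then have "(\<integral>\<omega>. f (hist 0 \<omega>) \<partial>M) = (\<integral>h. f h \<partial>IT.eP 0 (\<lambda>_. undefined))"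
    using integral_distr[OF measurable_hist_M f] by simp
  also have "\<dots> = (\<integral>y. f ((\<lambda>_. undefined)(0 := y)) \<partial>return borel x0)"
    unfolding IT.eP_def transition.simps
    by (rule integral_distr[OF _ f], rule measurable_fun_upd[where J="{0..<0}"]) auto
  also have "\<dots> = f ((\<lambda>_. undefined)(0 := x0))"
  proof (rule integral_return)
    have "(\<lambda>y. (\<lambda>_. undefined)(0 := y)) \<in> measurable borel (histories 0)"
      by (rule measurable_fun_upd[where J="{0..<0}"]) auto
    then show "(\<lambda>y. f ((\<lambda>_. undefined)(0 := y))) \<in> borel_measurable borel"
      by (rule measurable_compose) (rule f)
  qed simp
  also have "(\<lambda>_. undefined)(0 := x0) = (\<lambda>i\<in>{0..<Suc 0}. x0)" by (auto simp: fun_eq_iff)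
  finally show ?thesis .
qed

end

lemma ereal_expectation_integrable:
  assumes f: "integrable M f"
  shows "ereal_expectation M f = ereal (\<integral>x. f x \<partial>M)"
proof -
  have fin: "(\<integral>\<^sup>+x. ennreal (f x) \<partial>M) < \<infinity>" "(\<integral>\<^sup>+x. ennreal (- f x) \<partial>M) < \<infinity>"
    using f unfolding real_integrable_def by (auto simp: top.not_eq_extremum)
  have "enn2ereal a - enn2ereal b = ereal (enn2real a - enn2real b)" if "a < \<infinity>" "b < \<infinity>" for a b
    using that by (cases a; cases b) (auto simp: enn2ereal_ennreal)
  then show ?thesis
    unfolding ereal_expectation_def real_lebesgue_integral_def[OF f] using fin by blast
qed

section \<open>Potentials along a play and the expected duration\<close>

context game_run
begin

text \<open>Conditions on finitely many positions describe the first ending time as a measurable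
  property of a history; \<open>end_time\<close> is an unspecified number on plays that do not
  end.\<close>

definition first_end :: "nat \<Rightarrow> (nat \<Rightarrow> 'a) \<Rightarrow> bool" where
  "first_end j h \<longleftrightarrow> (\<forall>i<j. \<not> ends h i) \<and> ends h j"

text \<open>While the game is alive, a pass of Player II is the same as a payment of Player I: both
  decision variables being true would have ended the game.\<close>

definition passes :: "nat \<Rightarrow> (nat \<Rightarrow> 'a) \<Rightarrow> real" where
  "passes k h = (\<Sum>j<k. of_bool (alive j h \<and> \<theta>2 j (hist j h)))"

definition alive_time :: "nat \<Rightarrow> (nat \<Rightarrow> 'a) \<Rightarrow> real" where
  "alive_time k h = (\<Sum>j<k. of_bool (alive j h))"

text \<open>This process interpolates between \<open>P 0\<close> at the start and the payoff at the
  end: once the game is over it is the payoff, and before that \<open>P k\<close> at the current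
  position stands in for the payoff still to come.\<close>

definition potential :: "('a \<Rightarrow> real) \<Rightarrow> (nat \<Rightarrow> 'a \<Rightarrow> real) \<Rightarrow> nat \<Rightarrow> (nat \<Rightarrow> 'a) \<Rightarrow> real" where
  "potential F P k h = (\<Sum>j\<le>k. of_bool (first_end j h) * strip_payoff \<Omega> \<epsilon> F (h j))
     + of_bool (alive k h) * P k (h k) - \<epsilon> * passes k h"

lemma end_time_least:
  assumes "\<not> alive k h"
  shows "first_end j h \<longleftrightarrow> j = end_time \<Omega> \<theta>1 \<theta>2 h" "end_time \<Omega> \<theta>1 \<theta>2 h \<le> k"
proof -
  let ?t = "end_time \<Omega> \<theta>1 \<theta>2 h"
  obtain i where i: "i \<le> k" "ends h i" using assms unfolding alive_def by auto
  have t: "ends h ?t" "\<And>m. ends h m \<Longrightarrow> ?t \<le> m" unfolding end_time_def using i by (auto intro: LeastI Least_le)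
  then show "?t \<le> k" using i by force
  show "first_end j h \<longleftrightarrow> j = ?t"
    unfolding first_end_def using t by (metis leD linorder_neqE_nat order_le_less)
qed

lemma sum_first_end:
  "(\<Sum>j\<le>k. of_bool (first_end j h) * g j) = (if alive k h then 0 else g (end_time \<Omega> \<theta>1 \<theta>2 h) :: real)"
proof (cases "alive k h")
  case True
  then have "\<not> first_end j h" if "j \<le> k" for j using that unfolding alive_def first_end_def by auto
  then show ?thesis using True by (auto intro!: sum.neutral)
next
  case False
  then have "(\<Sum>j\<le>k. of_bool (first_end j h) * g j) = (\<Sum>j\<le>k. if j = end_time \<Omega> \<theta>1 \<theta>2 h then g j else 0)"
    using end_time_least(1)[OF False] by (intro sum.cong) auto
  then show ?thesis using False end_time_least(2)[OF False] by (simp add: sum.delta)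
qed

lemma alive_iff_end_time:
  assumes "\<not> alive k h" shows "alive j h \<longleftrightarrow> j < end_time \<Omega> \<theta>1 \<theta>2 h"
  using end_time_least(1)[OF assms, of "end_time \<Omega> \<theta>1 \<theta>2 h"] unfolding alive_def first_end_def
  by (meson leD leI le_less_trans)

lemma potential_dead:
  assumes "\<not> alive k h"
  shows "potential F P k h = payoff \<Omega> F \<epsilon> \<theta>1 \<theta>2 h"
proof -
  let ?t = "end_time \<Omega> \<theta>1 \<theta>2 h"
  have "passes k h = (\<Sum>j<k. if j < ?t then of_bool (\<theta>2 j (hist j h)) else 0)"
    unfolding passes_def alive_iff_end_time[OF assms] by (intro sum.cong) auto
  also have "\<dots> = (\<Sum>j<?t. of_bool (\<theta>2 j (hist j h)))"
  proof -
    have "{j \<in> {..<k}. j < ?t} = {..<?t}" using end_time_least(2)[OF assms] by auto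
    then show ?thesis by (subst sum.inter_filter[symmetric]) simp_all
  qed
  also have "\<dots> = (\<Sum>j<?t. of_bool (\<theta>2 j (hist j h) \<and> \<not> \<theta>1 j (hist j h)))"
  proof (intro sum.cong refl)
    fix j assume "j \<in> {..<?t}"
    then have "\<not> ends h j" using alive_iff_end_time[OF assms, of j] unfolding alive_def by auto
    then show "of_bool (\<theta>2 j (hist j h)) = (of_bool (\<theta>2 j (hist j h) \<and> \<not> \<theta>1 j (hist j h)) :: real)"
      unfolding ends_at_def by auto
  qed
  finally show ?thesis
    using assms unfolding potential_def sum_first_end payoff_def Let_def strip_payoff_def by simp
qed

lemma potential_upd:
  assumes h: "h \<in> space (histories k)"
  shows "\<not> alive k h \<Longrightarrow> potential F P (Suc k) (h(Suc k := y)) = potential F P k h"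
    and "alive k h \<Longrightarrow> potential F P (Suc k) (h(Suc k := y)) = potential F P k h - P k (h k)
      - \<epsilon> * of_bool (\<theta>2 k h) + (if ends (h(Suc k := y)) (Suc k) then strip_payoff \<Omega> \<epsilon> F y else P (Suc k) y)"
    and alive_time_upd: "alive_time (Suc k) (h(Suc k := y)) = alive_time k h + of_bool (alive k h)"
proof -
  let ?h = "h(Suc k := y)"
  have al: "alive (Suc k) ?h \<longleftrightarrow> alive k h \<and> \<not> ends ?h (Suc k)"
    using alive_upd[OF h, of k y] unfolding alive_def by (auto simp: le_Suc_eq)
  have fe: "first_end (Suc k) ?h \<longleftrightarrow> alive k h \<and> ends ?h (Suc k)"
    using alive_upd[OF h, of k y] unfolding alive_def first_end_def by (auto simp: less_Suc_eq_le)
  have fe': "first_end j ?h = first_end j h" if "j \<le> k" for j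
    using that ends_upd[OF h] unfolding first_end_def by auto
  have "(\<Sum>j\<le>k. of_bool (first_end j ?h) * strip_payoff \<Omega> \<epsilon> F (?h j))
      = (\<Sum>j\<le>k. of_bool (first_end j h) * strip_payoff \<Omega> \<epsilon> F (h j))"
    using fe' by (intro sum.cong) auto
  moreover have "(\<Sum>j<k. of_bool (alive j ?h \<and> \<theta>2 j (hist j ?h))) = passes k h"
    unfolding passes_def using alive_upd[OF h] hist_upd[OF h] by (intro sum.cong) auto
  ultimately have eq: "potential F P (Suc k) ?h = (\<Sum>j\<le>k. of_bool (first_end j h) * strip_payoff \<Omega> \<epsilon> F (h j))
      + of_bool (alive k h \<and> ends ?h (Suc k)) * strip_payoff \<Omega> \<epsilon> F y
      + of_bool (alive k h \<and> \<not> ends ?h (Suc k)) * P (Suc k) y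
      - \<epsilon> * (passes k h + of_bool (alive k h \<and> \<theta>2 k h))"
    unfolding potential_def passes_def[of "Suc k"] al sum.atMost_Suc fe sum.lessThan_Suc
    using alive_upd[OF h, of k y] hist_upd[OF h, of k y] hist_id[OF h] by simp
  show "\<not> alive k h \<Longrightarrow> potential F P (Suc k) ?h = potential F P k h"
    using eq unfolding potential_def[of F P k h] by simp
  show "alive k h \<Longrightarrow> potential F P (Suc k) ?h = potential F P k h - P k (h k)
      - \<epsilon> * of_bool (\<theta>2 k h) + (if ends ?h (Suc k) then strip_payoff \<Omega> \<epsilon> F y else P (Suc k) y)"
    using eq unfolding potential_def[of F P k h] by (simp add: algebra_simps)
  have "(\<Sum>j<k. of_bool (alive j ?h)) = alive_time k h"
    unfolding alive_time_def using alive_upd[OF h] by (intro sum.cong) auto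
  then show "alive_time (Suc k) ?h = alive_time k h + of_bool (alive k h)"
    unfolding alive_time_def[of "Suc k"] sum.lessThan_Suc using alive_upd[OF h, of k y] by simp
qed

lemma potential_hist: "potential F P k (hist k \<omega>) = potential F P k \<omega>"
proof -
  have "(\<Sum>j\<le>k. of_bool (first_end j (hist k \<omega>)) * strip_payoff \<Omega> \<epsilon> F (hist k \<omega> j))
      = (\<Sum>j\<le>k. of_bool (first_end j \<omega>) * strip_payoff \<Omega> \<epsilon> F (\<omega> j))"
    by (intro sum.cong) (auto simp: first_end_def ends_hist hist_apply)
  moreover have "passes k (hist k \<omega>) = passes k \<omega>"
    unfolding passes_def by (intro sum.cong) (auto simp: alive_hist hist_hist)
  ultimately show ?thesis unfolding potential_def by (simp add: alive_hist hist_apply)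
qed

lemma alive_time_hist: "alive_time k (hist k \<omega>) = alive_time k \<omega>"
  unfolding alive_time_def by (intro sum.cong) (auto simp: alive_hist)

lemma alive_time_bounds: "0 \<le> alive_time k h" "alive_time k h \<le> real k"
proof -
  show "0 \<le> alive_time k h" unfolding alive_time_def by (intro sum_nonneg) auto
  have "alive_time k h \<le> (\<Sum>j<k. 1)" unfolding alive_time_def by (intro sum_mono) auto
  then show "alive_time k h \<le> real k" by simp
qed

lemma passes_bounds: "0 \<le> passes k h" "passes k h \<le> alive_time k h"
proof -
  show "0 \<le> passes k h" unfolding passes_def by (intro sum_nonneg) simp
  show "passes k h \<le> alive_time k h" unfolding passes_def alive_time_def by (intro sum_mono) simp
qed

lemma measurable_alive_time: "alive_time k \<in> borel_measurable (histories k)"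
proof -
  have [measurable]: "Measurable.pred (histories k) (alive j)" if "j \<in> {..<k}" for j
    using that by (intro pred_alive) auto
  show ?thesis unfolding alive_time_def[abs_def] by measurable
qed

lemma measurable_potential:
  assumes [measurable]: "strip_payoff \<Omega> \<epsilon> F \<in> borel_measurable borel" "\<And>k. P k \<in> borel_measurable borel"
  shows "potential F P k \<in> borel_measurable (histories k)"
proof -
  have 1: "Measurable.pred (histories k) (first_end j)" if "j \<le> k" for j
  proof -
    have "Measurable.pred (histories k) (\<lambda>h. (\<forall>i\<in>{..<j}. \<not> ends h i) \<and> ends h j)"
      using that by (intro pred_intros_logic pred_intros_finite pred_ends) auto
    moreover have "first_end j = (\<lambda>h. (\<forall>i\<in>{..<j}. \<not> ends h i) \<and> ends h j)"
      unfolding fun_eq_iff first_end_def by blast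
    ultimately show ?thesis by (simp only:)
  qed
  have "(\<lambda>h. \<Sum>j\<le>k. of_bool (first_end j h) * strip_payoff \<Omega> \<epsilon> F (h j)) \<in> borel_measurable (histories k)"
  proof (intro borel_measurable_sum borel_measurable_times)
    fix j assume "j \<in> {..k}"
    then have j: "j \<le> k" by simp
    note [measurable] = 1[OF j] measurable_coord[OF j]
    show "(\<lambda>h. of_bool (first_end j h) :: real) \<in> borel_measurable (histories k)"
      "(\<lambda>h. strip_payoff \<Omega> \<epsilon> F (h j)) \<in> borel_measurable (histories k)" by measurable
  qed
  moreover have "(\<lambda>h. of_bool (alive k h) * P k (h k)) \<in> borel_measurable (histories k)"
  proof -
    note [measurable] = pred_alive[of k k, OF le_refl] measurable_coord[of k k, OF le_refl]
    show ?thesis by measurable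
  qed
  moreover have "passes k \<in> borel_measurable (histories k)"
    unfolding passes_def[abs_def]
  proof (intro borel_measurable_sum)
    fix j assume "j \<in> {..<k}"
    then have j: "j \<le> k" by simp
    note [measurable] = pred_alive[OF j] pred_decision2[OF j]
    show "(\<lambda>h. of_bool (alive j h \<and> \<theta>2 j (hist j h)) :: real) \<in> borel_measurable (histories k)" by measurable
  qed
  ultimately show ?thesis unfolding potential_def[abs_def] by measurable
qed

text \<open>Payments only decrease the potential, so the upper bound is uniform in time while the
  lower one depends on the number of passes. This asymmetry is why Player II, but not Player I, has
  to limit the play.\<close>

lemma potential_bounds:
  assumes "0 < \<epsilon>" "\<And>x. \<bar>strip_payoff \<Omega> \<epsilon> F x\<bar> \<le> C" "\<And>k x. \<bar>P k x\<bar> \<le> C"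
  shows "potential F P k h \<le> C" "- C - \<epsilon> * passes k h \<le> potential F P k h"
    "\<bar>potential F P k h\<bar> \<le> C + \<epsilon> * alive_time k h"
proof -
  define A where "A = (if alive k h then P k (h k) else strip_payoff \<Omega> \<epsilon> F (h (end_time \<Omega> \<theta>1 \<theta>2 h)))"
  have A: "\<bar>A\<bar> \<le> C" unfolding A_def using assms by auto
  have eq: "potential F P k h = A - \<epsilon> * passes k h"
    unfolding potential_def sum_first_end A_def by simp
  have p: "0 \<le> \<epsilon> * passes k h" "\<epsilon> * passes k h \<le> \<epsilon> * alive_time k h"
    using passes_bounds assms(1) by (auto intro!: mult_left_mono)
  show "potential F P k h \<le> C" "- C - \<epsilon> * passes k h \<le> potential F P k h"
    "\<bar>potential F P k h\<bar> \<le> C + \<epsilon> * alive_time k h"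
    unfolding eq using A p by auto
qed

lemma terminates_iff: "game_terminates \<Omega> \<theta>1 \<theta>2 \<omega> \<longleftrightarrow> (\<exists>k. \<not> alive k \<omega>)"
  unfolding game_terminates_def alive_def by auto

lemma pred_alive_M: "Measurable.pred M (alive k)"
proof -
  have "Measurable.pred M (\<lambda>\<omega>. alive k (hist k \<omega>))"
    by (rule measurable_compose[OF measurable_hist_M pred_alive[OF le_refl]])
  then show ?thesis by (simp add: alive_hist)
qed

lemma measurable_payoff:
  assumes Fh: "strip_payoff \<Omega> \<epsilon> F \<in> borel_measurable borel"
  shows "payoff \<Omega> F \<epsilon> \<theta>1 \<theta>2 \<in> borel_measurable M"
proof -
  note [measurable] = Fh
  have [measurable]: "Measurable.pred M (\<lambda>\<omega>. ends \<omega> k)" for k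
    using measurable_compose[OF measurable_hist_M pred_ends[OF le_refl], of k] by (simp add: ends_hist)
  have t: "end_time \<Omega> \<theta>1 \<theta>2 \<in> measurable M (count_space UNIV)"
    unfolding end_time_def[abs_def] by measurable
  have "(\<lambda>\<omega>. strip_payoff \<Omega> \<epsilon> F (\<omega> n) - \<epsilon> * (\<Sum>k<n. of_bool (\<theta>2 k (hist k \<omega>) \<and> \<not> \<theta>1 k (hist k \<omega>))))
      \<in> borel_measurable M" for n
  proof -
    have [measurable]: "(\<lambda>\<omega>. \<omega> n) \<in> borel_measurable M"
      unfolding measurable_cong_sets[OF sets_M refl] by (intro measurable_component_singleton) auto
    have [measurable]: "Measurable.pred M (\<lambda>\<omega>. \<theta>1 k (hist k \<omega>))" "Measurable.pred M (\<lambda>\<omega>. \<theta>2 k (hist k \<omega>))" for k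
      using P1 P2 measurable_compose[OF measurable_hist_M] unfolding policies_def by blast+
    show ?thesis by measurable
  qed
  from measurable_compose_countable[OF this t] show ?thesis
    unfolding payoff_def[abs_def] Let_def strip_payoff_def .
qed

text \<open>A bound on the expected live time is summability of the probabilities of still being
  alive. By Borel-Cantelli the game ends almost surely, and the total live time gives an integrable
  majorant for the convergence of the potentials to the payoff.\<close>

lemma expected_payoff_limit:
  assumes e: "0 < \<epsilon>" and Fh: "strip_payoff \<Omega> \<epsilon> F \<in> borel_measurable borel"
    and P: "\<And>k. P k \<in> borel_measurable borel"
    and C: "\<And>x. \<bar>strip_payoff \<Omega> \<epsilon> F x\<bar> \<le> C" "\<And>k x. \<bar>P k x\<bar> \<le> C"
    and bound: "\<And>k. (\<integral>\<omega>. alive_time k (hist k \<omega>) \<partial>M) \<le> B"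
  shows "AE \<omega> in M. game_terminates \<Omega> \<theta>1 \<theta>2 \<omega>" "integrable M (payoff \<Omega> F \<epsilon> \<theta>1 \<theta>2)"
    "(\<lambda>k. \<integral>\<omega>. potential F P k (hist k \<omega>) \<partial>M) \<longlonglongrightarrow> (\<integral>\<omega>. payoff \<Omega> F \<epsilon> \<theta>1 \<theta>2 \<omega> \<partial>M)"
proof -
  interpret prob_space M by (rule prob_space_M)
  note [measurable] = pred_alive_M
  have int: "integrable M (\<lambda>\<omega>. of_bool (alive j \<omega>) :: real)" for j
    by (rule integrable_const_bound[of _ 1]) (auto intro!: AE_I2)
  have E: "(\<integral>\<omega>. of_bool (alive j \<omega>) \<partial>M) = measure M {\<omega>. alive j \<omega>}" for j
  proof -
    have "(\<lambda>\<omega>. of_bool (alive j \<omega>) :: real) = indicator {\<omega>. alive j \<omega>}" by (auto simp: fun_eq_iff indicator_def)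
    then show ?thesis by (simp add: space_M)
  qed
  have "(\<Sum>j<k. measure M {\<omega>. alive j \<omega>}) \<le> B" for k
    using bound[of k] int unfolding alive_time_hist E[symmetric]
    by (subst Bochner_Integration.integral_sum[symmetric]) (auto simp: alive_time_def)
  then have sm: "summable (\<lambda>j. measure M {\<omega>. alive j \<omega>})"
    by (intro summableI_nonneg_bounded[where x=B]) auto
  have meas: "{\<omega>. alive j \<omega>} \<in> sets M" for j
    using predE[OF pred_alive_M[of j]] by (simp add: space_M)
  have "AE \<omega> in M. \<forall>\<^sub>F n in sequentially. \<omega> \<in> space M - {\<omega>. alive n \<omega>}"
    by (rule borel_cantelli_AE1[OF meas _ sm]) (simp add: less_top[symmetric])
  then show trm: "AE \<omega> in M. game_terminates \<Omega> \<theta>1 \<theta>2 \<omega>"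
    by eventually_elim (auto simp: terminates_iff eventually_sequentially)
  have dead: "\<not> alive n \<omega>" if "\<not> alive m \<omega>" "m \<le> n" for m n \<omega>
    using that unfolding alive_def by (meson order_trans)
  have fin: "(\<lambda>j. of_bool (alive j \<omega>) :: real) sums (\<Sum>j. of_bool (alive j \<omega>))"
      "alive_time k \<omega> \<le> (\<Sum>j. of_bool (alive j \<omega>))"
    if "game_terminates \<Omega> \<theta>1 \<theta>2 \<omega>" for \<omega> k
  proof -
    obtain m where m: "\<not> alive m \<omega>" using \<open>game_terminates \<Omega> \<theta>1 \<theta>2 \<omega>\<close> unfolding terminates_iff by auto
    have s: "summable (\<lambda>j. of_bool (alive j \<omega>) :: real)"
      by (rule summable_finite[of "{..<m}"]) (use dead[OF m] in \<open>auto simp: not_less\<close>)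
    then show "(\<lambda>j. of_bool (alive j \<omega>) :: real) sums (\<Sum>j. of_bool (alive j \<omega>))" by (rule summable_sums)
    show "alive_time k \<omega> \<le> (\<Sum>j. of_bool (alive j \<omega>))"
      unfolding alive_time_def by (rule sum_le_suminf[OF s]) auto
  qed
  have intT: "integrable M (\<lambda>\<omega>. \<Sum>j. of_bool (alive j \<omega>) :: real)"
  proof (rule integrable_suminf[OF int])
    show "AE \<omega> in M. summable (\<lambda>j. norm (of_bool (alive j \<omega>) :: real))"
      using trm by eventually_elim (use fin(1) in \<open>auto dest: sums_summable\<close>)
    show "summable (\<lambda>j. \<integral>\<omega>. norm (of_bool (alive j \<omega>) :: real) \<partial>M)"
      using sm by (simp add: E)
  qed
  let ?w = "\<lambda>\<omega>. C + \<epsilon> * (\<Sum>j. of_bool (alive j \<omega>))"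
  have intw: "integrable M ?w" using intT by simp
  have measG: "(\<lambda>\<omega>. potential F P k (hist k \<omega>)) \<in> borel_measurable M" for k
    by (rule measurable_compose[OF measurable_hist_M measurable_potential[OF Fh P]])
  have lim: "AE \<omega> in M. (\<lambda>k. potential F P k (hist k \<omega>)) \<longlonglongrightarrow> payoff \<Omega> F \<epsilon> \<theta>1 \<theta>2 \<omega>"
    using trm
  proof eventually_elim
    case (elim \<omega>)
    then obtain m where m: "\<not> alive m \<omega>" unfolding terminates_iff by auto
    show ?case
      unfolding potential_hist
      by (rule tendsto_eventually, rule eventually_sequentiallyI[of m]) (rule potential_dead[OF dead[OF m]])
  qed
  have bd: "AE \<omega> in M. norm (potential F P k (hist k \<omega>)) \<le> ?w \<omega>" for k
    using trm
  proof eventually_elim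
    case (elim \<omega>)
    have "\<epsilon> * alive_time k \<omega> \<le> \<epsilon> * (\<Sum>j. of_bool (alive j \<omega>))"
      using fin(2)[OF elim, of k] e by (intro mult_left_mono) auto
    then show ?case
      unfolding potential_hist real_norm_def using potential_bounds(3)[of F C P k \<omega>, OF e C] by linarith
  qed
  show "integrable M (payoff \<Omega> F \<epsilon> \<theta>1 \<theta>2)"
    by (rule integrable_dominated_convergence[OF measurable_payoff[OF Fh] measG intw lim bd])
  show "(\<lambda>k. \<integral>\<omega>. potential F P k (hist k \<omega>) \<partial>M) \<longlonglongrightarrow> (\<integral>\<omega>. payoff \<Omega> F \<epsilon> \<theta>1 \<theta>2 \<omega> \<partial>M)"
    by (rule integral_dominated_convergence[OF measurable_payoff[OF Fh] measG intw lim bd])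
qed

lemma space_upd: "h \<in> space (histories k) \<Longrightarrow> h(Suc k := y) \<in> space (histories (Suc k))"
  by (auto simp: space_PiM PiE_iff extensional_def)

lemma strip_payoff_inside: "x \<in> \<Omega> \<Longrightarrow> strip_payoff \<Omega> \<epsilon> F x = 0"
  by (simp add: strip_payoff_def outer_strip_def)

lemma alive_inside: "alive k h \<Longrightarrow> h k \<in> \<Omega>"
  unfolding alive_def ends_at_def by auto

lemma ends_cases:
  assumes "h \<in> space (histories k)" "ends h k"
  shows "h k \<notin> \<Omega> \<or> h k \<in> \<Omega> \<and> \<theta>1 k h \<and> \<theta>2 k h"
  using assms(2) unfolding ends_at_def hist_id[OF assms(1)] by auto

text \<open>The sign \<open>\<sigma>\<close> is 1 for the lower and \<open>- 1\<close> for the upper bound.\<close>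

lemma payoff_bound:
  fixes \<sigma> :: real
  assumes e: "0 < \<epsilon>" and \<gamma>: "0 < \<gamma>" and \<sigma>: "\<bar>\<sigma>\<bar> = 1"
    and Fh: "strip_payoff \<Omega> \<epsilon> F \<in> borel_measurable borel"
    and P: "\<And>k. P k \<in> borel_measurable borel"
    and C: "\<And>x. \<bar>strip_payoff \<Omega> \<epsilon> F x\<bar> \<le> C" "\<And>k x. \<bar>P k x\<bar> \<le> C"
    and B: "\<And>k h. \<sigma> * potential F P k h \<le> B"
    and stop: "\<And>k h. h \<in> space (histories k) \<Longrightarrow> ends h k \<Longrightarrow> \<sigma> * P k (h k) \<le> \<sigma> * strip_payoff \<Omega> \<epsilon> F (h k)"
    and pay: "\<And>k h. h \<in> space (histories k) \<Longrightarrow> h k \<in> \<Omega> \<Longrightarrow> \<theta>2 k h \<Longrightarrow> \<not> \<theta>1 k h \<Longrightarrow>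
      \<sigma> * P k (h k) + \<gamma> \<le> \<sigma> * (P (Suc k) (S1 k h) - \<epsilon>)"
    and tug: "\<And>k h. h \<in> space (histories k) \<Longrightarrow> h k \<in> \<Omega> \<Longrightarrow> \<not> \<theta>2 k h \<Longrightarrow>
      \<sigma> * P k (h k) + \<gamma> \<le> \<sigma> * ((P (Suc k) (S1 k h) + P (Suc k) (S2 k h)) / 2)"
  shows "AE \<omega> in M. game_terminates \<Omega> \<theta>1 \<theta>2 \<omega>" "integrable M (payoff \<Omega> F \<epsilon> \<theta>1 \<theta>2)"
    and "\<sigma> * P 0 x0 \<le> \<sigma> * (\<integral>\<omega>. payoff \<Omega> F \<epsilon> \<theta>1 \<theta>2 \<omega> \<partial>M)"
proof -
  interpret prob_space M by (rule prob_space_M)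
  let ?G = "potential F P"
  \<comment> \<open>Subtracting \<open>\<gamma>\<close> per live turn still leaves a submartingale,
    because the hypotheses have this gain to spare. As \<open>\<sigma> * potential\<close> is at
    most \<open>B\<close>, the expected live time is at most
    \<open>(B - \<sigma> * P 0 x0) / \<gamma>\<close>.\<close>
  define f where "f k h = \<sigma> * ?G k h - \<gamma> * alive_time k h" for k h
  have meas: "f k \<in> borel_measurable (histories k)" for k
    unfolding f_def[abs_def] using measurable_potential[OF Fh P] measurable_alive_time by measurable
  have fb: "\<bar>f k h\<bar> \<le> C + (\<epsilon> + \<gamma>) * real (Suc n)" if "k \<le> Suc n" for k n h
  proof -
    have "alive_time k h \<le> real (Suc n)" using alive_time_bounds(2)[of k h] that by linarith
    then have "(\<epsilon> + \<gamma>) * alive_time k h \<le> (\<epsilon> + \<gamma>) * real (Suc n)" using e \<gamma> by (intro mult_left_mono) auto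
    moreover have "\<bar>f k h\<bar> \<le> C + \<epsilon> * alive_time k h + \<gamma> * alive_time k h"
      using potential_bounds(3)[of F C P k h, OF e C] alive_time_bounds(1)[of k h] \<gamma> \<sigma> unfolding f_def
      by (intro order_trans[OF abs_triangle_ineq4] add_mono) (auto simp: abs_mult)
    ultimately show ?thesis by (simp add: algebra_simps)
  qed
  \<comment> \<open>If the game ends at the new position, \<open>stop\<close> permits replacing the
    terminal payoff by \<open>P\<close>, so both outcomes are covered by one inequality.\<close>
  have upd: "f k h - \<sigma> * P k (h k) - \<gamma> - \<sigma> * (\<epsilon> * of_bool (\<theta>2 k h)) + \<sigma> * P (Suc k) y \<le> f (Suc k) (h(Suc k := y))"
    if h: "h \<in> space (histories k)" "alive k h" for k y and h :: "nat \<Rightarrow> 'a"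
    using stop[OF space_upd[OF h(1)], of y] h(2) unfolding f_def potential_upd(2)[OF h] alive_time_upd[OF h(1)]
    by (simp add: algebra_simps)
  have step: "(\<integral>\<omega>. f k (hist k \<omega>) \<partial>M) \<le> (\<integral>\<omega>. f (Suc k) (hist (Suc k) \<omega>) \<partial>M)" for k
  proof (rule expectation_step[OF meas fb[of k k] meas fb[of "Suc k" k]])
    fix h :: "nat \<Rightarrow> 'a" assume h: "h \<in> space (histories k)"
    show "\<not> alive k h \<Longrightarrow> f k h \<le> f (Suc k) (h(Suc k := h k))"
      using potential_upd(1)[OF h, of F P] alive_time_upd[OF h] unfolding f_def by simp
    assume al: "alive k h"
    then have in\<Omega>: "h k \<in> \<Omega>" by (rule alive_inside)
    show "f k h \<le> f (Suc k) (h(Suc k := S1 k h))" if "\<theta>2 k h"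
    proof -
      have "\<not> \<theta>1 k h" using al that hist_id[OF h] unfolding alive_def ends_at_def by auto
      then show ?thesis using pay[OF h in\<Omega> that] upd[OF h al, of "S1 k h"] that by (simp add: right_diff_distrib)
    qed
    show "f k h \<le> (f (Suc k) (h(Suc k := S1 k h)) + f (Suc k) (h(Suc k := S2 k h))) / 2" if "\<not> \<theta>2 k h"
      using tug[OF h in\<Omega> that] upd[OF h al, of "S1 k h"] upd[OF h al, of "S2 k h"] that
      by (simp add: distrib_left add_divide_distrib)
  qed auto
  have start: "\<sigma> * P 0 x0 \<le> (\<integral>\<omega>. f 0 (hist 0 \<omega>) \<partial>M)"
  proof -
    let ?h = "\<lambda>i\<in>{0..<Suc 0}. x0"
    have h: "?h \<in> space (histories 0)" by (auto simp: space_PiM)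
    have "f 0 ?h = \<sigma> * (if ends ?h 0 then strip_payoff \<Omega> \<epsilon> F x0 else P 0 x0)"
      unfolding f_def potential_def alive_time_def passes_def alive_def first_end_def by auto
    then have "\<sigma> * P 0 x0 \<le> f 0 ?h" using stop[OF h] by auto
    then show ?thesis unfolding expectation_start[OF meas] .
  qed
  have mono: "\<sigma> * P 0 x0 \<le> (\<integral>\<omega>. f k (hist k \<omega>) \<partial>M)" for k
    by (induction k) (use start step order_trans in \<open>blast+\<close>)
  have intG: "integrable M (\<lambda>\<omega>. ?G k (hist k \<omega>))" and intA: "integrable M (\<lambda>\<omega>. alive_time k (hist k \<omega>))" for k
  proof -
    have "\<bar>?G k h\<bar> \<le> C + \<epsilon> * real k" for h
      using potential_bounds(3)[of F C P k h, OF e C] mult_left_mono[OF alive_time_bounds(2)[of k h], of \<epsilon>] e by linarith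
    then show "integrable M (\<lambda>\<omega>. ?G k (hist k \<omega>))"
      by (intro integrable_hist[OF measurable_potential[OF Fh P]])
    show "integrable M (\<lambda>\<omega>. alive_time k (hist k \<omega>))"
      using alive_time_bounds by (intro integrable_hist[OF measurable_alive_time, of _ "real k"]) auto
  qed
  have split: "\<sigma> * P 0 x0 + \<gamma> * (\<integral>\<omega>. alive_time k (hist k \<omega>) \<partial>M) \<le> \<sigma> * (\<integral>\<omega>. ?G k (hist k \<omega>) \<partial>M)" for k
    using mono[of k] intG[of k] intA[of k] unfolding f_def by simp
  have up: "\<sigma> * (\<integral>\<omega>. ?G k (hist k \<omega>) \<partial>M) \<le> B" for k
    using integral_mono[of M "\<lambda>\<omega>. \<sigma> * ?G k (hist k \<omega>)" "\<lambda>_. B"] intG[of k] B by (simp add: prob_space)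
  have "\<gamma> * (\<integral>\<omega>. alive_time k (hist k \<omega>) \<partial>M) \<le> B - \<sigma> * P 0 x0" for k
    using split[of k] up[of k] by linarith
  then have bnd: "(\<integral>\<omega>. alive_time k (hist k \<omega>) \<partial>M) \<le> (B - \<sigma> * P 0 x0) / \<gamma>" for k
    using \<gamma> by (simp add: field_simps)
  note L = expected_payoff_limit[where P=P, OF e Fh P C bnd]
  show "AE \<omega> in M. game_terminates \<Omega> \<theta>1 \<theta>2 \<omega>" "integrable M (payoff \<Omega> F \<epsilon> \<theta>1 \<theta>2)" by (rule L)+
  have nonneg: "0 \<le> \<gamma> * (\<integral>\<omega>. alive_time k (hist k \<omega>) \<partial>M)" for k
    using \<gamma> alive_time_bounds(1) by (intro mult_nonneg_nonneg integral_nonneg) auto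
  have "\<sigma> * P 0 x0 \<le> \<sigma> * (\<integral>\<omega>. ?G k (hist k \<omega>) \<partial>M)" for k using split[of k] nonneg[of k] by linarith
  then show "\<sigma> * P 0 x0 \<le> \<sigma> * (\<integral>\<omega>. payoff \<Omega> F \<epsilon> \<theta>1 \<theta>2 \<omega> \<partial>M)"
    by (intro LIMSEQ_le_const[OF tendsto_mult_left[OF L(3)]]) auto
qed

text \<open>Payments only lower the potential, so \<open>C\<close> bounds it from above against
  every opponent; together with the drift \<open>\<gamma>\<close> this makes the live time
  integrable.\<close>

lemma payoff_lower_bound:
  assumes e: "0 < \<epsilon>" and \<gamma>: "0 < \<gamma>" and Fh: "strip_payoff \<Omega> \<epsilon> F \<in> borel_measurable borel"
    and P: "\<And>k. P k \<in> borel_measurable borel"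
    and C: "\<And>x. \<bar>strip_payoff \<Omega> \<epsilon> F x\<bar> \<le> C" "\<And>k x. \<bar>P k x\<bar> \<le> C"
    and out: "\<And>k x. x \<notin> \<Omega> \<Longrightarrow> P k x \<le> strip_payoff \<Omega> \<epsilon> F x"
    and leave: "\<And>k h. h \<in> space (histories k) \<Longrightarrow> h k \<in> \<Omega> \<Longrightarrow> \<theta>1 k h \<Longrightarrow> P k (h k) \<le> 0"
    and pay: "\<And>k h. h \<in> space (histories k) \<Longrightarrow> h k \<in> \<Omega> \<Longrightarrow> \<not> \<theta>1 k h \<Longrightarrow>
      P k (h k) + \<gamma> \<le> P (Suc k) (S1 k h) - \<epsilon>"
    and tug: "\<And>k h. h \<in> space (histories k) \<Longrightarrow> h k \<in> \<Omega> \<Longrightarrow>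
      P k (h k) + \<gamma> \<le> (P (Suc k) (S1 k h) + P (Suc k) (S2 k h)) / 2"
  shows "AE \<omega> in M. game_terminates \<Omega> \<theta>1 \<theta>2 \<omega>"
    and "ereal (P 0 x0) \<le> ereal_expectation M (payoff \<Omega> F \<epsilon> \<theta>1 \<theta>2)"
proof -
  have "1 * P k (h k) \<le> 1 * strip_payoff \<Omega> \<epsilon> F (h k)" if "h \<in> space (histories k)" "ends h k" for k and h :: "nat \<Rightarrow> 'a"
    using ends_cases[OF that]
  proof (elim disjE conjE)
    assume "h k \<notin> \<Omega>" then show ?thesis using out by simp
  next
    assume "h k \<in> \<Omega>" "\<theta>1 k h" "\<theta>2 k h"
    then show ?thesis using leave[OF that(1)] strip_payoff_inside[of "h k" F] by simp
  qed
  note stop = this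
  have B: "1 * potential F P k h \<le> C" for k h using potential_bounds(1)[of F C P, OF e C] by simp
  have pay': "1 * P k (h k) + \<gamma> \<le> 1 * (P (Suc k) (S1 k h) - \<epsilon>)"
    if "h \<in> space (histories k)" "h k \<in> \<Omega>" "\<theta>2 k h" "\<not> \<theta>1 k h" for k h using pay[OF that(1,2,4)] by simp
  have tug': "1 * P k (h k) + \<gamma> \<le> 1 * ((P (Suc k) (S1 k h) + P (Suc k) (S2 k h)) / 2)"
    if "h \<in> space (histories k)" "h k \<in> \<Omega>" "\<not> \<theta>2 k h" for k h using tug[OF that(1,2)] by simp
  have *: "AE \<omega> in M. game_terminates \<Omega> \<theta>1 \<theta>2 \<omega>" "integrable M (payoff \<Omega> F \<epsilon> \<theta>1 \<theta>2)"
    "1 * P 0 x0 \<le> 1 * (\<integral>\<omega>. payoff \<Omega> F \<epsilon> \<theta>1 \<theta>2 \<omega> \<partial>M)"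
    by (rule payoff_bound[where \<sigma>=1 and \<gamma>=\<gamma> and F=F and P=P and C=C and B=C];
        (simp; fail | rule e \<gamma> Fh P C B stop pay' tug'; assumption))+
  show "AE \<omega> in M. game_terminates \<Omega> \<theta>1 \<theta>2 \<omega>" by (rule *)
  show "ereal (P 0 x0) \<le> ereal_expectation M (payoff \<Omega> F \<epsilon> \<theta>1 \<theta>2)"
    using *(3) unfolding ereal_expectation_integrable[OF *(2)] by simp
qed

text \<open>
  Player I may prolong the game at his own expense, which would count as \<open>\<infinity>\<close>. Therefore
  Player II stops passing after finitely many turns.
\<close>

lemma payoff_upper_bound:
  assumes e: "0 < \<epsilon>" and \<gamma>: "0 < \<gamma>" and Fh: "strip_payoff \<Omega> \<epsilon> F \<in> borel_measurable borel"
    and P: "\<And>k. P k \<in> borel_measurable borel"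
    and C: "\<And>x. \<bar>strip_payoff \<Omega> \<epsilon> F x\<bar> \<le> C" "\<And>k x. \<bar>P k x\<bar> \<le> C"
    and out: "\<And>k x. x \<notin> \<Omega> \<Longrightarrow> strip_payoff \<Omega> \<epsilon> F x \<le> P k x"
    and leave: "\<And>k h. h \<in> space (histories k) \<Longrightarrow> h k \<in> \<Omega> \<Longrightarrow> \<theta>2 k h \<Longrightarrow> 0 \<le> P k (h k)"
    and pay: "\<And>k h. h \<in> space (histories k) \<Longrightarrow> h k \<in> \<Omega> \<Longrightarrow> \<theta>2 k h \<Longrightarrow>
      P (Suc k) (S1 k h) - \<epsilon> \<le> P k (h k) - \<gamma>"
    and tug: "\<And>k h. h \<in> space (histories k) \<Longrightarrow> h k \<in> \<Omega> \<Longrightarrow> \<not> \<theta>2 k h \<Longrightarrow>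
      (P (Suc k) (S1 k h) + P (Suc k) (S2 k h)) / 2 \<le> P k (h k) - \<gamma>"
    and late: "\<And>k h. n \<le> k \<Longrightarrow> \<not> \<theta>2 k h"
  shows "AE \<omega> in M. game_terminates \<Omega> \<theta>1 \<theta>2 \<omega>"
    and "ereal_expectation M (payoff \<Omega> F \<epsilon> \<theta>1 \<theta>2) \<le> ereal (P 0 x0)"
proof -
  have "- 1 * P k (h k) \<le> - 1 * strip_payoff \<Omega> \<epsilon> F (h k)" if "h \<in> space (histories k)" "ends h k" for k and h :: "nat \<Rightarrow> 'a"
    using ends_cases[OF that]
  proof (elim disjE conjE)
    assume "h k \<notin> \<Omega>" then show ?thesis using out by simp
  next
    assume "h k \<in> \<Omega>" "\<theta>1 k h" "\<theta>2 k h"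
    then show ?thesis using leave[OF that(1)] strip_payoff_inside[of "h k" F] by simp
  qed
  note stop = this
  \<comment> \<open>From turn \<open>n\<close> on there are no passes, so the payments stay below
    \<open>\<epsilon> * n\<close> and the negated potential is bounded above.\<close>
  have "passes k h \<le> real n" for k h
  proof -
    have "passes k h = (\<Sum>j\<in>{..<k} \<inter> {..<n}. of_bool (alive j h \<and> \<theta>2 j (hist j h)))"
      unfolding passes_def by (rule sum.mono_neutral_right) (auto, meson late not_le_imp_less)
    also have "\<dots> \<le> (\<Sum>j\<in>{..<k} \<inter> {..<n}. 1)" by (intro sum_mono) auto
    also have "\<dots> \<le> real n" using card_mono[of "{..<n}" "{..<k} \<inter> {..<n}"] by simp
    finally show ?thesis .
  qed
  then have B: "- 1 * potential F P k h \<le> C + \<epsilon> * real n" for k h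
    using potential_bounds(2)[of F C P k h, OF e C] mult_left_mono[of "passes k h" "real n" \<epsilon>] e by (smt (verit))
  have pay': "- 1 * P k (h k) + \<gamma> \<le> - 1 * (P (Suc k) (S1 k h) - \<epsilon>)"
    if "h \<in> space (histories k)" "h k \<in> \<Omega>" "\<theta>2 k h" for k h using pay[OF that] by argo
  have tug': "- 1 * P k (h k) + \<gamma> \<le> - 1 * ((P (Suc k) (S1 k h) + P (Suc k) (S2 k h)) / 2)"
    if "h \<in> space (histories k)" "h k \<in> \<Omega>" "\<not> \<theta>2 k h" for k h using tug[OF that] by argo
  have *: "AE \<omega> in M. game_terminates \<Omega> \<theta>1 \<theta>2 \<omega>" "integrable M (payoff \<Omega> F \<epsilon> \<theta>1 \<theta>2)"
    "- 1 * P 0 x0 \<le> - 1 * (\<integral>\<omega>. payoff \<Omega> F \<epsilon> \<theta>1 \<theta>2 \<omega> \<partial>M)"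
    by (rule payoff_bound[where \<sigma>="- 1" and \<gamma>=\<gamma> and F=F and P=P and C=C and B="C + \<epsilon> * real n"];
        (simp; fail | rule e \<gamma> Fh P C B stop pay' tug'; assumption))+
  show "AE \<omega> in M. game_terminates \<Omega> \<theta>1 \<theta>2 \<omega>" by (rule *)
  show "ereal_expectation M (payoff \<Omega> F \<epsilon> \<theta>1 \<theta>2) \<le> ereal (P 0 x0)"
    using *(3) unfolding ereal_expectation_integrable[OF *(2)] by simp
qed

end

subsection \<open>The game value\<close>

text \<open>Player I moves to a point almost maximizing the next potential and leaves exactly when
  its supremum is at most \<open>\<epsilon>\<close>, that is, when moving at the cost
  \<open>\<epsilon>\<close> cannot bring more than leaving. The selection error
  \<open>\<gamma> / 2\<close> consumes half of the drift; the other half forces the game to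
  end.\<close>

lemma value_I_ge:
  fixes \<Omega> :: "'a::euclidean_space set"
  assumes e: "0 < \<epsilon>" and \<gamma>: "0 < \<gamma>" and \<Omega>: "open \<Omega>" and x0: "x0 \<in> \<Omega>"
    and Fh: "strip_payoff \<Omega> \<epsilon> F \<in> borel_measurable borel"
    and P: "\<And>k. P k \<in> borel_measurable borel"
    and C: "\<And>x. \<bar>strip_payoff \<Omega> \<epsilon> F x\<bar> \<le> C" "\<And>k x. \<bar>P k x\<bar> \<le> C"
    and out: "\<And>k x. x \<notin> \<Omega> \<Longrightarrow> P k x \<le> strip_payoff \<Omega> \<epsilon> F x"
    and sub: "\<And>k x. x \<in> \<Omega> \<Longrightarrow> P k x + \<gamma> \<le> dpp \<epsilon> (P (Suc k)) x"
  shows "ereal (P 0 x0) \<le> value_I \<Omega> F \<epsilon> x0"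
proof -
  have "\<forall>k. \<exists>s\<in>borel_measurable borel. \<forall>x. s x \<in> ball x \<epsilon> \<and> bsup \<epsilon> (P k) x - \<gamma> / 2 < P k (s x)"
    using near_sup_selection[OF e, of "P _" C "\<gamma> / 2"] C(2) \<gamma> by auto
  then obtain s where s: "\<And>k. s k \<in> borel_measurable borel" "\<And>k x. s k x \<in> ball x \<epsilon>"
    "\<And>k x. bsup \<epsilon> (P k) x - \<gamma> / 2 < P k (s k x)" by metis
  define S1 where "S1 k h = s (Suc k) (h k)" for k and h :: "nat \<Rightarrow> 'a"
  define \<theta>1 where "\<theta>1 k h \<longleftrightarrow> bsup \<epsilon> (P (Suc k)) (h k) \<le> \<epsilon>" for k and h :: "nat \<Rightarrow> 'a"
  have pol: "(S1, \<theta>1) \<in> policies \<epsilon>"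
  proof -
    have coord: "(\<lambda>h. h k) \<in> borel_measurable (histories k)" for k
      by (intro measurable_component_singleton) auto
    have "S1 k \<in> borel_measurable (histories k)" for k
      unfolding S1_def[abs_def] by (rule measurable_compose[OF coord s(1)])
    moreover have "\<theta>1 k \<in> measurable (histories k) (count_space UNIV)" for k
    proof -
      have [measurable]: "(\<lambda>h. bsup \<epsilon> (P (Suc k)) (h k)) \<in> borel_measurable (histories k)"
        by (rule measurable_compose[OF coord borel_measurable_bsup[of \<epsilon> "P (Suc k)" C, OF e C(2)]])
      show ?thesis unfolding \<theta>1_def[abs_def] by measurable
    qed
    ultimately show ?thesis unfolding policies_def using s(2) by (auto simp: S1_def)
  qed
  have "ereal (P 0 x0) \<le> expected_payoff (-\<infinity>) \<Omega> F \<epsilon> x0 (S1, \<theta>1) p2" if p2: "p2 \<in> policies \<epsilon>" for p2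
  proof -
    obtain S2 \<theta>2 where p2': "p2 = (S2, \<theta>2)" by (cases p2)
    interpret game_run \<Omega> \<epsilon> S1 S2 \<theta>1 \<theta>2 x0
      by unfold_locales (use pol p2 p2' \<Omega> in auto)
    have sub': "P k (h k) + \<gamma> \<le> dpp \<epsilon> (P (Suc k)) (h k)" if "h k \<in> \<Omega>" for k and h :: "nat \<Rightarrow> 'a"
      by (rule sub[OF that])
    have s1: "bsup \<epsilon> (P (Suc k)) (h k) - \<gamma> / 2 < P (Suc k) (S1 k h)" for k and h :: "nat \<Rightarrow> 'a"
      unfolding S1_def by (rule s(3))
    have leave: "P k (h k) \<le> 0" if "h k \<in> \<Omega>" "\<theta>1 k h" for k and h :: "nat \<Rightarrow> 'a"
      using sub'[of h k, OF that(1)] \<gamma> that(2) unfolding \<theta>1_def dpp_def by auto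
    have pay: "P k (h k) + \<gamma> / 2 \<le> P (Suc k) (S1 k h) - \<epsilon>" if "h k \<in> \<Omega>" "\<not> \<theta>1 k h" for k and h :: "nat \<Rightarrow> 'a"
      using sub'[of h k, OF that(1)] s1[of k h] that(2) unfolding \<theta>1_def dpp_def by auto
    have tug: "P k (h k) + \<gamma> / 2 \<le> (P (Suc k) (S1 k h) + P (Suc k) (S2 k h)) / 2"
      if h: "h \<in> space (histories k)" "h k \<in> \<Omega>" for k and h :: "nat \<Rightarrow> 'a"
    proof -
      have "S2 k h \<in> ball (h k) \<epsilon>" using p2 p2' h(1) unfolding policies_def by blast
      then have "binf \<epsilon> (P (Suc k)) (h k) \<le> P (Suc k) (S2 k h)"
        using binf_lower[of "h k" \<epsilon> "P (Suc k)" C] C(2) by blast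
      then show ?thesis using sub'[of h k, OF h(2)] s1[of k h] \<gamma> unfolding dpp_def by argo
    qed
    have \<gamma>2: "0 < \<gamma> / 2" using \<gamma> by simp
    have *: "AE \<omega> in M. game_terminates \<Omega> \<theta>1 \<theta>2 \<omega>"
      "ereal (P 0 x0) \<le> ereal_expectation M (payoff \<Omega> F \<epsilon> \<theta>1 \<theta>2)"
      by (rule payoff_lower_bound[where P=P, OF e \<gamma>2 Fh P C]; use out leave pay tug in blast)+
    show ?thesis unfolding expected_payoff_def p2' Let_def fst_conv snd_conv using * by simp
  qed
  then have "ereal (P 0 x0) \<le> (INF p2\<in>policies \<epsilon>. expected_payoff (-\<infinity>) \<Omega> F \<epsilon> x0 (S1, \<theta>1) p2)"
    by (intro INF_greatest)
  also have "\<dots> \<le> value_I \<Omega> F \<epsilon> x0"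
    unfolding value_I_def using x0 by (auto intro: SUP_upper2[OF pol])
  finally show ?thesis .
qed

text \<open>Player II moves to an almost minimizing point and, before turn \<open>n\<close> only,
  passes when the passing branch realizes the minimum. Afterwards \<open>late\<close> makes
  tug-of-war alone sufficient, so the number of payments is bounded.\<close>

lemma value_II_le:
  fixes \<Omega> :: "'a::euclidean_space set"
  assumes e: "0 < \<epsilon>" and \<gamma>: "0 < \<gamma>" and \<Omega>: "open \<Omega>" and x0: "x0 \<in> \<Omega>"
    and Fh: "strip_payoff \<Omega> \<epsilon> F \<in> borel_measurable borel"
    and P: "\<And>k. P k \<in> borel_measurable borel"
    and C: "\<And>x. \<bar>strip_payoff \<Omega> \<epsilon> F x\<bar> \<le> C" "\<And>k x. \<bar>P k x\<bar> \<le> C"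
    and out: "\<And>k x. x \<notin> \<Omega> \<Longrightarrow> strip_payoff \<Omega> \<epsilon> F x \<le> P k x"
    and super: "\<And>k x. x \<in> \<Omega> \<Longrightarrow> dpp \<epsilon> (P (Suc k)) x + \<gamma> \<le> P k x"
    and late: "\<And>k x. x \<in> \<Omega> \<Longrightarrow> n \<le> k \<Longrightarrow> (bsup \<epsilon> (P (Suc k)) x + binf \<epsilon> (P (Suc k)) x) / 2 + \<gamma> \<le> P k x"
  shows "value_II \<Omega> F \<epsilon> x0 \<le> ereal (P 0 x0)"
proof -
  have "\<forall>k. \<exists>s\<in>borel_measurable borel. \<forall>x. s x \<in> ball x \<epsilon> \<and> P k (s x) < binf \<epsilon> (P k) x + \<gamma> / 2"
    using near_inf_selection[OF e, of "P _" C "\<gamma> / 2"] C(2) \<gamma> by auto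
  then obtain s where s: "\<And>k. s k \<in> borel_measurable borel" "\<And>k x. s k x \<in> ball x \<epsilon>"
    "\<And>k x. P k (s k x) < binf \<epsilon> (P k) x + \<gamma> / 2" by metis
  define S2 where "S2 k h = s (Suc k) (h k)" for k and h :: "nat \<Rightarrow> 'a"
  define \<theta>2 where "\<theta>2 k h \<longleftrightarrow> k < n \<and> max 0 (bsup \<epsilon> (P (Suc k)) (h k) - \<epsilon>)
    \<le> (bsup \<epsilon> (P (Suc k)) (h k) + binf \<epsilon> (P (Suc k)) (h k)) / 2" for k and h :: "nat \<Rightarrow> 'a"
  have pol: "(S2, \<theta>2) \<in> policies \<epsilon>"
  proof -
    have coord: "(\<lambda>h. h k) \<in> borel_measurable (histories k)" for k
      by (intro measurable_component_singleton) auto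
    have "S2 k \<in> borel_measurable (histories k)" for k
      unfolding S2_def[abs_def] by (rule measurable_compose[OF coord s(1)])
    moreover have "\<theta>2 k \<in> measurable (histories k) (count_space UNIV)" for k
    proof -
      have a: "(\<lambda>h. bsup \<epsilon> (P (Suc k)) (h k)) \<in> borel_measurable (histories k)"
        by (rule measurable_compose[OF coord borel_measurable_bsup[of \<epsilon> "P (Suc k)" C, OF e C(2)]])
      have b: "(\<lambda>h. binf \<epsilon> (P (Suc k)) (h k)) \<in> borel_measurable (histories k)"
        by (rule measurable_compose[OF coord borel_measurable_binf[of \<epsilon> "P (Suc k)" C, OF e C(2)]])
      have "Measurable.pred (histories k) (\<lambda>h. max 0 (bsup \<epsilon> (P (Suc k)) (h k) - \<epsilon>)
          \<le> (bsup \<epsilon> (P (Suc k)) (h k) + binf \<epsilon> (P (Suc k)) (h k)) / 2)"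
        unfolding pred_def
        by (intro borel_measurable_le borel_measurable_max borel_measurable_const
            borel_measurable_diff borel_measurable_add borel_measurable_divide a b)
      then show ?thesis
        unfolding \<theta>2_def[abs_def] by (cases "k < n") simp_all
    qed
    ultimately show ?thesis unfolding policies_def using s(2) by (auto simp: S2_def)
  qed
  have "expected_payoff \<infinity> \<Omega> F \<epsilon> x0 p1 (S2, \<theta>2) \<le> ereal (P 0 x0)" if p1: "p1 \<in> policies \<epsilon>" for p1
  proof -
    obtain S1 \<theta>1 where p1': "p1 = (S1, \<theta>1)" by (cases p1)
    interpret game_run \<Omega> \<epsilon> S1 S2 \<theta>1 \<theta>2 x0
      by unfold_locales (use pol p1 p1' \<Omega> in auto)
    have super': "dpp \<epsilon> (P (Suc k)) (h k) + \<gamma> \<le> P k (h k)" if "h k \<in> \<Omega>" for k and h :: "nat \<Rightarrow> 'a"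
      by (rule super[OF that])
    have s2: "P (Suc k) (S2 k h) < binf \<epsilon> (P (Suc k)) (h k) + \<gamma> / 2" for k and h :: "nat \<Rightarrow> 'a"
      unfolding S2_def by (rule s(3))
    have s1: "P (Suc k) (S1 k h) \<le> bsup \<epsilon> (P (Suc k)) (h k)"
      if h: "h \<in> space (histories k)" for k and h :: "nat \<Rightarrow> 'a"
    proof -
      have "S1 k h \<in> ball (h k) \<epsilon>" using p1 p1' h unfolding policies_def by blast
      then show ?thesis using bsup_upper[of "h k" \<epsilon> "P (Suc k)" C] C(2) by blast
    qed
    have leave: "0 \<le> P k (h k)" if "h k \<in> \<Omega>" "\<theta>2 k h" for k and h :: "nat \<Rightarrow> 'a"
      using super'[of h k, OF that(1)] \<gamma> that(2) unfolding \<theta>2_def dpp_def by linarith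
    have pay: "P (Suc k) (S1 k h) - \<epsilon> \<le> P k (h k) - \<gamma> / 2"
      if "h \<in> space (histories k)" "h k \<in> \<Omega>" "\<theta>2 k h" for k and h :: "nat \<Rightarrow> 'a"
      using super'[of h k, OF that(2)] s1[OF that(1)] \<gamma> that(3) unfolding \<theta>2_def dpp_def by linarith
    have tug: "(P (Suc k) (S1 k h) + P (Suc k) (S2 k h)) / 2 \<le> P k (h k) - \<gamma> / 2"
      if "h \<in> space (histories k)" "h k \<in> \<Omega>" "\<not> \<theta>2 k h" for k and h :: "nat \<Rightarrow> 'a"
    proof -
      have "(bsup \<epsilon> (P (Suc k)) (h k) + binf \<epsilon> (P (Suc k)) (h k)) / 2 + \<gamma> \<le> P k (h k)"
        using super'[of h k, OF that(2)] late[OF that(2), of k] that(3) unfolding \<theta>2_def dpp_def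
        by (cases "n \<le> k") (auto simp: min_def split: if_splits)
      then show ?thesis using s1[OF that(1)] s2[of k h] \<gamma> by argo
    qed
    have \<gamma>2: "0 < \<gamma> / 2" using \<gamma> by simp
    have never: "\<not> \<theta>2 k h" if "n \<le> k" for k h using that unfolding \<theta>2_def by simp
    have *: "AE \<omega> in M. game_terminates \<Omega> \<theta>1 \<theta>2 \<omega>"
      "ereal_expectation M (payoff \<Omega> F \<epsilon> \<theta>1 \<theta>2) \<le> ereal (P 0 x0)"
      by (rule payoff_upper_bound[where P=P and n=n, OF e \<gamma>2 Fh P C]; use out leave pay tug never in blast)+
    show ?thesis unfolding expected_payoff_def p1' Let_def fst_conv snd_conv using * by simp
  qed
  then have "(SUP p1\<in>policies \<epsilon>. expected_payoff \<infinity> \<Omega> F \<epsilon> x0 p1 (S2, \<theta>2)) \<le> ereal (P 0 x0)"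
    by (intro SUP_least)
  moreover have "value_II \<Omega> F \<epsilon> x0 \<le> (SUP p1\<in>policies \<epsilon>. expected_payoff \<infinity> \<Omega> F \<epsilon> x0 p1 (S2, \<theta>2))"
    unfolding value_II_def using x0 by (auto intro: INF_lower2[OF pol])
  ultimately show ?thesis by (rule order_trans[rotated])
qed

text \<open>For a pair of policies under which the game does not end almost surely, the two
  conventions give \<open>- \<infinity>\<close> and \<open>\<infinity>\<close>, which are in the
  right order.\<close>

lemma value_I_le_value_II: "value_I \<Omega> F \<epsilon> x \<le> value_II \<Omega> F \<epsilon> x"
proof (cases "x \<in> \<Omega>")
  case True
  have "(INF p2\<in>policies \<epsilon>. expected_payoff (-\<infinity>) \<Omega> F \<epsilon> x p1 p2)
      \<le> (SUP p1\<in>policies \<epsilon>. expected_payoff \<infinity> \<Omega> F \<epsilon> x p1 p2)"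
    if "p1 \<in> policies \<epsilon>" "p2 \<in> policies \<epsilon>" for p1 p2
  proof -
    have "expected_payoff (-\<infinity>) \<Omega> F \<epsilon> x p1 p2 \<le> expected_payoff \<infinity> \<Omega> F \<epsilon> x p1 p2"
      unfolding expected_payoff_def Let_def by auto
    then show ?thesis by (intro INF_lower2[OF that(2)] SUP_upper2[OF that(1)])
  qed
  then show ?thesis unfolding value_I_def value_II_def using True
    by (auto intro!: SUP_least INF_greatest)
qed (simp add: value_I_def value_II_def)

section \<open>The strip around the domain and the terminal payoff\<close>

lemma in_outer_strip:
  fixes \<Omega> :: "'a::euclidean_space set"
  assumes "x \<in> \<Omega>" "y \<in> ball x \<epsilon>" "y \<notin> \<Omega>"
  shows "y \<in> outer_strip \<Omega> \<epsilon>"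
proof -
  have "closed_segment x y \<inter> frontier \<Omega> \<noteq> {}"
    by (rule connected_Int_frontier) (use assms in auto)
  then obtain z where z: "z \<in> closed_segment x y" "z \<in> frontier \<Omega>" by auto
  have "infdist y (frontier \<Omega>) \<le> dist y z" by (rule infdist_le[OF z(2)])
  also have "\<dots> \<le> dist x y" using segment_bound(2)[OF z(1)] by (simp add: dist_norm norm_minus_commute)
  finally show ?thesis using assms by (auto simp: outer_strip_def)
qed

lemma frontier_in_outer_strip:
  assumes "open \<Omega>" "0 < \<epsilon>" "x \<in> frontier \<Omega>"
  shows "x \<in> outer_strip \<Omega> \<epsilon>"
  using assms by (auto simp: outer_strip_def frontier_def interior_open)

lemma frontier_nonempty:
  fixes \<Omega> :: "'a::euclidean_space set"
  assumes "bounded \<Omega>" "\<Omega> \<noteq> {}"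
  shows "frontier \<Omega> \<noteq> {}"
  using assms frontier_eq_empty[of \<Omega>] not_bounded_UNIV by auto

lemma outer_strip_near:
  fixes \<Omega> :: "'a::euclidean_space set"
  assumes "bounded \<Omega>" "\<Omega> \<noteq> {}" "x \<in> outer_strip \<Omega> \<epsilon>"
  shows "\<exists>z\<in>frontier \<Omega>. dist x z < \<epsilon>"
  using infdist_attains_inf[OF frontier_closed frontier_nonempty[OF assms(1,2)], of x] assms(3)
  unfolding outer_strip_def by force

lemma bounded_outer_strip:
  fixes \<Omega> :: "'a::euclidean_space set"
  assumes "bounded \<Omega>" "\<Omega> \<noteq> {}"
  shows "bounded (outer_strip \<Omega> \<epsilon>)"
proof -
  have "bounded (frontier \<Omega>)" using assms by (auto simp: frontier_def intro: bounded_subset[OF bounded_closure])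
  then obtain B where B: "\<And>z. z \<in> frontier \<Omega> \<Longrightarrow> norm z \<le> B" by (auto simp: bounded_iff)
  have "norm x \<le> B + \<epsilon>" if x: "x \<in> outer_strip \<Omega> \<epsilon>" for x
  proof -
    obtain z where "z \<in> frontier \<Omega>" "dist x z < \<epsilon>" using outer_strip_near[OF assms x] by auto
    then show ?thesis using B[of z] norm_triangle_sub[of x z] by (simp add: dist_norm)
  qed
  then show ?thesis by (auto simp: bounded_iff)
qed

lemma
  fixes \<Omega> :: "'a::euclidean_space set"
  assumes \<Omega>: "open \<Omega>" "bounded \<Omega>" "\<Omega> \<noteq> {}" and F: "L-lipschitz_on (outer_strip \<Omega> \<epsilon>) F"
  shows borel_measurable_strip_payoff: "strip_payoff \<Omega> \<epsilon> F \<in> borel_measurable borel"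
    and strip_payoff_bounded: "\<exists>C. \<forall>x. \<bar>strip_payoff \<Omega> \<epsilon> F x\<bar> \<le> C"
proof -
  have "outer_strip \<Omega> \<epsilon> = - \<Omega> \<inter> (\<lambda>x. infdist x (frontier \<Omega>)) -` {..<\<epsilon>}"
    by (auto simp: outer_strip_def)
  moreover have "open ((\<lambda>x. infdist x (frontier \<Omega>)) -` {..<\<epsilon>})"
    by (intro open_vimage continuous_intros) 
  ultimately have S: "outer_strip \<Omega> \<epsilon> \<in> sets borel" using \<Omega> by auto
  have eq: "strip_payoff \<Omega> \<epsilon> F = (\<lambda>x. indicator (outer_strip \<Omega> \<epsilon>) x *\<^sub>R F x)"
    by (auto simp: strip_payoff_def fun_eq_iff)
  show "strip_payoff \<Omega> \<epsilon> F \<in> borel_measurable borel"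
    unfolding eq by (rule borel_measurable_continuous_on_indicator[OF S lipschitz_on_continuous_on[OF F]])
  have "bounded (F ` outer_strip \<Omega> \<epsilon>)"
    by (rule bounded_uniformly_continuous_image[OF lipschitz_on_uniformly_continuous[OF F] bounded_outer_strip[OF \<Omega>(2,3)]])
  then obtain C where "\<And>x. x \<in> outer_strip \<Omega> \<epsilon> \<Longrightarrow> \<bar>F x\<bar> \<le> C" by (auto simp: bounded_iff)
  then have "\<bar>strip_payoff \<Omega> \<epsilon> F x\<bar> \<le> max C 0" for x
    unfolding strip_payoff_def by (auto simp: le_max_iff_disj)
  then show "\<exists>C. \<forall>x. \<bar>strip_payoff \<Omega> \<epsilon> F x\<bar> \<le> C" by blast
qed

text \<open>
  The function is \<open>(x \<bullet> i + R)\<^sup>2 - A\<close>: along the direction of the unit vector \<open>i\<close> it is increasing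
  and convex, and its second difference gives the strictness.
\<close>

lemma strict_subsolution_exists:
  fixes \<Omega> :: "'a::euclidean_space set"
  assumes e: "0 < \<epsilon>" and "bounded \<Omega>"
  shows "\<exists>p \<gamma> C. continuous_on UNIV p \<and> 0 < \<gamma> \<and>
    (\<forall>x\<in>\<Omega>. \<forall>y\<in>ball x \<epsilon>. - C \<le> p y \<and> p y \<le> - c) \<and>
    (\<forall>x\<in>\<Omega>. p x + \<gamma> \<le> (bsup \<epsilon> p x + binf \<epsilon> p x) / 2)"
proof -
  obtain B where B: "\<And>x. x \<in> \<Omega> \<Longrightarrow> norm x \<le> B" "0 < B" using assms(2) by (auto simp: bounded_pos)
  obtain i :: 'a where i: "i \<in> Basis" using nonempty_Basis by blast
  \<comment> \<open>\<open>R\<close> makes \<open>y \<bullet> i + R\<close> positive on all balls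
    centred in the domain, so squaring is monotone there; \<open>A\<close> shifts the whole range
    below \<open>- c\<close>.\<close>
  define R where "R = B + \<epsilon> + 1"
  define A where "A = (2 * R)\<^sup>2 + c"
  define p where "p x = (x \<bullet> i + R)\<^sup>2 - A" for x :: 'a
  define C where "C = \<bar>A\<bar> + \<bar>c\<bar>"
  have xi: "\<bar>x \<bullet> i\<bar> \<le> B" if "x \<in> \<Omega>" for x
    using Basis_le_norm[OF i, of x] B(1)[OF that] by linarith
  have yi: "x \<bullet> i - \<epsilon> \<le> y \<bullet> i" "y \<bullet> i \<le> x \<bullet> i + \<epsilon>" if "y \<in> ball x \<epsilon>" for x y
  proof -
    have "\<bar>(y - x) \<bullet> i\<bar> < \<epsilon>"
      using Basis_le_norm[OF i, of "y - x"] that by (simp add: dist_norm norm_minus_commute)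
    then show "x \<bullet> i - \<epsilon> \<le> y \<bullet> i" "y \<bullet> i \<le> x \<bullet> i + \<epsilon>" by (auto simp: inner_diff_left)
  qed
  have range: "- C \<le> p y" "p y \<le> - c" if x: "x \<in> \<Omega>" and y: "y \<in> ball x \<epsilon>" for x y
  proof -
    have "0 \<le> y \<bullet> i + R" "y \<bullet> i + R \<le> 2 * R" using xi[OF x] yi[OF y] unfolding R_def by auto
    then have "(y \<bullet> i + R)\<^sup>2 \<le> (2 * R)\<^sup>2" by (intro power_mono) auto
    moreover have "0 \<le> (y \<bullet> i + R)\<^sup>2" by simp
    ultimately show "- C \<le> p y" "p y \<le> - c"
      using A_def abs_ge_minus_self[of A] abs_ge_zero[of c] abs_ge_self[of A] unfolding p_def C_def by linarith+
  qed
  have strict: "p x + \<epsilon>\<^sup>2 / 4 \<le> (bsup \<epsilon> p x + binf \<epsilon> p x) / 2" if x: "x \<in> \<Omega>" for x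
  proof -
    define t where "t = x \<bullet> i + R"
    have t: "\<epsilon> \<le> t" "t \<le> 2 * R" using xi[OF x] e B(2) unfolding t_def R_def by auto
    have R: "\<epsilon> < R" using B(2) unfolding R_def by simp
    have "\<bar>p y\<bar> \<le> max \<bar>C\<bar> \<bar>c\<bar>" if "y \<in> ball x \<epsilon>" for y using range[OF x that] by linarith
    note bnd = this
    have inf: "(t - \<epsilon>)\<^sup>2 - A \<le> binf \<epsilon> p x"
    proof (intro binf_greatest[OF e])
      fix y assume y: "y \<in> ball x \<epsilon>"
      have "(t - \<epsilon>)\<^sup>2 \<le> (y \<bullet> i + R)\<^sup>2" using yi[OF y] t unfolding t_def by (intro power_mono) auto
      then show "(t - \<epsilon>)\<^sup>2 - A \<le> p y" unfolding p_def by simp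
    qed
    \<comment> \<open>The open ball contains no step of length \<open>\<epsilon>\<close>. Shortening
      it by \<open>\<epsilon>\<^sup>2 / (8 * R)\<close> costs at most
      \<open>\<epsilon>\<^sup>2 / 2\<close> in the term linear in \<open>t\<close>, and the term
      \<open>\<epsilon>\<^sup>2\<close> from the backward step outweighs this.\<close>
    define s where "s = \<epsilon> - \<epsilon>\<^sup>2 / (8 * R)"
    have "\<epsilon>\<^sup>2 / (8 * R) < \<epsilon>" "0 < \<epsilon>\<^sup>2 / (8 * R)" using R e by (auto simp: power2_eq_square field_simps)
    then have s: "0 < s" "s < \<epsilon>" unfolding s_def by auto
    have "x + s *\<^sub>R i \<in> ball x \<epsilon>" using s i by (simp add: dist_norm)
    from bsup_upper[of x \<epsilon> p, OF bnd this] have sup: "(t + s)\<^sup>2 - A \<le> bsup \<epsilon> p x"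
      unfolding p_def t_def using i by (simp add: inner_add_left algebra_simps)
    have "t * (\<epsilon>\<^sup>2 / (8 * R)) \<le> 2 * R * (\<epsilon>\<^sup>2 / (8 * R))" using t R e by (intro mult_right_mono) auto
    also have "\<dots> = \<epsilon>\<^sup>2 / 4" using R e by (simp add: field_simps)
    finally have "t * (\<epsilon> - s) \<le> \<epsilon>\<^sup>2 / 4" unfolding s_def by simp
    moreover have "(t + s)\<^sup>2 + (t - \<epsilon>)\<^sup>2 = 2 * t\<^sup>2 - 2 * (t * (\<epsilon> - s)) + s\<^sup>2 + \<epsilon>\<^sup>2"
      by (simp add: power2_eq_square algebra_simps)
    moreover have "0 \<le> s\<^sup>2" by simp
    ultimately have "2 * t\<^sup>2 + \<epsilon>\<^sup>2 / 2 \<le> (t + s)\<^sup>2 + (t - \<epsilon>)\<^sup>2" by argo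
    then show ?thesis using sup inf unfolding p_def t_def[symmetric] by argo
  qed
  have "continuous_on UNIV p" unfolding p_def[abs_def] by (intro continuous_intros)
  then show ?thesis using range strict e by (intro exI[of _ p] exI[of _ "\<epsilon>\<^sup>2 / 4"] exI[of _ C]) auto
qed

lemma abs_dpp:
  assumes "0 < \<epsilon>" "\<And>y. y \<in> ball x \<epsilon> \<Longrightarrow> \<bar>f y\<bar> \<le> C"
  shows "\<bar>dpp \<epsilon> f x\<bar> \<le> C"
proof -
  have "\<bar>bsup \<epsilon> f x\<bar> \<le> C" by (rule abs_bsup[OF assms])
  moreover have "\<bar>binf \<epsilon> f x\<bar> \<le> C" by (rule abs_binf[OF assms])
  ultimately have "- C \<le> (bsup \<epsilon> f x + binf \<epsilon> f x) / 2" "(bsup \<epsilon> f x + binf \<epsilon> f x) / 2 \<le> C" "0 \<le> C"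
    by (auto simp: abs_le_iff)
  moreover have "\<bar>min a (max 0 b)\<bar> \<le> C" if "- C \<le> a" "a \<le> C" "0 \<le> C" for a b
    using that by (auto simp: min_def max_def abs_le_iff)
  ultimately show ?thesis unfolding dpp_def by blast
qed

text \<open>The increasing iterates of a strict subsolution and the decreasing iterates of a strict
  supersolution enclose \<open>v\<close>. A monotone limit alone need not pass through the infimum
  in the operator; the uniform closeness of the two sequences is what yields the equation for
  \<open>v\<close>.\<close>

theorem game_value_dpp:
  fixes \<Omega> :: "'a::euclidean_space set"
  assumes \<Omega>: "open \<Omega>" "bounded \<Omega>" "\<Omega> \<noteq> {}" and e: "0 < \<epsilon>"
    and F: "L-lipschitz_on (outer_strip \<Omega> \<epsilon>) F"
  shows "\<exists>v C. is_game_value \<Omega> F \<epsilon> v \<and> (\<forall>x. \<bar>v x\<bar> \<le> C) \<and> (\<forall>x\<in>\<Omega>. v x = dpp \<epsilon> v x) \<and>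
    (\<forall>x\<in>outer_strip \<Omega> \<epsilon>. v x = F x)"
proof -
  let ?F = "strip_payoff \<Omega> \<epsilon> F"
  note Fh = borel_measurable_strip_payoff[OF \<Omega> F]
  obtain c where c: "\<And>x. \<bar>?F x\<bar> \<le> c" using strip_payoff_bounded[OF \<Omega> F] by blast
  have c0: "0 \<le> c" using c by (meson abs_ge_zero order_trans)
  \<comment> \<open>The bound \<open>- (c + 1)\<close> puts \<open>p\<close> below every payoff and,
    for a drift of at most 1, keeps \<open>p\<close> plus the drift nonpositive, so that the leaving
    branch is respected too.\<close>
  obtain p \<gamma> C' where p: "continuous_on UNIV p" "0 < \<gamma>"
    "\<And>x y. x \<in> \<Omega> \<Longrightarrow> y \<in> ball x \<epsilon> \<Longrightarrow> - C' \<le> p y"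
    "\<And>x y. x \<in> \<Omega> \<Longrightarrow> y \<in> ball x \<epsilon> \<Longrightarrow> p y \<le> - (c + 1)"
    "\<And>x. x \<in> \<Omega> \<Longrightarrow> p x + \<gamma> \<le> (bsup \<epsilon> p x + binf \<epsilon> p x) / 2"
    using strict_subsolution_exists[OF e \<Omega>(2), of "c + 1"] by blast
  define C where "C = max \<bar>C'\<bar> (c + 1)"
  have pC: "\<bar>p y\<bar> \<le> C" if "x \<in> \<Omega>" "y \<in> ball x \<epsilon>" for x y
    using p(3)[OF that] p(4)[OF that] c0 unfolding C_def by linarith
  have FC: "\<bar>?F x\<bar> \<le> C" for x using c[of x] unfolding C_def by linarith
  define T where "T f x = (if x \<in> \<Omega> then dpp \<epsilon> f x else ?F x)" for f x
  define u where "u n = (T ^^ n) (\<lambda>x. if x \<in> \<Omega> then p x else ?F x)" for n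
  define w where "w n = (T ^^ n) (\<lambda>x. if x \<in> \<Omega> then - p x else ?F x)" for n
  have u0: "u 0 = (\<lambda>x. if x \<in> \<Omega> then p x else ?F x)" and uS: "u (Suc n) = T (u n)" for n unfolding u_def by auto
  have w0: "w 0 = (\<lambda>x. if x \<in> \<Omega> then - p x else ?F x)" and wS: "w (Suc n) = T (w n)" for n unfolding w_def by auto
  have pC': "\<bar>p x\<bar> \<le> C" if "x \<in> \<Omega>" for x using pC[OF that] e by simp
  have TC: "\<bar>T f x\<bar> \<le> C" if "\<And>x. \<bar>f x\<bar> \<le> C" for f x
    unfolding T_def using abs_dpp[OF e, of x f C] that FC by auto
  have uC: "\<bar>u n x\<bar> \<le> C" for n x
    by (induction n arbitrary: x) (use pC' FC TC in \<open>auto simp: u0 uS\<close>)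
  have wC: "\<bar>w n x\<bar> \<le> C" for n x
    by (induction n arbitrary: x) (use pC' FC TC in \<open>auto simp: w0 wS\<close>)
  have TB: "T f \<in> borel_measurable borel" if "f \<in> borel_measurable borel" "\<And>x. \<bar>f x\<bar> \<le> C" for f
  proof -
    note [measurable] = Fh borel_measurable_dpp[OF e that(2)]
    have [measurable]: "\<Omega> \<in> sets borel" using \<Omega> by simp
    show ?thesis unfolding T_def[abs_def] by measurable
  qed
  have [measurable]: "\<Omega> \<in> sets borel" using \<Omega> by simp
  have [measurable]: "p \<in> borel_measurable borel" by (rule borel_measurable_continuous_onI[OF p(1)])
  note [measurable] = Fh
  have uB: "u n \<in> borel_measurable borel" for n
  proof (induction n)
    case 0 show ?case unfolding u0 by measurable
  next
    case (Suc n) then show ?case unfolding uS using uC by (intro TB)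
  qed
  have wB: "w n \<in> borel_measurable borel" for n
  proof (induction n)
    case 0 show ?case unfolding w0 by measurable
  next
    case (Suc n) then show ?case unfolding wS using wC by (intro TB)
  qed
  \<comment> \<open>Outside the domain \<open>u 0\<close> and \<open>w 0\<close> are the payoff,
    which lies between \<open>p\<close> and \<open>- p\<close>; this transfers the strict inequality
    of \<open>p\<close> to \<open>u 0\<close> and, negated, to \<open>w 0\<close>.\<close>
  have uw0: "p y \<le> u 0 y" "w 0 y \<le> - p y" if "x \<in> \<Omega>" "y \<in> ball x \<epsilon>" for x y
    using p(4)[OF that] c[of y] c0 unfolding u0 w0 by auto
  define \<gamma>' where "\<gamma>' = min \<gamma> 1"
  have \<gamma>': "0 < \<gamma>'" "\<gamma>' \<le> \<gamma>" "\<gamma>' \<le> 1" using p(2) unfolding \<gamma>'_def by auto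
  have strict_u: "u 0 x + \<gamma>' \<le> dpp \<epsilon> (u 0) x" if x: "x \<in> \<Omega>" for x
  proof -
    have "dpp \<epsilon> p x \<le> dpp \<epsilon> (u 0) x + 0"
      by (rule dpp_mono[OF e, of _ _ p C "u 0" C]) (use pC[OF x] uC uw0[OF x] in auto)
    moreover have "p x \<le> - (c + 1)" using p(4)[OF x] e by simp
    then have "p x + \<gamma>' \<le> dpp \<epsilon> p x"
      using p(5)[OF x] \<gamma>' c0 unfolding dpp_def by auto
    ultimately show ?thesis using x unfolding u0 by simp
  qed
  \<comment> \<open>Strictness is recorded for tug-of-war alone, because Player II eventually stops
    passing.\<close>
  have strict_w: "(bsup \<epsilon> (w 0) x + binf \<epsilon> (w 0) x) / 2 + \<gamma>' \<le> w 0 x" if x: "x \<in> \<Omega>" for x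
  proof -
    have "bsup \<epsilon> (w 0) x \<le> bsup \<epsilon> (\<lambda>y. - p y) x + 0" "binf \<epsilon> (w 0) x \<le> binf \<epsilon> (\<lambda>y. - p y) x + 0"
      using pC[OF x] wC uw0[OF x]
      by (auto intro!: bsup_mono[OF e, where C=C] binf_mono[OF e, where C=C] simp del: add_0_right)
    moreover have "bsup \<epsilon> (\<lambda>y. - p y) x = - binf \<epsilon> p x" "binf \<epsilon> (\<lambda>y. - p y) x = - bsup \<epsilon> p x"
      using bsup_uminus[of \<epsilon> p x] bsup_uminus[of \<epsilon> "\<lambda>y. - p y" x] by auto
    moreover have "w 0 x = - p x" using x unfolding w0 by simp
    ultimately show ?thesis using p(5)[OF x] \<gamma>' by argo
  qed
  have dpp_avg: "dpp \<epsilon> f x \<le> (bsup \<epsilon> f x + binf \<epsilon> f x) / 2" for f x unfolding dpp_def by (rule min.cobounded1)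
  have Tmono: "T f x \<le> T g x" if "\<And>x. \<bar>f x\<bar> \<le> C" "\<And>x. \<bar>g x\<bar> \<le> C" "\<And>x. f x \<le> g x" for f g x
    unfolding T_def using dpp_mono[OF e, of 0 x f C g C] that by auto
  have u_inc: "u n x \<le> u (Suc n) x" for n x
  proof (induction n arbitrary: x)
    case 0
    show ?case using strict_u[of x] \<gamma>' unfolding uS T_def by (auto simp: u0)
  next
    case (Suc n)
    have "T (u n) x \<le> T (u (Suc n)) x" by (intro Tmono uC Suc)
    then show ?case by (simp only: uS[symmetric])
  qed
  have w_dec: "w (Suc n) x \<le> w n x" for n x
  proof (induction n arbitrary: x)
    case 0
    show ?case
    proof (cases "x \<in> \<Omega>")
      case True
      have "dpp \<epsilon> (w 0) x \<le> w 0 x" using strict_w[OF True] dpp_avg[of "w 0" x] \<gamma>'(1) by linarith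
      then show ?thesis using True by (simp add: wS T_def)
    qed (simp add: wS T_def w0)
  next
    case (Suc n)
    have "T (w (Suc n)) x \<le> T (w n) x" by (intro Tmono wC Suc)
    then show ?case by (simp only: wS[symmetric])
  qed
  have uw: "u n x \<le> w n x" for n x
  proof (induction n arbitrary: x)
    case 0
    show ?case using p(4)[of x x] e c0 unfolding u0 w0 by auto
  next
    case (Suc n)
    show ?case unfolding uS wS by (intro Tmono uC wC Suc)
  qed
  define v where "v x = (SUP n. u n x)" for x
  have bdd: "bdd_above (range (\<lambda>n. u n x))" for x using uC by (auto intro!: bdd_aboveI[of _ C] simp: abs_le_iff)
  have uv: "u n x \<le> v x" for n x unfolding v_def by (rule cSUP_upper[OF _ bdd]) simp
  have vw: "v x \<le> w n x" for n x
    unfolding v_def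
  proof (rule cSUP_least)
    fix k
    have "u k x \<le> u (max k n) x" using lift_Suc_mono_le[of "\<lambda>n. u n x"] u_inc by simp
    also have "\<dots> \<le> w (max k n) x" by (rule uw)
    also have "\<dots> \<le> w n x" using lift_Suc_antimono_le[of "\<lambda>n. w n x"] w_dec by simp
    finally show "u k x \<le> w n x" .
  qed simp
  have vC: "\<bar>v x\<bar> \<le> C" for x using uC[of 0 x] wC[of 0 x] uv[of 0 x] vw[of x 0] by linarith
  \<comment> \<open>Comparison is applied with the roles exchanged: the larger sequence
    \<open>w\<close> as subsolution, the smaller \<open>u\<close> as supersolution. Both satisfy the
    recursion with equality and agree outside the domain.\<close>
  have close: "\<exists>n. \<forall>x. w n x \<le> u n x + m" if m: "0 < m" for m
  proof -
    have out: "w n y = u n y" if "y \<notin> \<Omega>" for n y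
      using that by (cases n) (auto simp: u0 w0 uS wS T_def)
    have "\<exists>N. \<forall>n\<ge>N. \<forall>x\<in>\<Omega>. w n x \<le> u n x + m"
      by (rule dpp_iterates_comparison[OF e \<Omega>(2), where C=C])
        (use uC wC out m in \<open>auto simp: uS wS T_def\<close>)
    then obtain n where "\<forall>x\<in>\<Omega>. w n x \<le> u n x + m" by blast
    then show ?thesis using out m by (metis add_0_right add_le_cancel_left less_imp_le)
  qed
  have vdpp: "v x = dpp \<epsilon> v x" if x: "x \<in> \<Omega>" for x
  proof (rule antisym)
    show "v x \<le> dpp \<epsilon> v x"
      unfolding v_def[of x]
    proof (rule cSUP_least)
      fix n
      have "u n x \<le> u (Suc n) x" by (rule u_inc)
      also have "\<dots> = dpp \<epsilon> (u n) x" using x by (simp add: uS T_def)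
      also have "\<dots> \<le> dpp \<epsilon> v x + 0" by (rule dpp_mono[OF e, where C=C and C'=C]) (use uC vC uv in auto)
      finally show "u n x \<le> dpp \<epsilon> v x" by simp
    qed simp
    show "dpp \<epsilon> v x \<le> v x"
    proof (rule field_le_epsilon)
      fix m :: real assume m: "0 < m"
      obtain n where n: "\<And>x. w n x \<le> u n x + m" using close[OF m] by blast
      have "v y \<le> u n y + m" for y using n[of y] vw[of y n] by linarith
      then have "dpp \<epsilon> v x \<le> dpp \<epsilon> (u n) x + m"
        by (intro dpp_mono[OF e, where C=C and C'=C]) (use uC vC m in auto)
      also have "dpp \<epsilon> (u n) x = u (Suc n) x" using x by (simp add: uS T_def)
      also have "\<dots> \<le> v x" by (rule uv)
      finally show "dpp \<epsilon> v x \<le> v x + m" by simp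
    qed
  qed
  have vF: "v x = ?F x" if "x \<notin> \<Omega>" for x
    using uv[of 0 x] vw[of x 0] that unfolding u0 w0 by simp
  have lower: "ereal (v x) \<le> value_I \<Omega> F \<epsilon> x" if x: "x \<in> \<Omega>" for x
  proof -
    have step: "ereal (u n x - \<eta> * real (Suc n)) \<le> value_I \<Omega> F \<epsilon> x" if \<eta>: "0 < \<eta>" for n \<eta>
    proof -
      \<comment> \<open>The iterates are played in reverse: at turn \<open>k\<close> there remain
        \<open>n - k\<close> of them. The correction shrinks by \<open>\<eta>\<close> per turn and
        so provides the drift. From turn \<open>n\<close> on truncated subtraction fixes
        \<open>P\<close> at \<open>u 0 - \<eta>\<close>, and the drift \<open>\<gamma>'\<close> of
        \<open>u 0\<close> takes over.\<close>
      define P where "P k y = u (n - k) y - \<eta> * real (Suc (n - k))" for k y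
      have b: "\<eta> * real (Suc (n - k)) \<le> \<eta> * real (Suc n)" "0 \<le> \<eta> * real (Suc (n - k))" for k
        using \<eta> by (auto intro!: mult_left_mono)
      have Pb: "\<bar>P k y\<bar> \<le> C + \<eta> * real (Suc n)" for k y
        using uC[of "n - k" y] b[of k] unfolding P_def by linarith
      have "ereal (P 0 x) \<le> value_I \<Omega> F \<epsilon> x"
      proof (rule value_I_ge[OF e _ \<Omega>(1) x Fh, where \<gamma>="min \<gamma>' \<eta>" and C="C + \<eta> * real (Suc n)"])
        show "P k \<in> borel_measurable borel" for k
          unfolding P_def[abs_def] using uB[of "n - k"] by measurable
        show "\<bar>P k y\<bar> \<le> C + \<eta> * real (Suc n)" for k y by (rule Pb)
        show "\<bar>?F y\<bar> \<le> C + \<eta> * real (Suc n)" for y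
          using FC[of y] b[of 0] by simp
        show "P k y \<le> ?F y" if "y \<notin> \<Omega>" for k y
          using that uv[of "n - k" y] vF[OF that] b(2)[of k] unfolding P_def by simp
        show "P k y + min \<gamma>' \<eta> \<le> dpp \<epsilon> (P (Suc k)) y" if y: "y \<in> \<Omega>" for k y
        proof -
          have mono: "dpp \<epsilon> (u (n - Suc k)) y \<le> dpp \<epsilon> (P (Suc k)) y + \<eta> * real (Suc (n - Suc k))"
            by (rule dpp_mono[OF e b(2) uC Pb]) (simp add: P_def)
          show ?thesis
          proof (cases "k < n")
            case True
            then have nk: "n - k = Suc (n - Suc k)" by simp
            have "u (n - k) y = dpp \<epsilon> (u (n - Suc k)) y" unfolding nk uS T_def using y by simp
            moreover have "\<eta> * real (Suc (n - k)) = \<eta> * real (Suc (n - Suc k)) + \<eta>"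
              unfolding nk by (simp add: algebra_simps)
            ultimately show ?thesis using mono unfolding P_def[of k] by linarith
          next
            case False
            then show ?thesis using mono strict_u[OF y] unfolding P_def[of k] by simp
          qed
        qed
      qed (use \<gamma>' \<eta> in auto)
      then show ?thesis unfolding P_def by simp
    qed
    have "ereal (v x - m) \<le> value_I \<Omega> F \<epsilon> x" if m: "0 < m" for m
    proof -
      \<comment> \<open>\<open>\<eta>\<close> is chosen after \<open>n\<close>, so that the total
        correction is \<open>m / 2\<close>.\<close>
      obtain n where n: "\<And>x. w n x \<le> u n x + m / 2" using close[of "m / 2"] m by auto
      have "ereal (v x - m) \<le> ereal (u n x - m / 2 / real (Suc n) * real (Suc n))"
        using n[of x] vw[of x n] by (simp del: of_nat_Suc)
      also have "\<dots> \<le> value_I \<Omega> F \<epsilon> x" by (rule step) (use m in simp)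
      finally show ?thesis .
    qed
    then have "ereal (v x) \<le> value_I \<Omega> F \<epsilon> x + ereal m" if "0 < m" for m
      using that by (cases "value_I \<Omega> F \<epsilon> x") (auto simp: algebra_simps)
    then show ?thesis by (blast intro: ereal_le_epsilon2)
  qed
  have upper: "value_II \<Omega> F \<epsilon> x \<le> ereal (v x)" if x: "x \<in> \<Omega>" for x
  proof -
    have step: "value_II \<Omega> F \<epsilon> x \<le> ereal (w n x + \<eta> * real (Suc n))" if \<eta>: "0 < \<eta>" for n \<eta>
    proof -
      \<comment> \<open>The mirror image of the construction for Player I. From turn
        \<open>n\<close> on \<open>P\<close> is \<open>w 0 + \<eta>\<close>, and
        \<open>strict_w\<close> supplies the drift without any pass.\<close>
      define P where "P k y = w (n - k) y + \<eta> * real (Suc (n - k))" for k y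
      have b: "\<eta> * real (Suc (n - k)) \<le> \<eta> * real (Suc n)" "0 \<le> \<eta> * real (Suc (n - k))" for k
        using \<eta> by (auto intro!: mult_left_mono)
      have Pb: "\<bar>P k y\<bar> \<le> C + \<eta> * real (Suc n)" for k y
        using wC[of "n - k" y] b[of k] unfolding P_def by linarith
      have "value_II \<Omega> F \<epsilon> x \<le> ereal (P 0 x)"
      proof (rule value_II_le[OF e _ \<Omega>(1) x Fh, where \<gamma>="min \<gamma>' \<eta>" and C="C + \<eta> * real (Suc n)" and n=n])
        show "P k \<in> borel_measurable borel" for k
          unfolding P_def[abs_def] using wB[of "n - k"] by measurable
        show "\<bar>P k y\<bar> \<le> C + \<eta> * real (Suc n)" for k y by (rule Pb)
        show "\<bar>?F y\<bar> \<le> C + \<eta> * real (Suc n)" for y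
          using FC[of y] b[of 0] by simp
        show "?F y \<le> P k y" if "y \<notin> \<Omega>" for k y
          using that vw[of y "n - k"] vF[OF that] b(2)[of k] unfolding P_def by simp
        show late: "(bsup \<epsilon> (P (Suc k)) y + binf \<epsilon> (P (Suc k)) y) / 2 + min \<gamma>' \<eta> \<le> P k y"
          if y: "y \<in> \<Omega>" and nk: "n \<le> k" for k y
        proof -
          have P0: "P k = (\<lambda>y. w 0 y + \<eta>)" "P (Suc k) = (\<lambda>y. w 0 y + \<eta>)" using nk unfolding P_def by auto
          have "bsup \<epsilon> (P (Suc k)) y \<le> bsup \<epsilon> (w 0) y + \<eta>"
            by (rule bsup_mono[OF e wC]) (simp add: P0)
          moreover have "binf \<epsilon> (P (Suc k)) y \<le> binf \<epsilon> (w 0) y + \<eta>"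
            by (rule binf_mono[OF e Pb]) (simp add: P0)
          moreover have "min \<gamma>' \<eta> \<le> \<gamma>'" by simp
          moreover have "P k y = w 0 y + \<eta>" by (simp add: P0(1))
          ultimately show ?thesis using strict_w[OF y] by argo
        qed
        show "dpp \<epsilon> (P (Suc k)) y + min \<gamma>' \<eta> \<le> P k y" if y: "y \<in> \<Omega>" for k y
        proof (cases "k < n")
          case True
          then have nk: "n - k = Suc (n - Suc k)" by simp
          have "dpp \<epsilon> (P (Suc k)) y \<le> dpp \<epsilon> (w (n - Suc k)) y + \<eta> * real (Suc (n - Suc k))"
            by (rule dpp_mono[OF e b(2) Pb wC]) (simp add: P_def)
          moreover have "w (n - k) y = dpp \<epsilon> (w (n - Suc k)) y" unfolding nk wS T_def using y by simp
          moreover have "\<eta> * real (Suc (n - k)) = \<eta> * real (Suc (n - Suc k)) + \<eta>"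
            unfolding nk by (simp add: algebra_simps)
          ultimately show ?thesis unfolding P_def[of k] by linarith
        next
          case False
          then show ?thesis using late[OF y, of k] dpp_avg[of "P (Suc k)" y] by linarith
        qed
      qed (use \<gamma>' \<eta> in auto)
      then show ?thesis unfolding P_def by simp
    qed
    have "value_II \<Omega> F \<epsilon> x \<le> ereal (v x) + ereal m" if m: "0 < m" for m
    proof -
      obtain n where n: "\<And>x. w n x \<le> u n x + m / 2" using close[of "m / 2"] m by auto
      have "value_II \<Omega> F \<epsilon> x \<le> ereal (w n x + m / 2 / real (Suc n) * real (Suc n))"
        by (rule step) (use m in simp)
      also have "\<dots> \<le> ereal (v x + m)"
        using n[of x] uv[of n x] by (simp del: of_nat_Suc)
      finally show ?thesis by simp
    qed
    then show ?thesis by (blast intro: ereal_le_epsilon2)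
  qed
  have "is_game_value \<Omega> F \<epsilon> v"
    unfolding is_game_value_def
  proof
    fix x assume x: "x \<in> \<Omega> \<union> outer_strip \<Omega> \<epsilon>"
    show "value_I \<Omega> F \<epsilon> x = ereal (v x) \<and> value_II \<Omega> F \<epsilon> x = ereal (v x)"
    proof (cases "x \<in> \<Omega>")
      case True
      show ?thesis
        by (intro conjI antisym order_trans[OF value_I_le_value_II upper[OF True]] lower[OF True]
            upper[OF True] order_trans[OF lower[OF True] value_I_le_value_II])
    next
      case False
      then show ?thesis using x vF[OF False] unfolding value_I_def value_II_def strip_payoff_def by auto
    qed
  qed
  moreover have "v x = F x" if "x \<in> outer_strip \<Omega> \<epsilon>" for x
    using vF[of x] that unfolding strip_payoff_def by (auto simp: outer_strip_def)
  ultimately show ?thesis using vC vdpp by blast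
qed

subsection \<open>Almost Lipschitz continuity\<close>

text \<open>The game enters the remaining argument only through these three properties of its value.
  The bound may depend on \<open>\<epsilon>\<close>; a common bound on the closed domain comes later
  from the almost Lipschitz estimate.\<close>

definition dpp_solution :: "'a::euclidean_space set \<Rightarrow> ('a \<Rightarrow> real) \<Rightarrow> real \<Rightarrow> ('a \<Rightarrow> real) \<Rightarrow> bool" where
  "dpp_solution \<Omega> F \<epsilon> v \<longleftrightarrow> (\<exists>C. \<forall>x. \<bar>v x\<bar> \<le> C) \<and> (\<forall>x\<in>\<Omega>. v x = dpp \<epsilon> v x) \<and>
    (\<forall>x\<in>outer_strip \<Omega> \<epsilon>. v x = F x)"

text \<open>
  A cone with slope \<open>L\<close> is not a discrete subsolution near its vertex; the additional jump
  \<open>L * \<epsilon>\<close> at the vertex repairs this.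
\<close>

lemma jump_cone:
  fixes x y :: "'a::euclidean_space" and c :: real
  assumes e: "0 < \<epsilon>" and L: "0 \<le> L" and xy: "x \<noteq> y"
  defines "q \<equiv> \<lambda>z. if z = y then c else c - L * dist z y - L * \<epsilon>"
  shows "q x + L * \<epsilon> \<le> bsup \<epsilon> q x" "q x - L * \<epsilon> \<le> binf \<epsilon> q x"
proof -
  let ?r = "dist x y"
  have r: "0 < ?r" using xy by simp
  have le: "L * dist z y \<le> L * (?r + \<epsilon>)" if "z \<in> ball x \<epsilon>" for z
    using that L dist_triangle[of z y x] by (intro mult_left_mono) (auto simp: dist_commute)
  have bnd: "\<bar>q z\<bar> \<le> \<bar>c\<bar> + L * (?r + \<epsilon>) + L * \<epsilon>" if "z \<in> ball x \<epsilon>" for z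
  proof -
    have "0 \<le> L * dist z y" "0 \<le> L * \<epsilon>" "0 \<le> L * (?r + \<epsilon>)" using L e by auto
    then have "\<bar>c - L * dist z y - L * \<epsilon>\<bar> \<le> \<bar>c\<bar> + L * (?r + \<epsilon>) + L * \<epsilon>"
      "\<bar>c\<bar> \<le> \<bar>c\<bar> + L * (?r + \<epsilon>) + L * \<epsilon>" using le[OF that] by linarith+
    then show ?thesis unfolding q_def by (simp split: if_split)
  qed
  have qx: "q x = c - L * ?r - L * \<epsilon>" using xy unfolding q_def by simp
  show "q x - L * \<epsilon> \<le> binf \<epsilon> q x"
  proof (rule binf_greatest[OF e])
    fix z assume z: "z \<in> ball x \<epsilon>"
    show "q x - L * \<epsilon> \<le> q z"
    proof -
      have "0 \<le> L * ?r" "0 \<le> L * \<epsilon>" "L * (?r + \<epsilon>) = L * ?r + L * \<epsilon>"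
        using L e by (auto simp: distrib_left)
      moreover have "q z = c \<or> q z = c - L * dist z y - L * \<epsilon>" unfolding q_def by simp
      ultimately show ?thesis using le[OF z] unfolding qx by linarith
    qed
  qed
  show "q x + L * \<epsilon> \<le> bsup \<epsilon> q x"
  proof (cases "?r < \<epsilon>")
    \<comment> \<open>Within reach of the vertex the jump \<open>L * \<epsilon>\<close> replaces the
      radial step, which would overshoot.\<close>
    case True
    then have "q y \<le> bsup \<epsilon> q x" using bsup_upper[of x \<epsilon> q, OF bnd] by simp
    moreover have "0 \<le> L * ?r" using L r by simp
    ultimately show ?thesis unfolding qx by (simp add: q_def)
  next
    case False
    show ?thesis
    proof (rule field_le_epsilon)
      fix \<eta> :: real assume \<eta>: "0 < \<eta>"
      \<comment> \<open>A step of length \<open>\<epsilon>\<close> leaves the open ball; shortening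
        it by \<open>\<sigma>\<close> costs at most \<open>\<eta>\<close>.\<close>
      define \<sigma> where "\<sigma> = min (\<epsilon> / 2) (\<eta> / (L + 1))"
      have "0 < \<eta> / (L + 1)" using L \<eta> by auto
      moreover have "\<sigma> \<le> \<epsilon> / 2" unfolding \<sigma>_def by (rule min.cobounded1)
      ultimately have \<sigma>: "0 < \<sigma>" "\<sigma> < \<epsilon>" using e unfolding \<sigma>_def by auto
      have "L * \<sigma> \<le> (L + 1) * (\<eta> / (L + 1))"
        using L \<eta> \<sigma> unfolding \<sigma>_def by (intro mult_mono) auto
      then have L\<sigma>: "L * \<sigma> \<le> \<eta>" using L by simp
      define s where "s = \<epsilon> - \<sigma>"
      have s: "0 < s" "s < \<epsilon>" "s < ?r" using \<sigma> False unfolding s_def by auto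
      define z where "z = x + (s / ?r) *\<^sub>R (y - x)"
      have "dist x z = s" unfolding z_def using r s by (simp add: dist_norm norm_minus_commute)
      then have zb: "z \<in> ball x \<epsilon>" using s by simp
      have "z - y = (1 - s / ?r) *\<^sub>R (x - y)" unfolding z_def by (simp add: algebra_simps)
      then have "dist z y = (1 - s / ?r) * ?r" using s r by (simp add: dist_norm)
      then have dz: "dist z y = ?r - s" using r by (simp add: field_simps)
      then have "z \<noteq> y" using s by auto
      then have "c - L * (?r - s) - L * \<epsilon> \<le> bsup \<epsilon> q x"
        using bsup_upper[of x \<epsilon> q, OF bnd zb] dz by (simp add: q_def)
      then show "q x + L * \<epsilon> \<le> bsup \<epsilon> q x + \<eta>" using L\<sigma> unfolding qx s_def by (simp add: algebra_simps)
    qed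
  qed
qed

text \<open>Slope at least 1 makes a step of length \<open>\<epsilon>\<close> up the cone worth its
  price, so the cone with top value \<open>F y\<close> is a subsolution for both branches. For the
  upper barrier the reflected cone only has to dominate the average, because the operator is a
  minimum.\<close>

lemma
  fixes \<Omega> :: "'a::euclidean_space set"
  assumes \<Omega>: "open \<Omega>" "bounded \<Omega>" and e: "0 < \<epsilon>" and L: "1 \<le> L"
    and F: "L-lipschitz_on (outer_strip \<Omega> \<epsilon>) F" and v: "dpp_solution \<Omega> F \<epsilon> v"
    and y: "y \<in> outer_strip \<Omega> \<epsilon>" and x: "x \<in> \<Omega>"
  shows lower_barrier: "F y - L * dist x y - L * \<epsilon> \<le> v x"
    and upper_barrier: "v x \<le> F y + L * dist x y + L * \<epsilon>"
proof -
  have y\<Omega>: "y \<notin> \<Omega>" using y by (simp add: outer_strip_def)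
  have xy: "x \<noteq> y" using x y\<Omega> by auto
  obtain Cv where Cv: "\<And>x. \<bar>v x\<bar> \<le> Cv" using v unfolding dpp_solution_def by auto
  obtain B where B: "\<And>x. x \<in> \<Omega> \<Longrightarrow> norm x \<le> B" using \<Omega>(2) by (auto simp: bounded_iff)
  define C where "C = max Cv (\<bar>F y\<bar> + L * (B + \<epsilon> + norm y) + L * \<epsilon>)"
  define q where "q c = (\<lambda>z. if z = y then c else c - L * dist z y - L * \<epsilon>)" for c
  have vC: "\<bar>v x\<bar> \<le> C" for x using Cv[of x] unfolding C_def by simp
  have qC: "\<bar>q c z\<bar> \<le> C" if x: "x \<in> \<Omega>" and z: "z \<in> ball x \<epsilon>" and c: "\<bar>c\<bar> = \<bar>F y\<bar>" for x z c
  proof -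
    have "norm z \<le> B + \<epsilon>" using B[OF x] z norm_triangle_sub[of z x] by (simp add: dist_norm norm_minus_commute)
    then have "dist z y \<le> B + \<epsilon> + norm y" using norm_triangle_ineq4[of z y] by (simp add: dist_norm)
    then have "L * dist z y \<le> L * (B + \<epsilon> + norm y)" using L by (intro mult_left_mono) auto
    moreover have "0 \<le> L * dist z y" "0 \<le> L * \<epsilon>" using L e by auto
    ultimately have "\<bar>q c z\<bar> \<le> \<bar>F y\<bar> + L * (B + \<epsilon> + norm y) + L * \<epsilon>" using c unfolding q_def by auto
    then show ?thesis unfolding C_def by simp
  qed
  have cone: "q c x + L * \<epsilon> \<le> bsup \<epsilon> (q c) x" "q c x - L * \<epsilon> \<le> binf \<epsilon> (q c) x" if "x \<in> \<Omega>" for x c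
    using jump_cone[of \<epsilon> L x y c, OF e] L that y\<Omega> unfolding q_def by auto
  have Le: "\<epsilon> \<le> L * \<epsilon>" using L e by simp
  have strip: "\<bar>F z - F y\<bar> \<le> L * dist z y" "v z = F z" if "x \<in> \<Omega>" "z \<in> ball x \<epsilon>" "z \<notin> \<Omega>" for x z
    using lipschitz_onD[OF F in_outer_strip[OF that] y] v in_outer_strip[OF that]
    unfolding dpp_solution_def by (auto simp: dist_real_def)
  have "q (F y) x \<le> v x"
  proof (rule dpp_comparison[OF e \<Omega>(2), where C=C])
    show "q (F y) z \<le> dpp \<epsilon> (q (F y)) z" if z: "z \<in> \<Omega>" for z
    proof -
      have "q (F y) z \<le> (bsup \<epsilon> (q (F y)) z + binf \<epsilon> (q (F y)) z) / 2"
        using cone[OF z, of "F y"] by argo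
      moreover have "q (F y) z \<le> bsup \<epsilon> (q (F y)) z - \<epsilon>"
        using cone(1)[OF z, of "F y"] Le by linarith
      ultimately show ?thesis unfolding dpp_def by simp
    qed
    show "dpp \<epsilon> v z \<le> v z" if z: "z \<in> \<Omega>" for z
      using v z unfolding dpp_solution_def by simp
    show "q (F y) z \<le> v z" if "x \<in> \<Omega>" "z \<in> ball x \<epsilon>" "z \<notin> \<Omega>" for x z
    proof (cases "z = y")
      case True
      then show ?thesis using strip(2)[OF that] by (simp add: q_def)
    next
      case False
      then have "q (F y) z = F y - L * dist z y - L * \<epsilon>" "q (- F y) z = - F y - L * dist z y - L * \<epsilon>"
        by (simp_all add: q_def)
      then show ?thesis using strip[OF that] Le e by linarith
    qed
  qed (use qC vC x in auto)
  then show "F y - L * dist x y - L * \<epsilon> \<le> v x" using xy by (simp add: q_def)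
  have "v x \<le> - q (- F y) x"
  proof (rule dpp_comparison[OF e \<Omega>(2), where C=C])
    show "dpp \<epsilon> (\<lambda>z. - q (- F y) z) z \<le> - q (- F y) z" if z: "z \<in> \<Omega>" for z
    proof -
      have "bsup \<epsilon> (\<lambda>z. - q (- F y) z) z = - binf \<epsilon> (q (- F y)) z"
        "binf \<epsilon> (\<lambda>z. - q (- F y) z) z = - bsup \<epsilon> (q (- F y)) z"
        using bsup_uminus[of \<epsilon> "q (- F y)"] bsup_uminus[of \<epsilon> "\<lambda>z. - q (- F y) z"] by auto
      then have "(bsup \<epsilon> (\<lambda>z. - q (- F y) z) z + binf \<epsilon> (\<lambda>z. - q (- F y) z) z) / 2 \<le> - q (- F y) z"
        using cone[OF z, of "- F y"] by argo
      then show ?thesis unfolding dpp_def by (rule min.coboundedI1)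
    qed
    show "v z \<le> dpp \<epsilon> v z" if z: "z \<in> \<Omega>" for z
      using v z unfolding dpp_solution_def by simp
    show "v z \<le> - q (- F y) z" if "x \<in> \<Omega>" "z \<in> ball x \<epsilon>" "z \<notin> \<Omega>" for x z
    proof (cases "z = y")
      case True
      then show ?thesis using strip(2)[OF that] by (simp add: q_def)
    next
      case False
      then have "q (F y) z = F y - L * dist z y - L * \<epsilon>" "q (- F y) z = - F y - L * dist z y - L * \<epsilon>"
        by (simp_all add: q_def)
      then show ?thesis using strip[OF that] Le e by linarith
    qed
  qed (use qC vC x in auto)
  then show "v x \<le> F y + L * dist x y + L * \<epsilon>" using xy by (simp add: q_def)
qed

lemma dpp_translate: "dpp \<epsilon> (\<lambda>y. f (y + h)) x = dpp \<epsilon> f (x + h)"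
proof -
  have "(\<lambda>y. y + h) ` ball x \<epsilon> = ball (x + h) \<epsilon>"
    using ball_translation[of h x \<epsilon>] by (simp add: add.commute)
  then have "(\<lambda>y. f (y + h)) ` ball x \<epsilon> = f ` ball (x + h) \<epsilon>"
    using image_image[of f "\<lambda>y. y + h" "ball x \<epsilon>"] by (simp only:)
  then show ?thesis unfolding dpp_def bsup_def binf_def by (simp only:)
qed

text \<open>A translate of \<open>v\<close> lowered by a nonnegative constant is again a
  subsolution. It is compared with \<open>v\<close> on the set where \<open>z\<close> and
  \<open>z + h\<close> both lie in the domain. One step outside this set, at least one of the two
  points is in the strip, where the barriers or the Lipschitz bound of \<open>F\<close>
  apply.\<close>

lemma dpp_solution_almost_lipschitz:
  fixes \<Omega> :: "'a::euclidean_space set"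
  assumes \<Omega>: "open \<Omega>" "bounded \<Omega>" and e: "0 < \<epsilon>" and L: "1 \<le> L"
    and F: "L-lipschitz_on (outer_strip \<Omega> \<epsilon>) F" and v: "dpp_solution \<Omega> F \<epsilon> v"
    and x: "x \<in> \<Omega> \<union> outer_strip \<Omega> \<epsilon>" and y: "y \<in> \<Omega> \<union> outer_strip \<Omega> \<epsilon>"
  shows "v y \<le> v x + L * dist x y + L * \<epsilon>"
proof -
  have Le: "0 \<le> L * \<epsilon>" using L e by simp
  have vF: "v z = F z" if "z \<in> outer_strip \<Omega> \<epsilon>" for z using v that unfolding dpp_solution_def by simp
  have edge: "v y \<le> v x + L * dist x y + L * \<epsilon>"
    if "x \<in> \<Omega> \<union> outer_strip \<Omega> \<epsilon>" "y \<in> \<Omega> \<union> outer_strip \<Omega> \<epsilon>" "x \<notin> \<Omega> \<or> y \<notin> \<Omega>" for x y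
  proof (cases "x \<in> \<Omega>")
    case True
    then have y: "y \<in> outer_strip \<Omega> \<epsilon>" using that by auto
    show ?thesis using lower_barrier[OF \<Omega> e L F v y True] vF[OF y] by simp
  next
    case False
    then have x: "x \<in> outer_strip \<Omega> \<epsilon>" using that by auto
    show ?thesis
    proof (cases "y \<in> \<Omega>")
      case True
      show ?thesis using upper_barrier[OF \<Omega> e L F v x True] vF[OF x] by (simp add: dist_commute)
    next
      case False
      then have y: "y \<in> outer_strip \<Omega> \<epsilon>" using that by auto
      show ?thesis using lipschitz_onD[OF F x y] vF[OF x] vF[OF y] Le by (simp add: dist_real_def)
    qed
  qed
  show ?thesis
  proof (cases "x \<in> \<Omega> \<and> y \<in> \<Omega>")
    case False
    then show ?thesis using edge[OF x y] by blast
  next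
    case True
    define h where "h = y - x"
    define c where "c = L * norm h + L * \<epsilon>"
    have c0: "0 \<le> c" using L Le unfolding c_def by simp
    obtain C where C: "\<And>x. \<bar>v x\<bar> \<le> C" using v unfolding dpp_solution_def by auto
    define D where "D = {z\<in>\<Omega>. z + h \<in> \<Omega>}"
    have "v (x + h) - c \<le> v x"
    proof (rule dpp_comparison[OF e, where C="C + c" and D=D and u="\<lambda>z. v (z + h) - c"])
      show "bounded D" using \<Omega>(2) by (rule bounded_subset) (auto simp: D_def)
      show "\<bar>v (z + h) - c\<bar> \<le> C + c" "\<bar>v z\<bar> \<le> C + c" for z
        using C[of "z + h"] C[of z] c0 by auto
      show "v (z + h) - c \<le> dpp \<epsilon> (\<lambda>z. v (z + h) - c) z" if "z \<in> D" for z
      proof -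
        have "v (z + h) = dpp \<epsilon> (\<lambda>z. v (z + h)) z"
          using that v unfolding D_def dpp_solution_def dpp_translate by auto
        also have "\<dots> \<le> dpp \<epsilon> (\<lambda>z. v (z + h) - c) z + c"
          by (rule dpp_mono[OF e c0, where C=C and C'="C + c"]) (use C c0 in \<open>auto intro: order_trans[OF abs_triangle_ineq4]\<close>)
        finally show ?thesis by simp
      qed
      show "dpp \<epsilon> v z \<le> v z" if "z \<in> D" for z
        using that v unfolding D_def dpp_solution_def by auto
      show "v (q + h) - c \<le> v q" if p: "p \<in> D" and q: "q \<in> ball p \<epsilon>" "q \<notin> D" for p q
      proof -
        have qh: "q + h \<in> ball (p + h) \<epsilon>" using q by (simp add: dist_norm)
        have "q \<in> \<Omega> \<union> outer_strip \<Omega> \<epsilon>" "q + h \<in> \<Omega> \<union> outer_strip \<Omega> \<epsilon>"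
          using in_outer_strip[of p \<Omega> q] in_outer_strip[of "p + h" \<Omega> "q + h"] p q qh unfolding D_def by auto
        from edge[OF this] show ?thesis using q(2) unfolding c_def D_def by (auto simp: dist_norm)
      qed
      show "x \<in> D" using True unfolding D_def h_def by simp
    qed
    then show ?thesis unfolding c_def h_def by (simp add: dist_norm norm_minus_commute)
  qed
qed

subsection \<open>Second-order calculus and consistency\<close>

lemma grad_inner_Basis: "i \<in> Basis \<Longrightarrow> grad f x \<bullet> i = pd i f x"
  unfolding grad_def by (simp add: inner_sum_left inner_Basis if_distrib cong: if_cong)

lemma frechet_derivative_grad:
  assumes "f differentiable (at x)"
  shows "frechet_derivative f (at x) h = grad f x \<bullet> h"
proof -
  have lin: "linear (frechet_derivative f (at x))" by (rule linear_frechet_derivative[OF assms])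
  have "frechet_derivative f (at x) h = frechet_derivative f (at x) (\<Sum>i\<in>Basis. (h \<bullet> i) *\<^sub>R i)"
    by (simp add: euclidean_representation)
  also have "\<dots> = (\<Sum>i\<in>Basis. (h \<bullet> i) * pd i f x)"
    unfolding pd_def by (simp add: linear_sum[OF lin] linear_cmul[OF lin])
  also have "\<dots> = (\<Sum>i\<in>Basis. (h \<bullet> i) * (grad f x \<bullet> i))"
    by (intro sum.cong) (auto simp: grad_inner_Basis)
  also have "\<dots> = grad f x \<bullet> h"
    by (subst euclidean_inner[of "grad f x" h]) (simp add: mult.commute)
  finally show ?thesis .
qed

lemma has_derivative_grad:
  assumes "f differentiable (at x)"
  shows "(f has_derivative (\<lambda>h. grad f x \<bullet> h)) (at x)"
  using assms unfolding frechet_derivative_works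
  by (simp add: frechet_derivative_grad[OF assms, abs_def])

definition hess :: "('a::euclidean_space \<Rightarrow> real) \<Rightarrow> 'a \<Rightarrow> 'a \<Rightarrow> real" where
  "hess f x h = (\<Sum>i\<in>Basis. \<Sum>j\<in>Basis. (h \<bullet> i) * pd i (pd j f) x * (h \<bullet> j))"

lemma inf_laplacian_hess: "inf_laplacian f x = hess f x (grad f x)"
  unfolding inf_laplacian_def hess_def by (intro sum.cong) (auto simp: grad_inner_Basis)

lemma hess_scaleR: "hess f x (c *\<^sub>R h) = c\<^sup>2 * hess f x h"
  unfolding hess_def by (simp add: sum_distrib_left power2_eq_square algebra_simps)

lemma continuous_hess: "isCont (hess f x) h"
  unfolding hess_def[abs_def] by (intro continuous_intros)

lemma Ck_on_2:
  "Ck_on 2 f S \<longleftrightarrow> (\<forall>x\<in>S. f differentiable (at x)) \<and>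
    (\<forall>i\<in>Basis. (\<forall>x\<in>S. pd i f differentiable (at x)) \<and> (\<forall>j\<in>Basis. continuous_on S (pd j (pd i f))))"
  by (simp add: numeral_2_eq_2)

lemma
  assumes S: "open S" "x0 \<in> S" and f: "Ck_on 2 f S" and \<eta>: "0 < \<eta>"
  shows grad_modulus: "\<exists>\<delta>>0. \<forall>y\<in>ball x0 \<delta>. norm (grad f y - grad f x0) \<le> \<eta>"
    and hess_modulus: "\<exists>\<delta>>0. \<forall>y\<in>ball x0 \<delta>. \<forall>h. \<bar>hess f y h - hess f x0 h\<bar> \<le> \<eta> * (norm h)\<^sup>2"
proof -
  have "isCont (pd i f) x0" if "i \<in> Basis" for i
    using f S that unfolding Ck_on_2 by (auto intro: differentiable_imp_continuous_within)
  then have "isCont (grad f) x0"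
    unfolding grad_def[abs_def] by (intro continuous_intros) auto
  then obtain \<delta> where "\<delta> > 0" "\<And>y. dist y x0 < \<delta> \<Longrightarrow> dist (grad f y) (grad f x0) < \<eta>"
    using \<eta> unfolding continuous_at_eps_delta by blast
  then show "\<exists>\<delta>>0. \<forall>y\<in>ball x0 \<delta>. norm (grad f y - grad f x0) \<le> \<eta>"
    by (intro exI[of _ \<delta>]) (auto simp: dist_norm norm_minus_commute less_imp_le)
  define A where "A y = (\<Sum>i\<in>Basis. \<Sum>j\<in>Basis. \<bar>pd i (pd j f) y - pd i (pd j f) x0\<bar>)" for y
  have "isCont (pd i (pd j f)) x0" if "i \<in> Basis" "j \<in> Basis" for i j
    using f S that unfolding Ck_on_2 by (auto simp: continuous_on_eq_continuous_at)
  then have "isCont A x0"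
    unfolding A_def[abs_def] by (intro continuous_intros) auto
  then obtain \<delta> where \<delta>: "\<delta> > 0" "\<And>y. dist y x0 < \<delta> \<Longrightarrow> dist (A y) (A x0) < \<eta>"
    using \<eta> unfolding continuous_at_eps_delta by blast
  have "A x0 = 0" unfolding A_def by simp
  have A: "A y < \<eta>" if "y \<in> ball x0 \<delta>" for y
    using \<delta>(2)[of y] that \<open>A x0 = 0\<close> by (auto simp: dist_real_def dist_commute)
  have "\<bar>hess f y h - hess f x0 h\<bar> \<le> \<eta> * (norm h)\<^sup>2" if y: "y \<in> ball x0 \<delta>" for y h
  proof -
    have eq: "hess f y h - hess f x0 h
        = (\<Sum>i\<in>Basis. \<Sum>j\<in>Basis. (h \<bullet> i) * (pd i (pd j f) y - pd i (pd j f) x0) * (h \<bullet> j))"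
      unfolding hess_def by (simp add: sum_subtractf[symmetric] algebra_simps)
    have "\<bar>hess f y h - hess f x0 h\<bar> \<le> (\<Sum>i\<in>Basis. \<Sum>j\<in>Basis. \<bar>(h \<bullet> i) * (pd i (pd j f) y - pd i (pd j f) x0) * (h \<bullet> j)\<bar>)"
      unfolding eq
      by (rule order_trans[OF sum_abs], rule sum_mono, rule sum_abs)
    also have "\<dots> \<le> (\<Sum>i\<in>Basis. \<Sum>j\<in>Basis. (norm h)\<^sup>2 * \<bar>pd i (pd j f) y - pd i (pd j f) x0\<bar>)"
    proof (intro sum_mono)
      fix i j :: 'a assume "i \<in> Basis" "j \<in> Basis"
      then have "\<bar>h \<bullet> i\<bar> * \<bar>h \<bullet> j\<bar> \<le> norm h * norm h" by (rule mult_mono[OF Basis_le_norm Basis_le_norm norm_ge_zero abs_ge_zero])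
      then have "(\<bar>h \<bullet> i\<bar> * \<bar>h \<bullet> j\<bar>) * \<bar>pd i (pd j f) y - pd i (pd j f) x0\<bar> \<le> (norm h * norm h) * \<bar>pd i (pd j f) y - pd i (pd j f) x0\<bar>"
        by (rule mult_right_mono[OF _ abs_ge_zero])
      moreover have "\<bar>a * b * c\<bar> = (\<bar>a\<bar> * \<bar>c\<bar>) * \<bar>b\<bar>" for a b c :: real by (simp add: abs_mult)
      ultimately show "\<bar>(h \<bullet> i) * (pd i (pd j f) y - pd i (pd j f) x0) * (h \<bullet> j)\<bar> \<le> (norm h)\<^sup>2 * \<bar>pd i (pd j f) y - pd i (pd j f) x0\<bar>"
        by (simp only: power2_eq_square)
    qed
    also have "\<dots> = (norm h)\<^sup>2 * A y" unfolding A_def by (simp add: sum_distrib_left)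
    also have "\<dots> \<le> (norm h)\<^sup>2 * \<eta>" using A[OF y] by (intro mult_left_mono) auto
    finally show ?thesis by (simp only: mult.commute)
  qed
  then show "\<exists>\<delta>>0. \<forall>y\<in>ball x0 \<delta>. \<forall>h. \<bar>hess f y h - hess f x0 h\<bar> \<le> \<eta> * (norm h)\<^sup>2"
    using \<delta>(1) by blast
qed

lemma DERIV_along_line:
  assumes "f differentiable (at (x + t *\<^sub>R h))"
  shows "((\<lambda>t. f (x + t *\<^sub>R h)) has_real_derivative grad f (x + t *\<^sub>R h) \<bullet> h) (at t)"
proof -
  have "((\<lambda>t. x + t *\<^sub>R h) has_derivative (\<lambda>s. s *\<^sub>R h)) (at t)"
    by (auto intro!: derivative_eq_intros)
  from has_derivative_compose[OF this has_derivative_grad[OF assms]]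
  show ?thesis unfolding has_field_derivative_def by (simp add: mult_commute_abs)
qed

lemma DERIV_grad_along_line:
  assumes f: "\<And>i. i \<in> Basis \<Longrightarrow> pd i f differentiable (at (x + t *\<^sub>R h))"
  shows "((\<lambda>t. grad f (x + t *\<^sub>R h) \<bullet> h) has_real_derivative hess f (x + t *\<^sub>R h) h) (at t)"
proof -
  have eq: "grad g y \<bullet> h = (\<Sum>j\<in>Basis. pd j g y * (h \<bullet> j))" for g y
    unfolding grad_def by (simp add: inner_sum_left) (simp add: inner_commute)
  have "((\<lambda>t. \<Sum>j\<in>Basis. pd j f (x + t *\<^sub>R h) * (h \<bullet> j)) has_real_derivative
      (\<Sum>j\<in>Basis. (grad (pd j f) (x + t *\<^sub>R h) \<bullet> h) * (h \<bullet> j))) (at t)"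
    by (intro DERIV_sum DERIV_cmult_right DERIV_along_line f)
  moreover have "(\<Sum>j\<in>Basis. (grad (pd j f) (x + t *\<^sub>R h) \<bullet> h) * (h \<bullet> j)) = hess f (x + t *\<^sub>R h) h"
    unfolding hess_def eq by (subst sum.swap) (simp add: sum_distrib_right sum_distrib_left mult_ac)
  ultimately show ?thesis unfolding eq[of f] by simp
qed

lemma grad_mean_value:
  assumes "\<And>y. y \<in> closed_segment x (x + h) \<Longrightarrow> f differentiable (at y)"
  shows "\<exists>y\<in>closed_segment x (x + h). f (x + h) - f x = grad f y \<bullet> h"
proof -
  have seg: "x + t *\<^sub>R h \<in> closed_segment x (x + h)" if "0 \<le> t" "t \<le> 1" for t
    unfolding in_segment using that by (intro exI[of _ t]) (auto simp: algebra_simps)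
  have "\<exists>t. 0 < t \<and> t < 1 \<and> f (x + 1 *\<^sub>R h) - f (x + 0 *\<^sub>R h) = (1 - 0) * (grad f (x + t *\<^sub>R h) \<bullet> h)"
    by (rule MVT2[where f="\<lambda>t. f (x + t *\<^sub>R h)"]) (auto intro!: DERIV_along_line assms seg)
  then obtain t where "0 < t" "t < 1" "f (x + h) - f x = grad f (x + t *\<^sub>R h) \<bullet> h" by auto
  then show ?thesis using seg[of t] by (intro bexI[of _ "x + t *\<^sub>R h"]) auto
qed

text \<open>The even function \<open>f (x + t *\<^sub>R h) + f (x - t *\<^sub>R h)\<close> of
  \<open>t\<close> has derivative 0 at 0, so Taylor's formula with Lagrange remainder leaves only
  Hessian terms.\<close>

lemma second_difference:
  assumes S: "ball x r \<subseteq> S" and f: "Ck_on 2 f S" and h: "norm h < r"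
  shows "\<exists>y\<in>ball x r. \<exists>z\<in>ball x r. f (x + h) + f (x - h) - 2 * f x = (hess f y h + hess f z h) / 2"
proof -
  have B: "x + t *\<^sub>R h \<in> ball x r" if "\<bar>t\<bar> \<le> 1" for t
  proof -
    have "\<bar>t\<bar> * norm h \<le> 1 * norm h" using that by (intro mult_right_mono) auto
    then show ?thesis using h by (simp add: dist_norm)
  qed
  have d: "f differentiable (at (x + t *\<^sub>R h))" "\<And>i. i \<in> Basis \<Longrightarrow> pd i f differentiable (at (x + t *\<^sub>R h))"
    if "\<bar>t\<bar> \<le> 1" for t
    using f B[OF that] S unfolding Ck_on_2 by auto
  define G where "G t = f (x + t *\<^sub>R h) + f (x + (- t) *\<^sub>R h)" for t
  define G1 where "G1 t = grad f (x + t *\<^sub>R h) \<bullet> h - grad f (x + (- t) *\<^sub>R h) \<bullet> h" for t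
  define G2 where "G2 t = hess f (x + t *\<^sub>R h) h + hess f (x + (- t) *\<^sub>R h) h" for t
  have G: "(G has_real_derivative G1 t) (at t)" if "\<bar>t\<bar> \<le> 1" for t
  proof -
    have "((\<lambda>t. f (x + (- t) *\<^sub>R h)) has_real_derivative (grad f (x + (- t) *\<^sub>R h) \<bullet> h) * (- 1)) (at t)"
    proof (rule DERIV_chain2[where f="\<lambda>t. f (x + t *\<^sub>R h)"])
      show "((\<lambda>t. f (x + t *\<^sub>R h)) has_real_derivative grad f (x + (- t) *\<^sub>R h) \<bullet> h) (at (- t))"
        by (rule DERIV_along_line[OF d(1)]) (use that in simp)
    qed (auto intro!: derivative_eq_intros)
    from DERIV_add[OF DERIV_along_line[OF d(1)[OF that]] this] show ?thesis
      unfolding G_def[abs_def] G1_def by simp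
  qed
  have G1': "(G1 has_real_derivative G2 t) (at t)" if "\<bar>t\<bar> \<le> 1" for t
  proof -
    have "((\<lambda>t. grad f (x + (- t) *\<^sub>R h) \<bullet> h) has_real_derivative hess f (x + (- t) *\<^sub>R h) h * (- 1)) (at t)"
    proof (rule DERIV_chain2[where f="\<lambda>t. grad f (x + t *\<^sub>R h) \<bullet> h"])
      show "((\<lambda>t. grad f (x + t *\<^sub>R h) \<bullet> h) has_real_derivative hess f (x + (- t) *\<^sub>R h) h) (at (- t))"
        by (rule DERIV_grad_along_line[OF d(2)]) (use that in simp_all)
    qed (auto intro!: derivative_eq_intros)
    from DERIV_diff[OF DERIV_grad_along_line[OF d(2)[OF that]] this] show ?thesis
      unfolding G1_def[abs_def] G2_def by simp
  qed
  define df where "df m = (if m = 0 then G else if m = 1 then G1 else G2)" for m :: nat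
  have "\<exists>t>0. t < 1 \<and> G 1 = (\<Sum>m<2. df m 0 / fact m * 1 ^ m) + df 2 t / fact 2 * 1 ^ 2"
    by (rule Maclaurin) (use G G1' in \<open>auto simp: df_def less_Suc_eq numeral_2_eq_2\<close>)
  then obtain t where t: "0 < t" "t < 1" "G 1 = G 0 + G1 0 + G2 t / 2"
    by (auto simp: numeral_2_eq_2 df_def)
  have "f (x + h) + f (x - h) - 2 * f x = G2 t / 2" using t(3) unfolding G_def G1_def by simp
  then show ?thesis unfolding G2_def using B[of t] B[of "- t"] t by force
qed

section \<open>Consistency of paying and of tug-of-war with smooth test functions\<close>

lemma pay_consistency_lower:
  assumes S: "open S" "x0 \<in> S" and f: "Ck_on 2 f S"
    and H: "\<And>\<delta>. 0 < \<delta> \<Longrightarrow> \<exists>x \<epsilon>. 0 < \<epsilon> \<and> \<epsilon> < \<delta> \<and> dist x0 x < \<delta> \<and> f x \<le> bsup \<epsilon> f x - \<epsilon> + \<epsilon> ^ 3"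
  shows "1 \<le> norm (grad f x0)"
proof (rule ccontr)
  assume neg: "\<not> ?thesis"
  \<comment> \<open>\<open>c\<close> lies strictly between the norm of the gradient and 1. Near
    \<open>x0\<close> a step gains at most \<open>c * \<epsilon>\<close>, and the deficit
    \<open>(1 - c) * \<epsilon>\<close> is larger than \<open>\<epsilon> ^ 3\<close> for small
    \<open>\<epsilon>\<close>.\<close>
  define c where "c = (1 + norm (grad f x0)) / 2"
  have c: "norm (grad f x0) < c" "c < 1" "0 < c" using neg
    unfolding c_def by (auto simp: add_pos_nonneg)
  obtain r where r: "0 < r" "ball x0 r \<subseteq> S" using S open_contains_ball by blast
  obtain d where d: "0 < d" "\<And>y. y \<in> ball x0 d \<Longrightarrow> norm (grad f y - grad f x0) \<le> c - norm (grad f x0)"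
    using grad_modulus[OF S f, of "c - norm (grad f x0)"] c by auto
  define \<delta> where "\<delta> = Min {r / 2, d / 2, 1 - c, 1}"
  have "0 < \<delta>" unfolding \<delta>_def using r d c by auto
  then obtain x \<epsilon> where x: "0 < \<epsilon>" "\<epsilon> < \<delta>" "dist x0 x < \<delta>" "f x \<le> bsup \<epsilon> f x - \<epsilon> + \<epsilon> ^ 3"
    using H by blast
  have \<delta>: "\<delta> \<le> r / 2" "\<delta> \<le> d / 2" "\<delta> \<le> 1 - c" "\<delta> \<le> 1"
    unfolding \<delta>_def by (rule Min_le; simp)+
  have sub: "y \<in> S" "y \<in> ball x0 d" if "y \<in> ball x \<epsilon>" for y
    using x \<delta> that dist_triangle[of x0 y x] r(2) by auto
  have "bsup \<epsilon> f x \<le> f x + c * \<epsilon>"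
  proof (rule bsup_least[OF x(1)])
    fix y assume y: "y \<in> ball x \<epsilon>"
    have seg: "closed_segment x y \<subseteq> ball x \<epsilon>"
      using y x(1) by (intro closed_segment_subset) auto
    then have "\<exists>z\<in>closed_segment x (x + (y - x)). f (x + (y - x)) - f x = grad f z \<bullet> (y - x)"
      using sub(1) f unfolding Ck_on_2 by (intro grad_mean_value) auto
    then obtain z where z: "z \<in> closed_segment x y" "f y - f x = grad f z \<bullet> (y - x)" by auto
    have "norm (grad f z) \<le> c"
      using d(2)[OF sub(2)[of z]] z(1) seg norm_triangle_sub[of "grad f z" "grad f x0"] by auto
    then have "norm (grad f z) * norm (y - x) \<le> c * \<epsilon>"
      using y c by (intro mult_mono) (auto simp: dist_norm norm_minus_commute)
    then show "f y \<le> f x + c * \<epsilon>" using z(2) norm_cauchy_schwarz[of "grad f z" "y - x"] by linarith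
  qed
  then have "(1 - c) * \<epsilon> \<le> \<epsilon> ^ 3" using x(4) by (simp add: algebra_simps)
  also have "\<dots> \<le> \<epsilon> ^ 2" using x \<delta> by (intro power_decreasing) auto
  also have "\<dots> = \<epsilon> * \<epsilon>" by (simp add: power2_eq_square)
  finally have "1 - c \<le> \<epsilon>" using x(1) by simp
  then show False using x \<delta> by simp
qed

text \<open>In the applications \<open>p\<close> is the gradient at the limit point, not at the
  moving centre \<open>x\<close>; \<open>\<eta>\<close> absorbs the variation over the ball. Steps
  along \<open>p\<close> give the first bound, as a limit of step lengths because the ball is
  open.\<close>

lemma bsup_gradient_lower:
  assumes e: "0 < \<epsilon>" and f: "\<And>y. y \<in> ball x \<epsilon> \<Longrightarrow> f differentiable (at y)"
    and p: "p \<noteq> 0" and \<eta>: "\<And>y. y \<in> ball x \<epsilon> \<Longrightarrow> norm (grad f y - p) \<le> \<eta>"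
  shows "f x + \<epsilon> * (norm p - \<eta>) \<le> bsup \<epsilon> f x"
    and "y \<in> ball x \<epsilon> \<Longrightarrow> f y \<le> f x + p \<bullet> (y - x) + \<eta> * \<epsilon>"
    and "\<exists>C. \<forall>y\<in>ball x \<epsilon>. \<bar>f y\<bar> \<le> C"
proof -
  have \<eta>0: "0 \<le> \<eta>" using \<eta>[of x] e norm_ge_zero order_trans by (metis centre_in_ball)
  have mv: "\<bar>f y - f x - p \<bullet> (y - x)\<bar> \<le> \<eta> * norm (y - x)" if y: "y \<in> ball x \<epsilon>" for y
  proof -
    have seg: "closed_segment x y \<subseteq> ball x \<epsilon>"
      using y e by (intro closed_segment_subset) auto
    then have "\<exists>z\<in>closed_segment x (x + (y - x)). f (x + (y - x)) - f x = grad f z \<bullet> (y - x)"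
      using f by (intro grad_mean_value) auto
    then obtain z where z: "z \<in> closed_segment x y" "f y - f x = grad f z \<bullet> (y - x)" by auto
    have "\<bar>(grad f z - p) \<bullet> (y - x)\<bar> \<le> norm (grad f z - p) * norm (y - x)" by (rule Cauchy_Schwarz_ineq2)
    also have "\<dots> \<le> \<eta> * norm (y - x)" using \<eta> z(1) seg by (intro mult_right_mono) auto
    finally show ?thesis using z(2) by (simp add: inner_diff_left)
  qed
  have le\<eta>: "\<eta> * norm (y - x) \<le> \<eta> * \<epsilon>" if "y \<in> ball x \<epsilon>" for y
    using that \<eta>0 by (intro mult_left_mono) (auto simp: dist_norm norm_minus_commute)
  show 2: "f y \<le> f x + p \<bullet> (y - x) + \<eta> * \<epsilon>" if "y \<in> ball x \<epsilon>" for y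
    using mv[OF that] le\<eta>[OF that] by linarith
  have bnd: "\<bar>f y\<bar> \<le> \<bar>f x\<bar> + norm p * \<epsilon> + \<eta> * \<epsilon>" if y: "y \<in> ball x \<epsilon>" for y
  proof -
    have "\<bar>p \<bullet> (y - x)\<bar> \<le> norm p * norm (y - x)" by (rule Cauchy_Schwarz_ineq2)
    also have "\<dots> \<le> norm p * \<epsilon>" using y by (intro mult_left_mono) (auto simp: dist_norm norm_minus_commute)
    finally show ?thesis using mv[OF y] le\<eta>[OF y] by linarith
  qed
  then show "\<exists>C. \<forall>y\<in>ball x \<epsilon>. \<bar>f y\<bar> \<le> C" by blast
  have s: "f x + s * (norm p - \<eta>) \<le> bsup \<epsilon> f x" if "0 < s" "s < \<epsilon>" for s
  proof -
    define y where "y = x + (s / norm p) *\<^sub>R p"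
    have yx: "norm (y - x) = s" "p \<bullet> (y - x) = s * norm p"
      using p that by (auto simp: y_def power2_norm_eq_inner[symmetric] power2_eq_square)
    then have "y \<in> ball x \<epsilon>" using that by (simp add: dist_norm norm_minus_commute)
    then show ?thesis using mv[of y] bsup_upper[of x \<epsilon> f, OF bnd, of y] yx by (simp add: algebra_simps)
  qed
  have "((\<lambda>s. f x + s * (norm p - \<eta>)) \<longlongrightarrow> f x + \<epsilon> * (norm p - \<eta>)) (at_left \<epsilon>)"
    by (intro tendsto_intros)
  then show "f x + \<epsilon> * (norm p - \<eta>) \<le> bsup \<epsilon> f x"
    by (rule tendsto_upperbound) (use s e in \<open>auto simp: eventually_at_left intro: exI[of _ 0]\<close>)
qed

lemma pay_consistency_upper:
  assumes S: "open S" "x0 \<in> S" and f: "Ck_on 2 f S"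
    and H: "\<And>\<delta>. 0 < \<delta> \<Longrightarrow> \<exists>x \<epsilon>. 0 < \<epsilon> \<and> \<epsilon> < \<delta> \<and> dist x0 x < \<delta> \<and> bsup \<epsilon> f x - \<epsilon> - \<epsilon> ^ 3 \<le> f x"
  shows "norm (grad f x0) \<le> 1"
proof (rule ccontr)
  assume neg: "\<not> ?thesis"
  define \<eta> where "\<eta> = (norm (grad f x0) - 1) / 2"
  have \<eta>: "0 < \<eta>" "norm (grad f x0) - \<eta> = 1 + \<eta>" using neg unfolding \<eta>_def by (auto simp: field_simps)
  have p: "grad f x0 \<noteq> 0" using neg by auto
  obtain r where r: "0 < r" "ball x0 r \<subseteq> S" using S open_contains_ball by blast
  obtain d where d: "0 < d" "\<And>y. y \<in> ball x0 d \<Longrightarrow> norm (grad f y - grad f x0) \<le> \<eta>"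
    using grad_modulus[OF S f \<eta>(1)] by auto
  define \<delta> where "\<delta> = Min {r / 2, d / 2, \<eta>, 1}"
  have "0 < \<delta>" unfolding \<delta>_def using r d \<eta> by auto
  then obtain x \<epsilon> where x: "0 < \<epsilon>" "\<epsilon> < \<delta>" "dist x0 x < \<delta>" "bsup \<epsilon> f x - \<epsilon> - \<epsilon> ^ 3 \<le> f x"
    using H by blast
  have \<delta>: "\<delta> \<le> r / 2" "\<delta> \<le> d / 2" "\<delta> \<le> \<eta>" "\<delta> \<le> 1"
    unfolding \<delta>_def by (rule Min_le; simp)+
  have sub: "y \<in> S" "y \<in> ball x0 d" if "y \<in> ball x \<epsilon>" for y
    using x \<delta> that dist_triangle[of x0 y x] r(2) by auto
  have "f x + \<epsilon> * (norm (grad f x0) - \<eta>) \<le> bsup \<epsilon> f x"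
    by (rule bsup_gradient_lower(1)[OF x(1) _ p]) (use sub d(2) f in \<open>auto simp: Ck_on_2\<close>)
  then have "\<epsilon> * \<eta> \<le> \<epsilon> ^ 3" using x(4) unfolding \<eta>(2) by (simp add: algebra_simps)
  also have "\<dots> \<le> \<epsilon> ^ 2" using x \<delta> by (intro power_decreasing) auto
  also have "\<dots> = \<epsilon> * \<epsilon>" by (simp add: power2_eq_square)
  finally have "\<eta> \<le> \<epsilon>" using x(1) by simp
  then show False using x \<delta> by simp
qed

text \<open>If the infinity Laplacian were negative, an almost maximal point \<open>x + h\<close> of
  the ball would lie nearly in the gradient direction, where the second difference is at most a
  negative multiple of \<open>\<epsilon>\<^sup>2\<close>. The reflected point \<open>x - h\<close>
  bounds the infimum, so the hypothesis keeps the same second difference above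
  \<open>- 3 * \<epsilon> ^ 3\<close>.\<close>

lemma tug_consistency:
  assumes S: "open S" "x0 \<in> S" and f: "Ck_on 2 f S"
    and H: "\<And>\<delta>. 0 < \<delta> \<Longrightarrow> \<exists>x \<epsilon>. 0 < \<epsilon> \<and> \<epsilon> < \<delta> \<and> dist x0 x < \<delta> \<and>
      f x \<le> (bsup \<epsilon> f x + binf \<epsilon> f x) / 2 + \<epsilon> ^ 3"
  shows "0 \<le> inf_laplacian f x0"
proof (rule ccontr)
  assume neg: "\<not> ?thesis"
  define p where "p = grad f x0"
  define e where "e = (1 / norm p) *\<^sub>R p"
  have lap: "inf_laplacian f x0 = hess f x0 p" unfolding inf_laplacian_hess p_def ..
  \<comment> \<open>A vanishing gradient would make the infinity Laplacian vanish.\<close>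
  have p: "p \<noteq> 0" using neg unfolding lap by (auto simp: hess_def)
  have ne: "norm e = 1" "p \<bullet> z = norm p * (e \<bullet> z)" for z unfolding e_def using p by auto
  have "hess f x0 e = (1 / norm p)\<^sup>2 * inf_laplacian f x0" unfolding e_def hess_scaleR lap ..
  then have "hess f x0 e < 0" using neg p by (simp add: mult_pos_neg)
  define \<kappa> where "\<kappa> = - hess f x0 e / 3"
  have \<kappa>: "0 < \<kappa>" "hess f x0 e = - 3 * \<kappa>" using \<open>hess f x0 e < 0\<close> unfolding \<kappa>_def by auto
  obtain \<sigma> where \<sigma>: "0 < \<sigma>" "\<And>z. dist z e < \<sigma> \<Longrightarrow> dist (hess f x0 z) (hess f x0 e) < \<kappa>"
    using continuous_hess[of e f x0] \<kappa>(1) unfolding continuous_at_eps_delta by blast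
  \<comment> \<open>The estimate \<open>norm p * (1 - e \<bullet> z) \<le> 3 * \<eta>\<close>
    derived below then puts the rescaled step \<open>z\<close> within \<open>\<sigma>\<close> of the
    unit vector \<open>e\<close>.\<close>
  define \<eta> where "\<eta> = \<sigma>\<^sup>2 * norm p / 16"
  have \<eta>: "0 < \<eta>" using \<sigma> p unfolding \<eta>_def by simp
  obtain r where r: "0 < r" "ball x0 r \<subseteq> S" using S open_contains_ball by blast
  obtain d where d: "0 < d" "\<And>y. y \<in> ball x0 d \<Longrightarrow> norm (grad f y - p) \<le> \<eta>"
    using grad_modulus[OF S f \<eta>] unfolding p_def by auto
  obtain d' where d': "0 < d'" "\<And>y h. y \<in> ball x0 d' \<Longrightarrow> \<bar>hess f y h - hess f x0 h\<bar> \<le> \<kappa> * (norm h)\<^sup>2"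
    using hess_modulus[OF S f \<kappa>(1)] by auto
  define \<delta> where "\<delta> = Min {r / 2, d / 2, d' / 2, \<kappa> / 4, 1, \<eta>}"
  have "0 < \<delta>" unfolding \<delta>_def using r d d' \<eta> \<kappa> by auto
  then obtain x \<epsilon> where x: "0 < \<epsilon>" "\<epsilon> < \<delta>" "dist x0 x < \<delta>"
    "f x \<le> (bsup \<epsilon> f x + binf \<epsilon> f x) / 2 + \<epsilon> ^ 3"
    using H by blast
  have \<delta>: "\<delta> \<le> r / 2" "\<delta> \<le> d / 2" "\<delta> \<le> d' / 2" "\<delta> \<le> \<kappa> / 4" "\<delta> \<le> 1" "\<delta> \<le> \<eta>"
    unfolding \<delta>_def by (rule Min_le; simp)+
  have sub: "y \<in> S" "y \<in> ball x0 d" "y \<in> ball x0 d'" if "y \<in> ball x \<epsilon>" for y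
    using x \<delta> that dist_triangle[of x0 y x] r(2) by auto
  have diff: "f differentiable (at y)" if "y \<in> ball x \<epsilon>" for y using sub(1)[OF that] f unfolding Ck_on_2 by auto
  have near: "norm (grad f y - p) \<le> \<eta>" if "y \<in> ball x \<epsilon>" for y using d(2)[OF sub(2)[OF that]] .
  have g1: "f x + \<epsilon> * (norm p - \<eta>) \<le> bsup \<epsilon> f x"
    by (rule bsup_gradient_lower(1)[OF x(1) diff p near])
  have g2: "f y \<le> f x + p \<bullet> (y - x) + \<eta> * \<epsilon>" if "y \<in> ball x \<epsilon>" for y
    by (rule bsup_gradient_lower(2)[OF x(1) diff p near that])
  have "\<exists>C. \<forall>y\<in>ball x \<epsilon>. \<bar>f y\<bar> \<le> C"
    by (rule bsup_gradient_lower(3)[OF x(1) diff p near])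
  then obtain C where C: "\<And>y. y \<in> ball x \<epsilon> \<Longrightarrow> \<bar>f y\<bar> \<le> C" by blast
  have "0 < \<epsilon> ^ 3" using x(1) by simp
  then obtain y where y: "y \<in> ball x \<epsilon>" "bsup \<epsilon> f x - \<epsilon> ^ 3 < f y"
    using bsup_approx[OF x(1), of "bsup \<epsilon> f x - \<epsilon> ^ 3" f x] by auto
  define h where "h = y - x"
  have h: "norm h < \<epsilon>" using y(1) unfolding h_def by (simp add: dist_norm norm_minus_commute)
  have "x - h \<in> ball x \<epsilon>" using h by (simp add: dist_norm)
  then have "binf \<epsilon> f x \<le> f (x - h)" using binf_lower[of x \<epsilon> f C] C by blast
  then have diff2: "- 3 * \<epsilon> ^ 3 \<le> f (x + h) + f (x - h) - 2 * f x"
    using x(4) y(2) unfolding h_def by (simp add: field_simps)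
  obtain y1 y2 where y12: "y1 \<in> ball x \<epsilon>" "y2 \<in> ball x \<epsilon>"
    "f (x + h) + f (x - h) - 2 * f x = (hess f y1 h + hess f y2 h) / 2"
    using second_difference[of x \<epsilon> S f h] sub(1) f h by blast
  define z where "z = (1 / \<epsilon>) *\<^sub>R h"
  have hz: "h = \<epsilon> *\<^sub>R z" "norm z \<le> 1" unfolding z_def using x(1) h by auto
  have "\<epsilon> ^ 3 = \<epsilon> * \<epsilon>\<^sup>2" "\<epsilon>\<^sup>2 \<le> \<epsilon>" using x(1,2) \<delta> by (auto simp: power3_eq_cube power2_eq_square mult_left_le)
  have "\<epsilon> * (norm p - \<eta>) \<le> p \<bullet> h + \<eta> * \<epsilon> + \<epsilon> ^ 3"
    using g1 y(2) g2[OF y(1)] unfolding h_def by linarith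
  also have "\<dots> = \<epsilon> * (p \<bullet> z + \<eta> + \<epsilon>\<^sup>2)" unfolding hz \<open>\<epsilon> ^ 3 = \<epsilon> * \<epsilon>\<^sup>2\<close> by (simp add: algebra_simps)
  finally have "norm p - \<eta> \<le> p \<bullet> z + \<eta> + \<epsilon>\<^sup>2" using x(1) by simp
  then have "norm p * (1 - e \<bullet> z) \<le> 3 * \<eta>" using \<open>\<epsilon>\<^sup>2 \<le> \<epsilon>\<close> x(2) \<delta>(6) ne(2)[of z] by (simp add: algebra_simps)
  also have "\<dots> = norm p * (3 / 16 * \<sigma>\<^sup>2)" unfolding \<eta>_def by simp
  finally have "1 - e \<bullet> z \<le> 3 / 16 * \<sigma>\<^sup>2" using p by simp
  have "(norm (z - e))\<^sup>2 = (norm z)\<^sup>2 + (norm e)\<^sup>2 - 2 * (e \<bullet> z)"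
    by (simp add: power2_norm_eq_inner inner_diff_left inner_diff_right inner_commute)
  also have "\<dots> \<le> 2 * (1 - e \<bullet> z)" using power_mono[OF hz(2), of 2] ne(1) by simp
  also have "\<dots> < \<sigma>\<^sup>2" using \<open>1 - e \<bullet> z \<le> 3 / 16 * \<sigma>\<^sup>2\<close> zero_less_power[OF \<sigma>(1), of 2] by argo
  finally have "dist z e < \<sigma>" using \<sigma>(1) by (simp add: dist_norm power2_less_imp_less)
  then have "hess f x0 z < - 2 * \<kappa>" using \<sigma>(2)[of z] \<kappa>(2) by (simp add: dist_real_def)
  moreover have "\<bar>hess f y' z - hess f x0 z\<bar> \<le> \<kappa>" if "y' \<in> ball x \<epsilon>" for y'
  proof -
    have "(norm z)\<^sup>2 \<le> 1" using power_mono[OF hz(2), of 2] by simp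
    then have "\<kappa> * (norm z)\<^sup>2 \<le> \<kappa> * 1" using \<kappa>(1) by (intro mult_left_mono) auto
    then show ?thesis using d'(2)[OF sub(3)[OF that], of z] by simp
  qed
  ultimately have "hess f y1 z < - \<kappa>" "hess f y2 z < - \<kappa>" using y12(1,2) by (smt (verit))+
  then have "(hess f y1 z + hess f y2 z) / 2 < - \<kappa>" by simp
  then have "\<epsilon>\<^sup>2 * ((hess f y1 z + hess f y2 z) / 2) < \<epsilon>\<^sup>2 * (- \<kappa>)"
    using x(1) by (intro mult_strict_left_mono) auto
  moreover have "(hess f y1 h + hess f y2 h) / 2 = \<epsilon>\<^sup>2 * ((hess f y1 z + hess f y2 z) / 2)"
    unfolding hz(1) hess_scaleR by (simp add: algebra_simps)
  ultimately have "- 3 * \<epsilon> * \<epsilon>\<^sup>2 < - \<kappa> * \<epsilon>\<^sup>2"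
    using diff2 y12(3) \<open>\<epsilon> ^ 3 = \<epsilon> * \<epsilon>\<^sup>2\<close> by (simp add: mult_ac)
  then have "- 3 * \<epsilon> < - \<kappa>" using x(1) by simp
  then show False using x(1,2) \<delta>(4) by argo
qed

subsection \<open>Limits of discrete solutions\<close>

text \<open>A certificate for second-order smoothness from candidate partial derivatives. The second
  partials can be identified because the formula for the first ones holds on a whole open
  set.\<close>

lemma C2_data:
  fixes f :: "'a::euclidean_space \<Rightarrow> real"
  assumes S: "open S"
    and f: "\<And>x. x \<in> S \<Longrightarrow> (f has_derivative (\<lambda>h. \<Sum>i\<in>Basis. G i x * (h \<bullet> i))) (at x)"
    and G: "\<And>i x. i \<in> Basis \<Longrightarrow> x \<in> S \<Longrightarrow> (G i has_derivative (\<lambda>h. \<Sum>j\<in>Basis. H j i x * (h \<bullet> j))) (at x)"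
    and H: "\<And>i j. i \<in> Basis \<Longrightarrow> j \<in> Basis \<Longrightarrow> continuous_on S (H j i)"
  shows "Ck_on 2 f S"
    and "\<And>i x. i \<in> Basis \<Longrightarrow> x \<in> S \<Longrightarrow> pd i f x = G i x"
    and "\<And>i j x. i \<in> Basis \<Longrightarrow> j \<in> Basis \<Longrightarrow> x \<in> S \<Longrightarrow> pd j (pd i f) x = H j i x"
proof -
  have sel: "(\<Sum>k\<in>Basis. c k * (i \<bullet> k)) = c i" if "i \<in> Basis" for c :: "'a \<Rightarrow> real" and i
    using that by (simp add: inner_Basis if_distrib cong: if_cong)
  show pd1: "pd i f x = G i x" if "i \<in> Basis" "x \<in> S" for i x
    unfolding pd_def frechet_derivative_at[OF f[OF that(2)], symmetric] by (rule sel[OF that(1)])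
  have d: "(pd i f has_derivative (\<lambda>h. \<Sum>j\<in>Basis. H j i x * (h \<bullet> j))) (at x)" if "i \<in> Basis" "x \<in> S" for i x
    by (rule has_derivative_transform_within_open[OF G[OF that] S that(2)]) (simp add: pd1 that(1))
  show pd2: "pd j (pd i f) x = H j i x" if "i \<in> Basis" "j \<in> Basis" "x \<in> S" for i j x
    unfolding pd_def[of j] frechet_derivative_at[OF d[OF that(1,3)], symmetric] by (rule sel[OF that(2)])
  have "continuous_on S (pd j (pd i f))" if "i \<in> Basis" "j \<in> Basis" for i j
    using H[OF that] pd2[OF that] by (simp cong: continuous_on_cong)
  moreover have "f differentiable (at x)" if "x \<in> S" for x using f[OF that] differentiableI by blast
  moreover have "pd i f differentiable (at x)" if "i \<in> Basis" "x \<in> S" for i x using d[OF that] differentiableI by blast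
  ultimately show "Ck_on 2 f S" unfolding Ck_on_2 by blast
qed

lemma C2_dataD:
  fixes f :: "'a::euclidean_space \<Rightarrow> real"
  assumes "Ck_on 2 f S"
  shows "x \<in> S \<Longrightarrow> (f has_derivative (\<lambda>h. \<Sum>i\<in>Basis. pd i f x * (h \<bullet> i))) (at x)"
    and "i \<in> Basis \<Longrightarrow> x \<in> S \<Longrightarrow> (pd i f has_derivative (\<lambda>h. \<Sum>j\<in>Basis. pd j (pd i f) x * (h \<bullet> j))) (at x)"
    and "i \<in> Basis \<Longrightarrow> j \<in> Basis \<Longrightarrow> continuous_on S (pd j (pd i f))"
proof -
  have eq: "grad g x \<bullet> h = (\<Sum>i\<in>Basis. pd i g x * (h \<bullet> i))" for g :: "'a \<Rightarrow> real" and x h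
    unfolding grad_def by (simp add: inner_sum_left) (simp add: inner_commute)
  show "x \<in> S \<Longrightarrow> (f has_derivative (\<lambda>h. \<Sum>i\<in>Basis. pd i f x * (h \<bullet> i))) (at x)"
    using has_derivative_grad[of f x] assms unfolding eq Ck_on_2 by blast
  show "i \<in> Basis \<Longrightarrow> x \<in> S \<Longrightarrow> (pd i f has_derivative (\<lambda>h. \<Sum>j\<in>Basis. pd j (pd i f) x * (h \<bullet> j))) (at x)"
    using has_derivative_grad[of "pd i f" x] assms unfolding eq Ck_on_2 by blast
  show "i \<in> Basis \<Longrightarrow> j \<in> Basis \<Longrightarrow> continuous_on S (pd j (pd i f))"
    using assms unfolding Ck_on_2 by blast
qed

lemma
  assumes S: "open S" and f: "Ck_on 2 f S"
  shows Ck_on_uminus: "Ck_on 2 (\<lambda>x. - f x) S"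
    and grad_uminus: "x \<in> S \<Longrightarrow> grad (\<lambda>x. - f x) x = - grad f x"
    and inf_laplacian_uminus: "x \<in> S \<Longrightarrow> inf_laplacian (\<lambda>x. - f x) x = - inf_laplacian f x"
proof -
  have d1: "((\<lambda>x. - f x) has_derivative (\<lambda>h. \<Sum>i\<in>Basis. - pd i f x * (h \<bullet> i))) (at x)" if "x \<in> S" for x
    using has_derivative_minus[OF C2_dataD(1)[OF f that]] by (simp add: sum_negf)
  have d2: "((\<lambda>x. - pd i f x) has_derivative (\<lambda>h. \<Sum>j\<in>Basis. - pd j (pd i f) x * (h \<bullet> j))) (at x)"
    if "i \<in> Basis" "x \<in> S" for x i
    using has_derivative_minus[OF C2_dataD(2)[OF f that]] by (simp add: sum_negf)
  have d3: "continuous_on S (\<lambda>x. - pd j (pd i f) x)" if "i \<in> Basis" "j \<in> Basis" for i j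
    by (intro continuous_intros C2_dataD(3)[OF f that])
  note D = C2_data[where f="\<lambda>x. - f x" and G="\<lambda>i x. - pd i f x" and H="\<lambda>j i x. - pd j (pd i f) x", OF S]
  have 1: "Ck_on 2 (\<lambda>x. - f x) S" "\<And>i x. i \<in> Basis \<Longrightarrow> x \<in> S \<Longrightarrow> pd i (\<lambda>x. - f x) x = - pd i f x"
    "\<And>i j x. i \<in> Basis \<Longrightarrow> j \<in> Basis \<Longrightarrow> x \<in> S \<Longrightarrow> pd j (pd i (\<lambda>x. - f x)) x = - pd j (pd i f) x"
    by (rule D; use d1 d2 d3 in blast)+
  show "Ck_on 2 (\<lambda>x. - f x) S" by (rule 1)
  show "x \<in> S \<Longrightarrow> grad (\<lambda>x. - f x) x = - grad f x"
    unfolding grad_def using 1(2) by (simp add: sum_negf[symmetric])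
  show "x \<in> S \<Longrightarrow> inf_laplacian (\<lambda>x. - f x) x = - inf_laplacian f x"
    unfolding inf_laplacian_def using 1(2,3) by (simp add: sum_negf[symmetric])
qed

lemma continuous_bounded_cball:
  fixes g :: "'a::euclidean_space \<Rightarrow> real"
  assumes "continuous_on (cball x r) g"
  shows "\<exists>B. \<forall>y\<in>cball x r. \<bar>g y\<bar> \<le> B"
  using compact_imp_bounded[OF compact_continuous_image[OF assms compact_cball]]
  unfolding bounded_iff by auto

text \<open>The approximations may be discontinuous, so \<open>v n - \<phi>\<close> may have no
  maximum. An error \<open>\<kappa> n\<close> is allowed instead, and strictness of the limiting
  maximum still drives the almost maximal points to \<open>x0\<close>.\<close>

lemma touching_points:
  fixes u \<phi> :: "'a::euclidean_space \<Rightarrow> real"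
  assumes r: "0 < r" and u: "continuous_on (cball x0 r) u" and \<phi>: "continuous_on (cball x0 r) \<phi>"
    and strict: "\<And>y. y \<in> cball x0 r \<Longrightarrow> y \<noteq> x0 \<Longrightarrow> u y - \<phi> y < u x0 - \<phi> x0"
    and v: "uniform_limit (cball x0 r) v u sequentially"
    and \<kappa>: "\<And>n. 0 < \<kappa> n" "\<kappa> \<longlonglongrightarrow> 0" and \<delta>: "0 < \<delta>"
  shows "\<forall>\<^sub>F n in sequentially. \<exists>x\<in>cball x0 r \<inter> ball x0 \<delta>. \<forall>y\<in>cball x0 r. v n y - \<phi> y \<le> v n x - \<phi> x + \<kappa> n"
proof -
  define g where "g y = u y - \<phi> y" for y
  have g: "continuous_on (cball x0 r) g" unfolding g_def by (intro continuous_intros u \<phi>)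
  define K where "K = cball x0 r - ball x0 \<delta>"
  have K: "compact K" "K \<subseteq> cball x0 r" unfolding K_def by (auto intro: compact_diff)
  \<comment> \<open>Of the margin \<open>4 * m\<close>, two parts cover the uniform error at the two
    points compared and one covers \<open>\<kappa> n\<close>; the last leaves a strict
    inequality.\<close>
  have "\<exists>m>0. \<forall>y\<in>K. g y \<le> g x0 - 4 * m"
  proof (cases "K = {}")
    case False
    obtain k where k: "k \<in> K" "\<And>y. y \<in> K \<Longrightarrow> g y \<le> g k"
      using continuous_attains_sup[OF K(1) False continuous_on_subset[OF g K(2)]] by blast
    have "g k < g x0" unfolding g_def by (rule strict) (use k(1) K(2) \<delta> in \<open>auto simp: K_def\<close>)
    then show ?thesis using k(2) by (intro exI[of _ "(g x0 - g k) / 4"]) (auto simp: field_simps)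
  qed (auto intro!: exI[of _ 1])
  then obtain m where m: "0 < m" "\<And>y. y \<in> K \<Longrightarrow> g y \<le> g x0 - 4 * m" by blast
  obtain B where B: "\<And>y. y \<in> cball x0 r \<Longrightarrow> \<bar>g y\<bar> \<le> B"
    using continuous_bounded_cball[OF g] by blast
  have "\<forall>\<^sub>F n in sequentially. \<kappa> n < m" using \<kappa>(2) m(1) by (rule order_tendstoD)
  moreover have "\<forall>\<^sub>F n in sequentially. \<forall>y\<in>cball x0 r. dist (v n y) (u y) < m"
    using v m(1) unfolding uniform_limit_iff by blast
  ultimately show ?thesis
  proof eventually_elim
    case (elim n)
    define w where "w y = v n y - \<phi> y" for y
    have wg: "\<bar>w y - g y\<bar> < m" if "y \<in> cball x0 r" for y
      using elim(2) that unfolding w_def g_def by (auto simp: dist_real_def)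
    have bdd: "bdd_above (w ` cball x0 r)"
    proof (rule bdd_aboveI2)
      fix y assume "y \<in> cball x0 r"
      then show "w y \<le> B + m" using wg[of y] B[of y] by linarith
    qed
    define s where "s = (SUP y\<in>cball x0 r. w y)"
    have ws: "w y \<le> s" if "y \<in> cball x0 r" for y unfolding s_def by (rule cSUP_upper[OF that bdd])
    have "\<exists>x\<in>cball x0 r. s - \<kappa> n < w x"
      unfolding s_def using less_cSUP_iff[OF _ bdd, of "(SUP y\<in>cball x0 r. w y) - \<kappa> n"] \<kappa>(1)[of n] r by auto
    then obtain x where x: "x \<in> cball x0 r" "s - \<kappa> n < w x" by blast
    have "x \<in> ball x0 \<delta>"
    proof (rule ccontr)
      assume "x \<notin> ball x0 \<delta>"
      then have "g x \<le> g x0 - 4 * m" using x(1) by (intro m(2)) (simp add: K_def)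
      then show False using x(2) wg[OF x(1)] wg[of x0] ws[of x0] r elim(1) m(1) by auto
    qed
    then show ?case using x ws unfolding w_def by (intro bexI[of _ x]) (auto, smt (verit) mem_cball)
  qed
qed

text \<open>Almost contact transfers discrete inequalities from \<open>v n\<close> to the test
  function up to \<open>\<epsilon> n ^ 3\<close>. The point is kept so close to \<open>x0\<close>
  that its ball of radius \<open>\<epsilon> n\<close> stays where the contact inequality
  holds.\<close>

lemma contact_points:
  fixes u \<phi> :: "'a::euclidean_space \<Rightarrow> real"
  assumes \<Omega>: "open \<Omega>" and x0: "x0 \<in> \<Omega>" and u: "continuous_on \<Omega> u" and \<phi>: "continuous_on \<Omega> \<phi>"
    and strict: "strict_local_max_at \<Omega> (\<lambda>y. u y - \<phi> y) x0"
    and \<epsilon>: "\<And>n. 0 < \<epsilon> n" "\<epsilon> \<longlonglongrightarrow> 0"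
    and C: "\<And>n x. \<bar>v n x\<bar> \<le> C n" and v: "uniform_limit \<Omega> v u sequentially" and \<delta>: "0 < \<delta>"
  shows "\<exists>n x. \<epsilon> n < \<delta> \<and> dist x0 x < \<delta> \<and> x \<in> \<Omega> \<and> \<bar>v n x - u x0\<bar> < \<delta> \<and>
    bsup (\<epsilon> n) (v n) x \<le> bsup (\<epsilon> n) \<phi> x + (v n x - \<phi> x + \<epsilon> n ^ 3) \<and>
    binf (\<epsilon> n) (v n) x \<le> binf (\<epsilon> n) \<phi> x + (v n x - \<phi> x + \<epsilon> n ^ 3)"
proof -
  obtain r1 where r1: "0 < r1" "\<And>y. y \<in> \<Omega> \<inter> ball x0 r1 \<Longrightarrow> y \<noteq> x0 \<Longrightarrow> u y - \<phi> y < u x0 - \<phi> x0"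
    using strict unfolding strict_local_max_at_def by blast
  obtain r2 where r2: "0 < r2" "cball x0 r2 \<subseteq> \<Omega>" using \<Omega> x0 open_contains_cball by blast
  obtain r3 where r3: "0 < r3" "\<And>y. dist y x0 < r3 \<Longrightarrow> \<bar>u y - u x0\<bar> < \<delta> / 2"
    using u \<Omega> x0 \<delta> unfolding continuous_on_eq_continuous_at[OF \<Omega>] continuous_at_eps_delta dist_real_def
    by (meson half_gt_zero)
  define r where "r = min r1 r2 / 2"
  have r: "0 < r" "r < r1" "r \<le> r2" using r1 r2 unfolding r_def by auto
  have sub: "cball x0 r \<subseteq> \<Omega>" using r2(2) r(3) by (meson cball_subset_cball_iff order_trans subset_cball)
  define \<delta>' where "\<delta>' = Min {\<delta>, r / 2, r3}"
  have \<delta>': "0 < \<delta>'" unfolding \<delta>'_def using \<delta> r r3 by auto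
  have \<delta>'': "\<delta>' \<le> \<delta>" "\<delta>' \<le> r / 2" "\<delta>' \<le> r3" unfolding \<delta>'_def by (rule Min_le; simp)+
  have "(\<lambda>n. \<epsilon> n ^ 3) \<longlonglongrightarrow> 0 ^ 3" by (intro tendsto_intros \<epsilon>)
  then have "\<forall>\<^sub>F n in sequentially. \<exists>x\<in>cball x0 r \<inter> ball x0 \<delta>'.
      \<forall>y\<in>cball x0 r. v n y - \<phi> y \<le> v n x - \<phi> x + \<epsilon> n ^ 3"
    using r1(2) sub r \<epsilon>(1) by (intro touching_points[OF r(1) continuous_on_subset[OF u sub]
        continuous_on_subset[OF \<phi> sub] _ uniform_limit_on_subset[OF v sub] _ _ \<delta>']) auto
  moreover have "\<forall>\<^sub>F n in sequentially. \<epsilon> n < \<delta>'" using \<epsilon>(2) \<delta>' by (rule order_tendstoD)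
  moreover have "\<forall>\<^sub>F n in sequentially. \<forall>y\<in>\<Omega>. dist (v n y) (u y) < \<delta> / 2"
    using v half_gt_zero[OF \<delta>] unfolding uniform_limit_iff by blast
  ultimately have "\<forall>\<^sub>F n in sequentially. (\<exists>x\<in>cball x0 r \<inter> ball x0 \<delta>'.
      \<forall>y\<in>cball x0 r. v n y - \<phi> y \<le> v n x - \<phi> x + \<epsilon> n ^ 3) \<and> \<epsilon> n < \<delta>' \<and> (\<forall>y\<in>\<Omega>. dist (v n y) (u y) < \<delta> / 2)"
    by eventually_elim blast
  then obtain n x where n: "x \<in> cball x0 r" "x \<in> ball x0 \<delta>'"
    "\<And>y. y \<in> cball x0 r \<Longrightarrow> v n y - \<phi> y \<le> v n x - \<phi> x + \<epsilon> n ^ 3" "\<epsilon> n < \<delta>'"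
    "\<And>y. y \<in> \<Omega> \<Longrightarrow> dist (v n y) (u y) < \<delta> / 2"
    using eventually_happens'[OF sequentially_bot] by blast
  have near: "y \<in> cball x0 r" if "y \<in> ball x (\<epsilon> n)" for y
    using that n(2,4) \<delta>''(2) dist_triangle[of x0 y x] by auto
  obtain B where B: "\<And>y. y \<in> cball x0 r \<Longrightarrow> \<bar>\<phi> y\<bar> \<le> B"
    using continuous_bounded_cball[OF continuous_on_subset[OF \<phi> sub]] by blast
  have "bsup (\<epsilon> n) (v n) x \<le> bsup (\<epsilon> n) \<phi> x + (v n x - \<phi> x + \<epsilon> n ^ 3)"
    by (rule bsup_mono[OF \<epsilon>(1), where C=B]) (use near B n(3) in \<open>auto simp: algebra_simps\<close>)
  moreover have "binf (\<epsilon> n) (v n) x \<le> binf (\<epsilon> n) \<phi> x + (v n x - \<phi> x + \<epsilon> n ^ 3)"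
    by (rule binf_mono[OF \<epsilon>(1), where C="C n"]) (use near C n(3) in \<open>auto simp: algebra_simps\<close>)
  moreover have "x \<in> \<Omega>" using n(1) sub by blast
  moreover have "\<bar>v n x - u x0\<bar> < \<delta>"
  proof -
    have "\<bar>u x - u x0\<bar> < \<delta> / 2" using n(2) \<delta>'' by (intro r3(2)) (auto simp: dist_commute)
    moreover have "\<bar>v n x - u x\<bar> < \<delta> / 2" using n(5)[OF \<open>x \<in> \<Omega>\<close>] by (simp add: dist_real_def)
    ultimately show ?thesis by argo
  qed
  ultimately show ?thesis using n(2,4) \<delta>'' by (intro exI[of _ n] exI[of _ x]) auto
qed

lemma Ck_on_2_continuous:
  assumes "Ck_on 2 f S" shows "continuous_on S f"
  using assms unfolding Ck_on_2
  by (auto intro!: continuous_at_imp_continuous_on differentiable_imp_continuous_within)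

lemma limit_viscosity_subsolution:
  fixes u :: "'a::euclidean_space \<Rightarrow> real"
  assumes \<Omega>: "open \<Omega>" and u: "continuous_on \<Omega> u"
    and \<epsilon>: "\<And>n. 0 < \<epsilon> n" "\<epsilon> \<longlonglongrightarrow> 0"
    and C: "\<And>n x. \<bar>v n x\<bar> \<le> C n" and v: "uniform_limit \<Omega> v u sequentially"
    and dpp: "\<And>n x. x \<in> \<Omega> \<Longrightarrow> v n x \<le> dpp (\<epsilon> n) (v n) x"
  shows "viscosity_subsolution \<Omega> u"
  unfolding viscosity_subsolution_def
proof (intro conjI ballI allI impI)
  show "usc_on \<Omega> u"
    unfolding usc_on_def using u by (auto simp: continuous_on_def intro: order_tendstoD)
  fix x0 \<phi> assume x0: "x0 \<in> \<Omega>" and A: "Ck_on 2 \<phi> \<Omega> \<and> strict_local_max_at \<Omega> (\<lambda>y. u y - \<phi> y) x0"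
  note contact = contact_points[OF \<Omega> x0 u Ck_on_2_continuous[OF conjunct1[OF A]] conjunct2[OF A] \<epsilon> C v]
  have "0 \<le> inf_laplacian \<phi> x0"
  proof (rule tug_consistency[OF \<Omega> x0 conjunct1[OF A]])
    fix \<delta> :: real assume "0 < \<delta>"
    from contact[OF this] obtain n x where n: "\<epsilon> n < \<delta>" "dist x0 x < \<delta>" "x \<in> \<Omega>"
      "bsup (\<epsilon> n) (v n) x \<le> bsup (\<epsilon> n) \<phi> x + (v n x - \<phi> x + \<epsilon> n ^ 3)"
      "binf (\<epsilon> n) (v n) x \<le> binf (\<epsilon> n) \<phi> x + (v n x - \<phi> x + \<epsilon> n ^ 3)" by blast
    have "v n x \<le> (bsup (\<epsilon> n) (v n) x + binf (\<epsilon> n) (v n) x) / 2"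
      using dpp[OF n(3), of n] unfolding dpp_def by simp
    then have "\<phi> x \<le> (bsup (\<epsilon> n) \<phi> x + binf (\<epsilon> n) \<phi> x) / 2 + \<epsilon> n ^ 3" using n(4,5) by argo
    then show "\<exists>x \<epsilon>. 0 < \<epsilon> \<and> \<epsilon> < \<delta> \<and> dist x0 x < \<delta> \<and> \<phi> x \<le> (bsup \<epsilon> \<phi> x + binf \<epsilon> \<phi> x) / 2 + \<epsilon> ^ 3"
      using n \<epsilon>(1)[of n] by blast
  qed
  moreover have "1 \<le> norm (grad \<phi> x0)" if pos: "0 < u x0"
  proof (rule pay_consistency_lower[OF \<Omega> x0 conjunct1[OF A]])
    fix \<delta> :: real assume "0 < \<delta>"
    \<comment> \<open>Values of \<open>v n\<close> within \<open>u x0\<close> of \<open>u x0\<close>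
      are positive, so \<open>max 0\<close> must be realized by paying.\<close>
    then have "0 < min \<delta> (u x0)" using pos by simp
    from contact[OF this] obtain n x where n: "\<epsilon> n < \<delta>" "dist x0 x < \<delta>" "x \<in> \<Omega>" "\<bar>v n x - u x0\<bar> < u x0"
      "bsup (\<epsilon> n) (v n) x \<le> bsup (\<epsilon> n) \<phi> x + (v n x - \<phi> x + \<epsilon> n ^ 3)" by auto
    have "v n x \<le> bsup (\<epsilon> n) (v n) x - \<epsilon> n"
      using dpp[OF n(3), of n] n(4) unfolding dpp_def by auto
    then have "\<phi> x \<le> bsup (\<epsilon> n) \<phi> x - \<epsilon> n + \<epsilon> n ^ 3" using n(5) by argo
    then show "\<exists>x \<epsilon>. 0 < \<epsilon> \<and> \<epsilon> < \<delta> \<and> dist x0 x < \<delta> \<and> \<phi> x \<le> bsup \<epsilon> \<phi> x - \<epsilon> + \<epsilon> ^ 3"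
      using n \<epsilon>(1)[of n] by blast
  qed
  ultimately show "max (- inf_laplacian \<phi> x0) (indicator {y. 0 < u y} x0 - norm (grad \<phi> x0)) \<le> 0"
    by (auto simp: indicator_def)
qed

text \<open>An upper bound on a minimum only says that one of two branches is small, possibly a
  different one at each contact point. Both alternatives are monotone in \<open>\<delta>\<close>, so
  one persists at all scales. Tug-of-war gives the sign of the infinity Laplacian; paying gives the
  gradient bound and, since its branch is at least 0, also \<open>0 \<le> u x0\<close>.\<close>

lemma limit_viscosity_supersolution:
  fixes u :: "'a::euclidean_space \<Rightarrow> real"
  assumes \<Omega>: "open \<Omega>" and u: "continuous_on \<Omega> u"
    and \<epsilon>: "\<And>n. 0 < \<epsilon> n" "\<epsilon> \<longlonglongrightarrow> 0"
    and C: "\<And>n x. \<bar>v n x\<bar> \<le> C n" and v: "uniform_limit \<Omega> v u sequentially"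
    and dpp: "\<And>n x. x \<in> \<Omega> \<Longrightarrow> dpp (\<epsilon> n) (v n) x \<le> v n x"
  shows "viscosity_supersolution \<Omega> u"
  unfolding viscosity_supersolution_def
proof (intro conjI ballI allI impI)
  show "lsc_on \<Omega> u"
    unfolding lsc_on_def using u by (auto simp: continuous_on_def intro: order_tendstoD)
  fix x0 \<phi> assume x0: "x0 \<in> \<Omega>" and A: "Ck_on 2 \<phi> \<Omega> \<and> strict_local_min_at \<Omega> (\<lambda>y. u y - \<phi> y) x0"
  have max: "strict_local_max_at \<Omega> (\<lambda>y. - u y - - \<phi> y) x0"
  proof -
    have "- u y - - \<phi> y < - u x0 - - \<phi> x0 \<longleftrightarrow> u x0 - \<phi> x0 < u y - \<phi> y" for y by auto
    then show ?thesis using A unfolding strict_local_max_at_def strict_local_min_at_def by (simp only:)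
  qed
  have \<phi>: "Ck_on 2 \<phi> \<Omega>" using A by blast
  have neg: "continuous_on \<Omega> (\<lambda>x. - u x)" "continuous_on \<Omega> (\<lambda>x. - \<phi> x)"
    "uniform_limit \<Omega> (\<lambda>n x. - v n x) (\<lambda>x. - u x) sequentially" "\<And>n x. \<bar>- v n x\<bar> \<le> C n"
    using u Ck_on_2_continuous[OF \<phi>] v C by (auto intro!: continuous_intros uniform_limit_intros)
  have minus: "binf e (\<lambda>y. - f y) x = - bsup e f x" for e x and f :: "'a \<Rightarrow> real"
    using bsup_uminus[of e "\<lambda>y. - f y" x] by simp
  have contact: "\<exists>n x. \<epsilon> n < \<delta> \<and> dist x0 x < \<delta> \<and> x \<in> \<Omega> \<and> \<bar>v n x - u x0\<bar> < \<delta> \<and>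
      binf (\<epsilon> n) \<phi> x \<le> binf (\<epsilon> n) (v n) x - (v n x - \<phi> x) + \<epsilon> n ^ 3 \<and>
      bsup (\<epsilon> n) \<phi> x \<le> bsup (\<epsilon> n) (v n) x - (v n x - \<phi> x) + \<epsilon> n ^ 3" if d: "0 < \<delta>" for \<delta>
  proof -
    obtain n x where "\<epsilon> n < \<delta>" "dist x0 x < \<delta>" "x \<in> \<Omega>" "\<bar>- v n x - - u x0\<bar> < \<delta>"
      "bsup (\<epsilon> n) (\<lambda>y. - v n y) x \<le> bsup (\<epsilon> n) (\<lambda>y. - \<phi> y) x + (- v n x - - \<phi> x + \<epsilon> n ^ 3)"
      "binf (\<epsilon> n) (\<lambda>y. - v n y) x \<le> binf (\<epsilon> n) (\<lambda>y. - \<phi> y) x + (- v n x - - \<phi> x + \<epsilon> n ^ 3)"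
      using contact_points[OF \<Omega> x0 neg(1,2) max \<epsilon> neg(4,3) d] by blast
    then show ?thesis unfolding minus bsup_uminus
      by (intro exI[of _ n] exI[of _ x]) auto
  qed
  define tug where "tug \<delta> \<longleftrightarrow> (\<exists>x \<epsilon>. 0 < \<epsilon> \<and> \<epsilon> < \<delta> \<and> dist x0 x < \<delta> \<and>
    (bsup \<epsilon> \<phi> x + binf \<epsilon> \<phi> x) / 2 - \<epsilon> ^ 3 \<le> \<phi> x)" for \<delta>
  define pay where "pay \<delta> \<longleftrightarrow> - \<delta> < u x0 \<and> (\<exists>x \<epsilon>. 0 < \<epsilon> \<and> \<epsilon> < \<delta> \<and> dist x0 x < \<delta> \<and>
    bsup \<epsilon> \<phi> x - \<epsilon> - \<epsilon> ^ 3 \<le> \<phi> x)" for \<delta>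
  have alt: "tug \<delta> \<or> pay \<delta>" if \<delta>: "0 < \<delta>" for \<delta>
  proof -
    obtain n x where n: "\<epsilon> n < \<delta>" "dist x0 x < \<delta>" "x \<in> \<Omega>" "\<bar>v n x - u x0\<bar> < \<delta>"
      "binf (\<epsilon> n) \<phi> x \<le> binf (\<epsilon> n) (v n) x - (v n x - \<phi> x) + \<epsilon> n ^ 3"
      "bsup (\<epsilon> n) \<phi> x \<le> bsup (\<epsilon> n) (v n) x - (v n x - \<phi> x) + \<epsilon> n ^ 3" using contact[OF \<delta>] by blast
    consider "(bsup (\<epsilon> n) (v n) x + binf (\<epsilon> n) (v n) x) / 2 \<le> v n x" | "max 0 (bsup (\<epsilon> n) (v n) x - \<epsilon> n) \<le> v n x"
      using dpp[OF n(3), of n] unfolding dpp_def by (auto simp only: min_le_iff_disj)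
    then show ?thesis
    proof cases
      case 1
      then have "(bsup (\<epsilon> n) \<phi> x + binf (\<epsilon> n) \<phi> x) / 2 - \<epsilon> n ^ 3 \<le> \<phi> x" using n(5,6) by argo
      then show ?thesis unfolding tug_def using n \<epsilon>(1)[of n] by blast
    next
      case 2
      then have "bsup (\<epsilon> n) \<phi> x - \<epsilon> n - \<epsilon> n ^ 3 \<le> \<phi> x" "- \<delta> < u x0" using n(4,6) by auto
      then show ?thesis unfolding pay_def using n \<epsilon>(1)[of n] by blast
    qed
  qed
  have "(\<forall>\<delta>>0. tug \<delta>) \<or> (\<forall>\<delta>>0. pay \<delta>)"
  proof (rule ccontr)
    assume "\<not> ?thesis"
    then obtain a b where ab: "0 < a" "\<not> tug a" "0 < b" "\<not> pay b" by blast
    have "tug a" if "tug (min a b)" using that unfolding tug_def by auto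
    moreover have "pay b" if "pay (min a b)" using that unfolding pay_def by auto
    ultimately show False using alt[of "min a b"] ab by auto
  qed
  then show "0 \<le> max (- inf_laplacian \<phi> x0) (indicator {y. 0 \<le> u y} x0 - norm (grad \<phi> x0))"
  proof
    assume tug: "\<forall>\<delta>>0. tug \<delta>"
    have "0 \<le> inf_laplacian (\<lambda>x. - \<phi> x) x0"
    proof (rule tug_consistency[OF \<Omega> x0 Ck_on_uminus[OF \<Omega> \<phi>]])
      fix \<delta> :: real assume "0 < \<delta>"
      then obtain x e where "0 < e" "e < \<delta>" "dist x0 x < \<delta>" "(bsup e \<phi> x + binf e \<phi> x) / 2 - e ^ 3 \<le> \<phi> x"
        using tug unfolding tug_def by blast
      then show "\<exists>x e. 0 < e \<and> e < \<delta> \<and> dist x0 x < \<delta> \<and>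
          - \<phi> x \<le> (bsup e (\<lambda>x. - \<phi> x) x + binf e (\<lambda>x. - \<phi> x) x) / 2 + e ^ 3"
        unfolding minus bsup_uminus by (intro exI[of _ x] exI[of _ e]) (auto simp: field_simps)
    qed
    then show ?thesis using inf_laplacian_uminus[OF \<Omega> \<phi> x0] by simp
  next
    assume pay: "\<forall>\<delta>>0. pay \<delta>"
    have "norm (grad \<phi> x0) \<le> 1"
      by (rule pay_consistency_upper[OF \<Omega> x0 \<phi>]) (use pay in \<open>auto simp: pay_def\<close>)
    moreover have "0 \<le> u x0"
    proof (rule ccontr)
      assume "\<not> 0 \<le> u x0"
      then have "pay (- u x0)" using pay by simp
      then show False unfolding pay_def by simp
    qed
    ultimately show ?thesis by (simp add: indicator_def)
  qed
qed

subsection \<open>Comparison with cones\<close>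

lemma sum_inner_Basis: "(\<Sum>i\<in>Basis. (h \<bullet> i) * (k \<bullet> i)) = h \<bullet> k" for h k :: "'a::euclidean_space"
  by (rule euclidean_inner[symmetric])

lemma sum_bilinear_Basis:
  fixes d h i :: "'a::euclidean_space"
  shows "(\<Sum>j\<in>Basis. (A * (2 * (d \<bullet> j)) * (2 * (d \<bullet> i)) + B * (2 * (j \<bullet> i))) * (h \<bullet> j))
    = B * (2 * (h \<bullet> i)) + A * (2 * (d \<bullet> h)) * (2 * (d \<bullet> i))"
proof -
  have "(A * (2 * (d \<bullet> j)) * (2 * (d \<bullet> i)) + B * (2 * (j \<bullet> i))) * (h \<bullet> j)
      = (4 * A * (d \<bullet> i)) * ((d \<bullet> j) * (h \<bullet> j)) + (2 * B) * ((i \<bullet> j) * (h \<bullet> j))" for j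
    by (simp add: algebra_simps inner_commute)
  then have "(\<Sum>j\<in>Basis. (A * (2 * (d \<bullet> j)) * (2 * (d \<bullet> i)) + B * (2 * (j \<bullet> i))) * (h \<bullet> j))
      = (4 * A * (d \<bullet> i)) * (\<Sum>j\<in>Basis. (d \<bullet> j) * (h \<bullet> j)) + (2 * B) * (\<Sum>j\<in>Basis. (i \<bullet> j) * (h \<bullet> j))"
    by (simp only: sum.distrib sum_distrib_left)
  then show ?thesis unfolding sum_inner_Basis by (simp add: inner_commute)
qed

text \<open>The profile \<open>g\<close> takes the squared distance as its argument so that the
  function is smooth at the centre as well. Where the gradient does not vanish, the sign of the
  infinity Laplacian is that of \<open>2 * g2 s * s + g1 s\<close>, with \<open>s\<close> the
  squared distance.\<close>

lemma
  fixes x :: "'a::euclidean_space" and g g1 g2 :: "real \<Rightarrow> real"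
  assumes g: "\<And>s. 0 \<le> s \<Longrightarrow> (g has_real_derivative g1 s) (at s)"
    and g1: "\<And>s. 0 \<le> s \<Longrightarrow> (g1 has_real_derivative g2 s) (at s)"
    and g2: "continuous_on {0..} g2"
  defines "f \<equiv> \<lambda>y. g ((y - x) \<bullet> (y - x))"
  shows radial_Ck_on: "Ck_on 2 f UNIV"
    and radial_grad: "grad f y = (2 * g1 ((y - x) \<bullet> (y - x))) *\<^sub>R (y - x)"
    and radial_pd: "i \<in> Basis \<Longrightarrow> pd i f y = g1 ((y - x) \<bullet> (y - x)) * (2 * ((y - x) \<bullet> i))"
    and radial_pd2: "i \<in> Basis \<Longrightarrow> j \<in> Basis \<Longrightarrow> pd j (pd i f) y = g2 ((y - x) \<bullet> (y - x)) * (2 * ((y - x) \<bullet> j)) * (2 * ((y - x) \<bullet> i))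
      + g1 ((y - x) \<bullet> (y - x)) * (2 * (j \<bullet> i))"
    and radial_inf_laplacian: "inf_laplacian f y = 8 * (g1 ((y - x) \<bullet> (y - x)))\<^sup>2 * ((y - x) \<bullet> (y - x))
      * (2 * g2 ((y - x) \<bullet> (y - x)) * ((y - x) \<bullet> (y - x)) + g1 ((y - x) \<bullet> (y - x)))"
proof -
  define s where "s y = (y - x) \<bullet> (y - x)" for y
  have s0: "0 \<le> s y" for y unfolding s_def by simp
  define G where "G i y = g1 (s y) * (2 * ((y - x) \<bullet> i))" for i y
  define H where "H j i y = g2 (s y) * (2 * ((y - x) \<bullet> j)) * (2 * ((y - x) \<bullet> i)) + g1 (s y) * (2 * (j \<bullet> i))" for i j y
  have ds: "(s has_derivative (\<lambda>h. 2 * ((y - x) \<bullet> h))) (at y)" for y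
    unfolding s_def[abs_def] by (auto intro!: derivative_eq_intros simp: inner_commute)
  have chain: "((\<lambda>y. k (s y)) has_derivative (\<lambda>h. k1 (s y) * (2 * ((y - x) \<bullet> h)))) (at y)"
    if "\<And>s. 0 \<le> s \<Longrightarrow> (k has_real_derivative k1 s) (at s)" for k k1 y
    using has_derivative_compose[OF ds that[OF s0, unfolded has_field_derivative_def]] .
  have e1: "k * (2 * ((y - x) \<bullet> h)) = (\<Sum>i\<in>Basis. k * (2 * ((y - x) \<bullet> i)) * (h \<bullet> i))" for k y h
    by (subst euclidean_inner[of "y - x" h]) (simp add: sum_distrib_left mult_ac)
  have d1: "(f has_derivative (\<lambda>h. \<Sum>i\<in>Basis. G i y * (h \<bullet> i))) (at y)" for y
  proof -
    have "(\<lambda>h. g1 (s y) * (2 * ((y - x) \<bullet> h))) = (\<lambda>h. \<Sum>i\<in>Basis. G i y * (h \<bullet> i))"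
      unfolding G_def by (rule ext, rule e1)
    moreover have "f = (\<lambda>y. g (s y))" unfolding f_def s_def ..
    ultimately show ?thesis using chain[OF g, of y] by (simp only:)
  qed
  have d2: "(G i has_derivative (\<lambda>h. \<Sum>j\<in>Basis. H j i y * (h \<bullet> j))) (at y)" if "i \<in> Basis" for i y
  proof -
    have "(G i has_derivative (\<lambda>h. g1 (s y) * (2 * (h \<bullet> i)) + g2 (s y) * (2 * ((y - x) \<bullet> h)) * (2 * ((y - x) \<bullet> i)))) (at y)"
      unfolding G_def[abs_def] by (rule has_derivative_mult[OF chain[OF g1]]) (auto intro!: derivative_eq_intros)
    moreover have "g1 (s y) * (2 * (h \<bullet> i)) + g2 (s y) * (2 * ((y - x) \<bullet> h)) * (2 * ((y - x) \<bullet> i))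
        = (\<Sum>j\<in>Basis. H j i y * (h \<bullet> j))" for h
      unfolding H_def by (rule sum_bilinear_Basis[symmetric])
    ultimately show ?thesis by simp
  qed
  have cs: "continuous_on UNIV s" unfolding s_def[abs_def] by (intro continuous_intros)
  have cg1: "continuous_on {0..} g1"
    by (intro continuous_at_imp_continuous_on ballI) (use g1 DERIV_isCont in auto)
  have c: "continuous_on UNIV (\<lambda>y. k (s y))" if "continuous_on {0..} k" for k :: "real \<Rightarrow> real"
    by (rule continuous_on_compose2[OF that cs]) (use s0 in auto)
  have d3: "continuous_on UNIV (H j i)" for i j
    unfolding H_def[abs_def] by (intro continuous_intros c g2 cg1)
  note D = C2_data[where f=f and G=G and H=H, OF open_UNIV]
  have 1: "Ck_on 2 f UNIV" "\<And>i y. i \<in> Basis \<Longrightarrow> pd i f y = G i y"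
    "\<And>i j y. i \<in> Basis \<Longrightarrow> j \<in> Basis \<Longrightarrow> pd j (pd i f) y = H j i y"
    using D(1) D(2)[OF _ _ _ _ UNIV_I] D(3)[OF _ _ _ _ _ UNIV_I] d1 d2 d3 by blast+
  show "Ck_on 2 f UNIV" by (rule 1)
  show "i \<in> Basis \<Longrightarrow> pd i f y = g1 ((y - x) \<bullet> (y - x)) * (2 * ((y - x) \<bullet> i))"
    using 1(2) unfolding G_def s_def by blast
  show "i \<in> Basis \<Longrightarrow> j \<in> Basis \<Longrightarrow> pd j (pd i f) y = g2 ((y - x) \<bullet> (y - x)) * (2 * ((y - x) \<bullet> j)) * (2 * ((y - x) \<bullet> i))
      + g1 ((y - x) \<bullet> (y - x)) * (2 * (j \<bullet> i))"
    using 1(3) unfolding H_def s_def by blast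
  have gr: "grad f y = (2 * g1 (s y)) *\<^sub>R (y - x)"
    by (rule euclidean_eqI) (simp add: grad_inner_Basis 1(2) G_def)
  then show "grad f y = (2 * g1 ((y - x) \<bullet> (y - x))) *\<^sub>R (y - x)" unfolding s_def .
  have hs: "hess f y h = g2 (s y) * 4 * ((y - x) \<bullet> h)\<^sup>2 + 2 * g1 (s y) * (h \<bullet> h)" for h
  proof -
    have "hess f y h = (\<Sum>j\<in>Basis. (\<Sum>i\<in>Basis. H i j y * (h \<bullet> i)) * (h \<bullet> j))"
      unfolding hess_def by (subst sum.swap) (simp add: 1(3) sum_distrib_right sum_distrib_left mult_ac)
    also have "\<dots> = (\<Sum>j\<in>Basis. (g1 (s y) * (2 * (h \<bullet> j)) + g2 (s y) * (2 * ((y - x) \<bullet> h)) * (2 * ((y - x) \<bullet> j))) * (h \<bullet> j))"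
      unfolding H_def by (simp only: sum_bilinear_Basis)
    also have "\<dots> = g1 (s y) * 2 * (\<Sum>j\<in>Basis. (h \<bullet> j) * (h \<bullet> j)) + g2 (s y) * 4 * ((y - x) \<bullet> h) * (\<Sum>j\<in>Basis. ((y - x) \<bullet> j) * (h \<bullet> j))"
    proof -
      have "(B * (2 * b) + A * (2 * c) * (2 * d)) * b = B * 2 * (b * b) + A * 4 * c * (d * b)" for A B b c d :: real
        by (simp add: algebra_simps)
      then show ?thesis by (simp only: sum.distrib sum_distrib_left)
    qed
    finally show ?thesis unfolding sum_inner_Basis by (simp add: power2_eq_square)
  qed
  show "inf_laplacian f y = 8 * (g1 ((y - x) \<bullet> (y - x)))\<^sup>2 * ((y - x) \<bullet> (y - x))
      * (2 * g2 ((y - x) \<bullet> (y - x)) * ((y - x) \<bullet> (y - x)) + g1 ((y - x) \<bullet> (y - x)))"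
    unfolding inf_laplacian_hess gr hs inner_scaleR_left inner_scaleR_right s_def[symmetric]
    by (simp add: power2_eq_square algebra_simps)
qed

lemma Ck_on_2_subset: "Ck_on 2 f S \<Longrightarrow> T \<subseteq> S \<Longrightarrow> Ck_on 2 f T"
  unfolding Ck_on_2 by (meson continuous_on_subset subsetD)

lemma
  assumes S: "open S" and f: "Ck_on 2 f S" and g: "Ck_on 2 g S"
  shows Ck_on_add: "Ck_on 2 (\<lambda>x. f x + g x) S"
    and pd_add: "\<And>i x. i \<in> Basis \<Longrightarrow> x \<in> S \<Longrightarrow> pd i (\<lambda>x. f x + g x) x = pd i f x + pd i g x"
    and pd2_add: "\<And>i j x. i \<in> Basis \<Longrightarrow> j \<in> Basis \<Longrightarrow> x \<in> S \<Longrightarrow>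
      pd j (pd i (\<lambda>x. f x + g x)) x = pd j (pd i f) x + pd j (pd i g) x"
proof -
  have d1: "((\<lambda>x. f x + g x) has_derivative (\<lambda>h. \<Sum>i\<in>Basis. (pd i f x + pd i g x) * (h \<bullet> i))) (at x)" if "x \<in> S" for x
    using has_derivative_add[OF C2_dataD(1)[OF f that] C2_dataD(1)[OF g that]] by (simp add: sum.distrib distrib_right)
  have d2: "((\<lambda>x. pd i f x + pd i g x) has_derivative (\<lambda>h. \<Sum>j\<in>Basis. (pd j (pd i f) x + pd j (pd i g) x) * (h \<bullet> j))) (at x)"
    if "i \<in> Basis" "x \<in> S" for x i
    using has_derivative_add[OF C2_dataD(2)[OF f that] C2_dataD(2)[OF g that]] by (simp add: sum.distrib distrib_right)
  have d3: "continuous_on S (\<lambda>x. pd j (pd i f) x + pd j (pd i g) x)" if "i \<in> Basis" "j \<in> Basis" for i j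
    by (intro continuous_intros C2_dataD(3)[OF f that] C2_dataD(3)[OF g that])
  note D = C2_data[where f="\<lambda>x. f x + g x" and G="\<lambda>i x. pd i f x + pd i g x"
      and H="\<lambda>j i x. pd j (pd i f) x + pd j (pd i g) x", OF S]
  show "Ck_on 2 (\<lambda>x. f x + g x) S" "\<And>i x. i \<in> Basis \<Longrightarrow> x \<in> S \<Longrightarrow> pd i (\<lambda>x. f x + g x) x = pd i f x + pd i g x"
    "\<And>i j x. i \<in> Basis \<Longrightarrow> j \<in> Basis \<Longrightarrow> x \<in> S \<Longrightarrow>
      pd j (pd i (\<lambda>x. f x + g x)) x = pd j (pd i f) x + pd j (pd i g) x"
    by (rule D; use d1 d2 d3 in blast)+
qed

text \<open>
  Adding \<open>|y - p|\<^sup>4\<close> to a test function makes the contact point strict without changing the first and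
  second derivatives there.
\<close>

lemma strict_test_function:
  fixes p :: "'a::euclidean_space"
  assumes S: "open S" "p \<in> S" and f: "Ck_on 2 f S"
  defines "\<psi> \<equiv> \<lambda>y. f y + ((y - p) \<bullet> (y - p))\<^sup>2"
  shows "Ck_on 2 \<psi> S" "grad \<psi> p = grad f p" "inf_laplacian \<psi> p = inf_laplacian f p"
proof -
  have q: "((\<lambda>s. s\<^sup>2) has_real_derivative 2 * s) (at s)" "((\<lambda>s. 2 * s) has_real_derivative 2) (at s)" for s :: real
    by (auto intro!: derivative_eq_intros)
  let ?q = "\<lambda>y. ((y - p) \<bullet> (y - p))\<^sup>2"
  have Q: "Ck_on 2 ?q S"
    by (rule Ck_on_2_subset[OF radial_Ck_on[where g="\<lambda>s. s\<^sup>2", OF q]]) auto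
  have pq: "pd i ?q p = 0" "pd j (pd i ?q) p = 0" if "i \<in> Basis" "j \<in> Basis" for i j
    using radial_pd[where g="\<lambda>s. s\<^sup>2" and x=p and y=p, OF q _ that(1)]
      radial_pd2[where g="\<lambda>s. s\<^sup>2" and x=p and y=p, OF q _ that] by auto
  show "Ck_on 2 \<psi> S" unfolding \<psi>_def by (rule Ck_on_add[OF S(1) f Q])
  have 1: "pd i \<psi> p = pd i f p" "pd j (pd i \<psi>) p = pd j (pd i f) p" if "i \<in> Basis" "j \<in> Basis" for i j
    unfolding \<psi>_def using pd_add[OF S(1) f Q that(1) S(2)] pd2_add[OF S(1) f Q that S(2)] pq[OF that] by auto
  show "grad \<psi> p = grad f p" unfolding grad_def using 1 by (intro sum.cong) auto
  show "inf_laplacian \<psi> p = inf_laplacian f p" unfolding inf_laplacian_def using 1 by (intro sum.cong) auto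
qed

section \<open>One-sided contact and comparison with cones\<close>

lemma subsolution_touch:
  assumes \<Omega>: "open \<Omega>" "p \<in> \<Omega>" and u: "viscosity_subsolution \<Omega> u" and \<phi>: "Ck_on 2 \<phi> \<Omega>"
    and r: "0 < r" "\<And>y. y \<in> \<Omega> \<inter> ball p r \<Longrightarrow> u y - \<phi> y \<le> u p - \<phi> p"
  shows "0 \<le> inf_laplacian \<phi> p" "0 < u p \<Longrightarrow> 1 \<le> norm (grad \<phi> p)"
proof -
  define \<psi> where "\<psi> y = \<phi> y + ((y - p) \<bullet> (y - p))\<^sup>2" for y
  note \<psi> = strict_test_function[OF \<Omega> \<phi>, folded \<psi>_def]
  have "u y - \<psi> y < u p - \<psi> p" if "y \<in> \<Omega> \<inter> ball p r" "y \<noteq> p" for y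
  proof -
    have "0 < ((y - p) \<bullet> (y - p))\<^sup>2" using that(2) by simp
    moreover have "\<psi> p = \<phi> p" by (simp add: \<psi>_def)
    ultimately show ?thesis using r(2)[OF that(1)] unfolding \<psi>_def[of y] by linarith
  qed
  then have "strict_local_max_at \<Omega> (\<lambda>y. u y - \<psi> y) p"
    unfolding strict_local_max_at_def using r(1) by blast
  then have "max (- inf_laplacian \<psi> p) (indicator {y. u y > 0} p - norm (grad \<psi> p)) \<le> 0"
    using u \<Omega>(2) \<psi>(1) unfolding viscosity_subsolution_def by blast
  then show "0 \<le> inf_laplacian \<phi> p" "0 < u p \<Longrightarrow> 1 \<le> norm (grad \<phi> p)"
    unfolding \<psi>(2,3) by auto
qed

text \<open>Phrased for maxima of \<open>- w - \<phi>\<close>, so that the same smoothed cones from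
  \<open>cone_contact\<close> serve for subsolutions and, after negation, for
  supersolutions.\<close>

lemma supersolution_touch:
  assumes \<Omega>: "open \<Omega>" "p \<in> \<Omega>" and w: "viscosity_supersolution \<Omega> w" and \<phi>: "Ck_on 2 \<phi> \<Omega>"
    and r: "0 < r" "\<And>y. y \<in> \<Omega> \<inter> ball p r \<Longrightarrow> - w y - \<phi> y \<le> - w p - \<phi> p"
  shows "0 \<le> inf_laplacian \<phi> p \<or> norm (grad \<phi> p) \<le> (if 0 \<le> w p then 1 else 0)"
proof -
  define \<psi> where "\<psi> y = \<phi> y + ((y - p) \<bullet> (y - p))\<^sup>2" for y
  note \<psi> = strict_test_function[OF \<Omega> \<phi>, folded \<psi>_def]
  have "w p - - \<psi> p < w y - - \<psi> y" if "y \<in> \<Omega> \<inter> ball p r" "y \<noteq> p" for y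
  proof -
    have "0 < ((y - p) \<bullet> (y - p))\<^sup>2" using that(2) by simp
    moreover have "\<psi> p = \<phi> p" by (simp add: \<psi>_def)
    ultimately show ?thesis using r(2)[OF that(1)] unfolding \<psi>_def[of y] by linarith
  qed
  then have "strict_local_min_at \<Omega> (\<lambda>y. w y - - \<psi> y) p"
    unfolding strict_local_min_at_def using r(1) by blast
  then have "max (- inf_laplacian (\<lambda>y. - \<psi> y) p) (indicator {y. w y \<ge> 0} p - norm (grad (\<lambda>y. - \<psi> y) p)) \<ge> 0"
    using w \<Omega>(2) Ck_on_uminus[OF \<Omega>(1) \<psi>(1)] unfolding viscosity_supersolution_def by blast
  then show ?thesis
    unfolding inf_laplacian_uminus[OF \<Omega>(1) \<psi>(1) \<Omega>(2)] grad_uminus[OF \<Omega>(1) \<psi>(1) \<Omega>(2)] \<psi>(2,3)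
    by (auto simp: indicator_def le_max_iff_disj)
qed

lemma smoothed_cone:
  fixes k a \<beta> :: real
  assumes "0 < a" and "0 \<le> s"
  shows "((\<lambda>s. k * sqrt (s + a\<^sup>2) - \<beta> * s) has_real_derivative k / (2 * sqrt (s + a\<^sup>2)) - \<beta>) (at s)"
    and "((\<lambda>s. k / (2 * sqrt (s + a\<^sup>2)) - \<beta>) has_real_derivative - k / (4 * (s + a\<^sup>2) * sqrt (s + a\<^sup>2))) (at s)"
    and "continuous_on {0..} (\<lambda>s. - k / (4 * (s + a\<^sup>2) * sqrt (s + a\<^sup>2)))"
proof -
  have pos: "0 < t + a\<^sup>2" if "0 \<le> t" for t using assms(1) that by (simp add: add_nonneg_pos)
  note p = pos[OF assms(2)]
  have sq: "sqrt (s + a\<^sup>2) * sqrt (s + a\<^sup>2) = s + a\<^sup>2" using p by simp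
  show "((\<lambda>s. k * sqrt (s + a\<^sup>2) - \<beta> * s) has_real_derivative k / (2 * sqrt (s + a\<^sup>2)) - \<beta>) (at s)"
    using p by (auto intro!: derivative_eq_intros simp: field_simps)
  have "((\<lambda>s. k / (2 * sqrt (s + a\<^sup>2)) - \<beta>) has_real_derivative
      (0 * (2 * sqrt (s + a\<^sup>2)) - k * (2 * (inverse (sqrt (s + a\<^sup>2)) / 2))) / ((2 * sqrt (s + a\<^sup>2)) * (2 * sqrt (s + a\<^sup>2))) - 0) (at s)"
    using p by (auto intro!: derivative_eq_intros)
  moreover have "(0 * (2 * sqrt (s + a\<^sup>2)) - k * (2 * (inverse (sqrt (s + a\<^sup>2)) / 2))) / ((2 * sqrt (s + a\<^sup>2)) * (2 * sqrt (s + a\<^sup>2))) - 0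
      = - k / (4 * (s + a\<^sup>2) * sqrt (s + a\<^sup>2))"
    using p sq by (simp add: field_simps)
  ultimately show "((\<lambda>s. k / (2 * sqrt (s + a\<^sup>2)) - \<beta>) has_real_derivative - k / (4 * (s + a\<^sup>2) * sqrt (s + a\<^sup>2))) (at s)"
    by (simp only:)
  show "continuous_on {0..} (\<lambda>s. - k / (4 * (s + a\<^sup>2) * sqrt (s + a\<^sup>2)))"
    using pos by (intro continuous_intros) (auto simp: less_imp_neq[symmetric], (smt (verit) pos)+)
qed

text \<open>
  The test function \<open>k * sqrt (|y - x|\<^sup>2 + a\<^sup>2) - \<beta> * |y - x|\<^sup>2\<close> is a smooth perturbation of the cone,
  strictly concave in the radial direction away from the vertex; \<open>a\<close> is chosen small depending
  on \<open>\<beta>\<close>.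
\<close>

lemma cone_contact:
  fixes f :: "'a::euclidean_space \<Rightarrow> real"
  assumes R: "0 < R" and f: "continuous_on (cball x R) f" and k: "0 \<le> \<kappa>" "\<kappa> < k"
    and sphere: "\<And>y. dist x y = R \<Longrightarrow> f y \<le> f x + k * R"
    and y0: "y0 \<in> cball x R" "f x + k * dist x y0 < f y0"
  shows "\<exists>\<phi> p. Ck_on 2 \<phi> UNIV \<and> p \<in> ball x R \<and> (\<forall>y\<in>cball x R. f y - \<phi> y \<le> f p - \<phi> p) \<and>
    inf_laplacian \<phi> p < 0 \<and> \<kappa> < norm (grad \<phi> p)"
proof -
  define \<eta> where "\<eta> = f y0 - f x - k * dist x y0"
  have \<eta>: "0 < \<eta>" using y0(2) unfolding \<eta>_def by simp
  have k0: "0 < k" using k by simp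
  \<comment> \<open>Within \<open>r0\<close> of the vertex \<open>f\<close> is too low for a maximum
    of \<open>f - \<phi>\<close>, so the contact point avoids the region where smoothing distorts
    the cone.\<close>
  obtain r0 where r0: "0 < r0" "\<And>y. y \<in> cball x R \<Longrightarrow> dist y x < r0 \<Longrightarrow> f y < f x + \<eta> / 4"
  proof -
    have "x \<in> cball x R" using R by simp
    then obtain d where d: "0 < d" "\<And>y. y \<in> cball x R \<Longrightarrow> dist y x < d \<Longrightarrow> dist (f y) (f x) < \<eta> / 4"
      using f \<eta> unfolding continuous_on_iff by (metis divide_pos_pos zero_less_numeral)
    have "f y < f x + \<eta> / 4" if "y \<in> cball x R" "dist y x < d" for y
      using d(2)[OF that] unfolding dist_real_def by linarith
    then show thesis using d(1) that by blast
  qed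
  \<comment> \<open>The quadratic term may use up neither the height \<open>\<eta>\<close> nor the
    excess \<open>k - \<kappa>\<close> of the slope.\<close>
  define \<beta> where "\<beta> = min (\<eta> / (4 * R\<^sup>2)) ((k - \<kappa>) / (8 * R))"
  have \<beta>: "0 < \<beta>" using \<eta> R k unfolding \<beta>_def by simp
  have "\<beta> \<le> \<eta> / (4 * R\<^sup>2)" unfolding \<beta>_def by (rule min.cobounded1)
  then have \<beta>1: "\<beta> * R\<^sup>2 \<le> \<eta> / 4" using R by (simp add: field_simps)
  have "\<beta> \<le> (k - \<kappa>) / (8 * R)" unfolding \<beta>_def by (rule min.cobounded2)
  then have \<beta>2: "2 * \<beta> * R \<le> (k - \<kappa>) / 4" using R by (simp add: field_simps)
  \<comment> \<open>The entries control in turn the height lost by smoothing, the slope lost beyond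
    radius \<open>r0\<close>, and the radial convexity due to smoothing against the concavity from
    \<open>\<beta>\<close>.\<close>
  define a where "a = Min {\<eta> / (4 * k), (k - \<kappa>) * r0 / (4 * k), sqrt (\<beta> * r0 ^ 3 / k)}"
  have a: "0 < a" unfolding a_def using \<eta> k k0 r0(1) \<beta> by simp
  have a': "a \<le> \<eta> / (4 * k)" "a \<le> (k - \<kappa>) * r0 / (4 * k)" "a \<le> sqrt (\<beta> * r0 ^ 3 / k)"
    unfolding a_def by (rule Min_le; simp)+
  have a1: "k * a \<le> \<eta> / 4" using a'(1) k0 by (simp add: field_simps)
  have a2: "k * a \<le> (k - \<kappa>) * r0 / 4" using a'(2) k0 by (simp add: field_simps)
  have "a\<^sup>2 \<le> \<beta> * r0 ^ 3 / k" using power_mono[OF a'(3), of 2] a \<beta> r0(1) k0 by simp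
  then have a3: "k * a\<^sup>2 \<le> \<beta> * r0 ^ 3" using k0 by (simp add: field_simps)
  define g where "g s = k * sqrt (s + a\<^sup>2) - \<beta> * s" for s
  define g1 where "g1 s = k / (2 * sqrt (s + a\<^sup>2)) - \<beta>" for s
  define g2 where "g2 s = - k / (4 * (s + a\<^sup>2) * sqrt (s + a\<^sup>2))" for s
  define \<phi> where "\<phi> y = g ((y - x) \<bullet> (y - x))" for y
  have sm: "(g has_real_derivative g1 s) (at s)" "(g1 has_real_derivative g2 s) (at s)" if "0 \<le> s" for s
    using smoothed_cone(1,2)[OF a that, of k \<beta>] unfolding g_def[abs_def] g1_def[abs_def] g2_def by auto
  have sm3: "continuous_on {0..} g2"
    using smoothed_cone(3)[OF a order_refl] unfolding g2_def[abs_def] .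
  have \<phi>_eq: "\<phi> = (\<lambda>y. g ((y - x) \<bullet> (y - x)))" unfolding \<phi>_def ..
  have rad: "Ck_on 2 \<phi> UNIV" "\<And>y. grad \<phi> y = (2 * g1 ((y - x) \<bullet> (y - x))) *\<^sub>R (y - x)"
    "\<And>y. inf_laplacian \<phi> y = 8 * (g1 ((y - x) \<bullet> (y - x)))\<^sup>2 * ((y - x) \<bullet> (y - x))
      * (2 * g2 ((y - x) \<bullet> (y - x)) * ((y - x) \<bullet> (y - x)) + g1 ((y - x) \<bullet> (y - x)))"
    unfolding \<phi>_eq by (rule radial_Ck_on[OF _ _ sm3] radial_grad[OF _ _ sm3] radial_inf_laplacian[OF _ _ sm3]; use sm in blast)+
  have \<phi>r: "\<phi> y = k * sqrt ((dist x y)\<^sup>2 + a\<^sup>2) - \<beta> * (dist x y)\<^sup>2" for y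
    unfolding \<phi>_def g_def by (simp add: power2_norm_eq_inner[symmetric] dist_norm norm_minus_commute)
  have sq: "t \<le> sqrt (t\<^sup>2 + a\<^sup>2)" "sqrt (t\<^sup>2 + a\<^sup>2) \<le> t + a" if "0 \<le> t" for t
    using that a sqrt_add_le_add_sqrt[of "t\<^sup>2" "a\<^sup>2"] real_sqrt_le_mono[of "t\<^sup>2" "t\<^sup>2 + a\<^sup>2"] by auto
  have up: "k * dist x y - \<beta> * R\<^sup>2 \<le> \<phi> y" if "y \<in> cball x R" for y
  proof -
    have "\<beta> * (dist x y)\<^sup>2 \<le> \<beta> * R\<^sup>2" using that \<beta> by (intro mult_left_mono power_mono) auto
    moreover have "k * dist x y \<le> k * sqrt ((dist x y)\<^sup>2 + a\<^sup>2)" using sq(1)[of "dist x y"] k0 by (intro mult_left_mono) auto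
    ultimately show ?thesis unfolding \<phi>r by linarith
  qed
  have "continuous_on (cball x R) (\<lambda>y. f y - \<phi> y)"
    by (intro continuous_intros f continuous_on_subset[OF Ck_on_2_continuous[OF rad(1)]]) auto
  then obtain p where p: "p \<in> cball x R" "\<And>y. y \<in> cball x R \<Longrightarrow> f y - \<phi> y \<le> f p - \<phi> p"
    using continuous_attains_sup[of "cball x R" "\<lambda>y. f y - \<phi> y"] R by auto
  have "k * sqrt ((dist x y0)\<^sup>2 + a\<^sup>2) \<le> k * (dist x y0 + a)" using sq(2)[of "dist x y0"] k0 by (intro mult_left_mono) auto
  moreover have "0 \<le> \<beta> * (dist x y0)\<^sup>2" using \<beta> by simp
  ultimately have "f x + \<eta> - k * a \<le> f y0 - \<phi> y0" unfolding \<phi>r \<eta>_def by (simp add: algebra_simps)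
  then have pv: "f x + \<eta> * 3 / 4 \<le> f p - \<phi> p" using p(2)[OF y0(1)] a1 by linarith
  have "r0 \<le> dist x p"
  proof (rule ccontr)
    assume "\<not> ?thesis"
    then have "f p < f x + \<eta> / 4" using r0(2)[OF p(1)] by (simp add: dist_commute)
    moreover have "0 \<le> k * dist x p" using k0 by simp
    ultimately show False using pv up[OF p(1)] \<beta>1 \<eta> by linarith
  qed
  have "dist x p \<noteq> R"
  proof
    assume "dist x p = R"
    then show False using sphere[of p] pv up[OF p(1)] \<beta>1 \<eta> by simp
  qed
  then have pR: "dist x p < R" using p(1) by simp
  define r where "r = dist x p"
  have r: "r0 \<le> r" "0 < r" "r < R" using \<open>r0 \<le> dist x p\<close> r0(1) pR unfolding r_def by auto
  have s: "(p - x) \<bullet> (p - x) = r\<^sup>2" unfolding r_def by (simp add: power2_norm_eq_inner[symmetric] dist_norm norm_minus_commute)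
  define q where "q = sqrt (r\<^sup>2 + a\<^sup>2)"
  have q: "0 < q" "q\<^sup>2 = r\<^sup>2 + a\<^sup>2" "r \<le> q" "q \<le> r + a"
    using sq[of r] r a unfolding q_def by (auto simp: add_pos_pos)
  have slope: "\<kappa> < 2 * g1 (r\<^sup>2) * r"
  proof -
    have "k * q - k * r \<le> k * a" using q(4) k0 mult_left_mono[of "q - r" a k] by (simp add: algebra_simps)
    also have "\<dots> \<le> (k - \<kappa>) * r0 / 4" by (rule a2)
    also have "\<dots> \<le> (k - \<kappa>) * q / 4" using r q k by (intro divide_right_mono mult_left_mono) auto
    finally have "k - k * r / q \<le> (k - \<kappa>) / 4" using q(1) by (simp add: field_simps)
    moreover have "2 * \<beta> * r \<le> 2 * \<beta> * R" using r \<beta> by (intro mult_left_mono) auto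
    moreover have "2 * g1 (r\<^sup>2) * r = k * r / q - 2 * \<beta> * r"
      unfolding g1_def q_def[symmetric] using q(1) by (simp add: field_simps)
    ultimately show ?thesis using \<beta>2 k by argo
  qed
  have g1pos: "0 < g1 (r\<^sup>2)"
  proof (rule ccontr)
    assume "\<not> ?thesis"
    then have "2 * g1 (r\<^sup>2) * r \<le> 0" using r(2) by (simp add: mult_nonpos_nonneg)
    then show False using slope k(1) by linarith
  qed
  have "2 * g2 (r\<^sup>2) * r\<^sup>2 + g1 (r\<^sup>2) < 0"
  proof -
    have "2 * g2 (r\<^sup>2) * r\<^sup>2 + g1 (r\<^sup>2) = k * a\<^sup>2 / (2 * q ^ 3) - \<beta>"
    proof -
      have gg: "g2 (r\<^sup>2) = - k / (4 * q ^ 3)" "g1 (r\<^sup>2) = k * q\<^sup>2 / (2 * q ^ 3) - \<beta>"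
        unfolding g2_def g1_def q_def[symmetric] q(2)[symmetric] using q(1)
        by (auto simp: power2_eq_square power3_eq_cube field_simps)
      have "2 * g2 (r\<^sup>2) * r\<^sup>2 + g1 (r\<^sup>2) = k * (q\<^sup>2 - r\<^sup>2) / (2 * q ^ 3) - \<beta>"
        unfolding gg using q(1) by (simp add: field_simps)
      then show ?thesis unfolding q(2) by simp
    qed
    moreover have "k * a\<^sup>2 < \<beta> * (2 * q ^ 3)"
    proof -
      have "r0 ^ 3 \<le> q ^ 3" using r0(1) r q by (intro power_mono) auto
      then have "\<beta> * r0 ^ 3 \<le> \<beta> * q ^ 3" using \<beta> by (intro mult_left_mono) auto
      moreover have "0 < \<beta> * q ^ 3" using \<beta> q by simp
      ultimately show ?thesis using a3 by linarith
    qed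
    then have "k * a\<^sup>2 / (2 * q ^ 3) < \<beta>" using q(1) by (simp add: pos_divide_less_eq)
    ultimately show ?thesis by simp
  qed
  then have "inf_laplacian \<phi> p < 0"
    unfolding rad(3) s using g1pos r(2) by (intro mult_pos_neg) auto
  moreover have "norm (grad \<phi> p) = 2 * g1 (r\<^sup>2) * r"
    unfolding rad(2) s using g1pos by (simp add: r_def dist_norm norm_minus_commute)
  ultimately show ?thesis using rad(1) p pR slope by (intro exI[of _ \<phi>] exI[of _ p]) auto
qed

text \<open>With \<open>\<kappa> = 0\<close> in \<open>cone_contact\<close>, a point above the cone
  would produce a contact point where the test function has negative infinity Laplacian.\<close>

lemma subsolution_cone:
  assumes \<Omega>: "open \<Omega>" and u: "viscosity_subsolution \<Omega> u" "continuous_on \<Omega> u"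
    and R: "0 < R" "cball x R \<subseteq> \<Omega>" and k: "0 < k"
    and sphere: "\<And>y. dist x y = R \<Longrightarrow> u y \<le> u x + k * R" and y: "y \<in> cball x R"
  shows "u y \<le> u x + k * dist x y"
proof (rule ccontr)
  assume "\<not> ?thesis"
  then have "u x + k * dist x y < u y" by simp
  from cone_contact[OF R(1) continuous_on_subset[OF u(2) R(2)] order_refl k sphere y this]
  obtain \<phi> p where p: "Ck_on 2 \<phi> UNIV" "p \<in> ball x R" "\<And>y. y \<in> cball x R \<Longrightarrow> u y - \<phi> y \<le> u p - \<phi> p"
    "inf_laplacian \<phi> p < 0" by blast
  obtain r where r: "0 < r" "ball p r \<subseteq> cball x R"
    using p(2) open_contains_ball open_ball ball_subset_cball by (metis order_trans)
  have "p \<in> \<Omega>" using p(2) R(2) by auto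
  from subsolution_touch(1)[OF \<Omega> this u(1) Ck_on_2_subset[OF p(1)] r(1)] have "0 \<le> inf_laplacian \<phi> p"
    using p(3) r(2) by blast
  then show False using p(4) by simp
qed

text \<open>A supersolution may violate the Laplacian condition where it is nonnegative and the
  gradient is at most 1. Cones from below are therefore available only with slope above 1 or where
  the function is negative, and \<open>cone_contact\<close> is used with \<open>\<kappa>\<close>
  equal to 1 or 0 accordingly.\<close>

lemma supersolution_cone:
  assumes \<Omega>: "open \<Omega>" and w: "viscosity_supersolution \<Omega> w" "continuous_on \<Omega> w"
    and R: "0 < R" "cball x R \<subseteq> \<Omega>" and k: "0 < k" and alt: "1 < k \<or> (\<forall>y\<in>cball x R. w y < 0)"
    and sphere: "\<And>y. dist x y = R \<Longrightarrow> w x - k * R \<le> w y" and y: "y \<in> cball x R"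
  shows "w x - k * dist x y \<le> w y"
proof (rule ccontr)
  assume "\<not> ?thesis"
  then have "- w x + k * dist x y < - w y" by simp
  define \<kappa> where "\<kappa> = (if 1 < k then 1 else 0 :: real)"
  have \<kappa>: "0 \<le> \<kappa>" "\<kappa> < k" using k unfolding \<kappa>_def by auto
  have "continuous_on (cball x R) (\<lambda>y. - w y)"
    by (intro continuous_intros continuous_on_subset[OF w(2) R(2)])
  then have "\<exists>\<phi> p. Ck_on 2 \<phi> UNIV \<and> p \<in> ball x R \<and> (\<forall>y\<in>cball x R. - w y - \<phi> y \<le> - w p - \<phi> p) \<and>
    inf_laplacian \<phi> p < 0 \<and> \<kappa> < norm (grad \<phi> p)"
    by (rule cone_contact[OF R(1) _ \<kappa> _ y \<open>- w x + k * dist x y < - w y\<close>]) (use sphere in force)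
  then obtain \<phi> p where p: "Ck_on 2 \<phi> UNIV" "p \<in> ball x R" "\<And>y. y \<in> cball x R \<Longrightarrow> - w y - \<phi> y \<le> - w p - \<phi> p"
    "inf_laplacian \<phi> p < 0" "\<kappa> < norm (grad \<phi> p)" by blast
  obtain r where r: "0 < r" "ball p r \<subseteq> cball x R"
    using p(2) open_contains_ball open_ball ball_subset_cball by (metis order_trans)
  have p\<Omega>: "p \<in> \<Omega>" using p(2) R(2) by auto
  have "0 \<le> inf_laplacian \<phi> p \<or> norm (grad \<phi> p) \<le> (if 0 \<le> w p then 1 else 0)"
    by (rule supersolution_touch[OF \<Omega> p\<Omega> w(1) Ck_on_2_subset[OF p(1)] r(1)])
      (use p(3) r(2) in blast)+
  moreover have "(if 0 \<le> w p then 1 else 0) \<le> \<kappa>"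
  proof (cases "1 < k")
    case False
    then have "w p < 0" using alt p(2) by auto
    then show ?thesis using \<kappa>(1) by simp
  qed (simp add: \<kappa>_def)
  ultimately show False using p(4,5) by linarith
qed

text \<open>If the growth fell short of \<open>R\<close>, a smoothed cone of slope below 1 centred
  at \<open>z\<close> would, up to a constant, touch \<open>u\<close> from above inside the ball.
  The cone is minimal at \<open>z\<close>, so \<open>u\<close> is positive at the contact point, and
  the gradient inequality fails there.\<close>

lemma subsolution_growth:
  assumes \<Omega>: "open \<Omega>" and u: "viscosity_subsolution \<Omega> u" "continuous_on \<Omega> u"
    and R: "0 < R" "cball z R \<subseteq> \<Omega>" and pos: "0 < u z"
  shows "\<exists>y\<in>cball z R. u z + R \<le> u y"
proof (rule ccontr)
  assume neg: "\<not> ?thesis"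
  have cu: "continuous_on (cball z R) u" by (rule continuous_on_subset[OF u(2) R(2)])
  obtain m where m: "m \<in> cball z R" "\<And>y. y \<in> cball z R \<Longrightarrow> u y \<le> u m"
    using continuous_attains_sup[OF compact_cball _ cu] R(1) by auto
  define gap where "gap = u z + R - u m"
  have gap: "0 < gap" using neg m(1) unfolding gap_def by force
  \<comment> \<open>Slope \<open>1 - t\<close> and smoothing radius \<open>t * R\<close> together
    cost at most \<open>2 * t * R\<close> on the sphere, which is at most half of the gap.\<close>
  define t where "t = min (1 / 2) (gap / (4 * R))"
  have t: "0 < t" "t \<le> 1 / 2" using gap R(1) unfolding t_def by auto
  have "t \<le> gap / (4 * R)" unfolding t_def by (rule min.cobounded2)
  then have tR: "4 * t * R \<le> gap" using R(1) by (simp add: field_simps)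
  define c where "c = 1 - t"
  define a where "a = t * R"
  have c: "0 < c" "c < 1" and a: "0 < a" using t R(1) unfolding c_def a_def by auto
  define g where "g s = c * sqrt (s + a\<^sup>2) - 0 * s" for s
  define g1 where "g1 s = c / (2 * sqrt (s + a\<^sup>2)) - 0" for s
  define g2 where "g2 s = - c / (4 * (s + a\<^sup>2) * sqrt (s + a\<^sup>2))" for s
  define \<phi> where "\<phi> y = g ((y - z) \<bullet> (y - z))" for y
  have sm: "(g has_real_derivative g1 s) (at s)" "(g1 has_real_derivative g2 s) (at s)" if "0 \<le> s" for s
    using smoothed_cone(1,2)[OF a that, of c 0] unfolding g_def[abs_def] g1_def[abs_def] g2_def by auto
  have sm3: "continuous_on {0..} g2"
    using smoothed_cone(3)[OF a order_refl] unfolding g2_def[abs_def] .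
  have \<phi>_eq: "\<phi> = (\<lambda>y. g ((y - z) \<bullet> (y - z)))" unfolding \<phi>_def ..
  have rad: "Ck_on 2 \<phi> UNIV" "\<And>y. grad \<phi> y = (2 * g1 ((y - z) \<bullet> (y - z))) *\<^sub>R (y - z)"
    "\<And>y. inf_laplacian \<phi> y = 8 * (g1 ((y - z) \<bullet> (y - z)))\<^sup>2 * ((y - z) \<bullet> (y - z))
      * (2 * g2 ((y - z) \<bullet> (y - z)) * ((y - z) \<bullet> (y - z)) + g1 ((y - z) \<bullet> (y - z)))"
    unfolding \<phi>_eq by (rule radial_Ck_on[OF _ _ sm3] radial_grad[OF _ _ sm3] radial_inf_laplacian[OF _ _ sm3]; use sm in blast)+
  have \<phi>r: "\<phi> y = c * sqrt ((dist z y)\<^sup>2 + a\<^sup>2)" for y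
    unfolding \<phi>_def g_def by (simp add: power2_norm_eq_inner[symmetric] dist_norm norm_minus_commute)
  have \<phi>z: "\<phi> z = c * a" unfolding \<phi>r using a by simp
  have \<phi>lo: "c * a \<le> \<phi> y" "c * dist z y \<le> \<phi> y" for y
    unfolding \<phi>r using c a real_sqrt_le_mono[of "a\<^sup>2" "(dist z y)\<^sup>2 + a\<^sup>2"]
      real_sqrt_le_mono[of "(dist z y)\<^sup>2" "(dist z y)\<^sup>2 + a\<^sup>2"] by auto
  have "continuous_on (cball z R) (\<lambda>y. u y - \<phi> y)"
    by (intro continuous_intros cu continuous_on_subset[OF Ck_on_2_continuous[OF rad(1)]]) auto
  then obtain p where p: "p \<in> cball z R" "\<And>y. y \<in> cball z R \<Longrightarrow> u y - \<phi> y \<le> u p - \<phi> p"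
    using continuous_attains_sup[of "cball z R" "\<lambda>y. u y - \<phi> y"] R(1) by auto
  have zp: "u z - c * a \<le> u p - \<phi> p" using p(2)[of z] R(1) \<phi>z by simp
  have "dist z p \<noteq> R"
  proof
    assume "dist z p = R"
    then have "u z - c * a \<le> u m - c * R" using zp \<phi>lo(2)[of p] m(2)[OF p(1)] by simp
    then have "gap \<le> R - c * (R - a)" unfolding gap_def by (simp add: algebra_simps)
    also have "R - c * (R - a) = 2 * t * R - t * t * R" unfolding c_def a_def by (simp add: algebra_simps)
    also have "\<dots> \<le> 2 * t * R" using R(1) by simp
    finally show False using tR gap t R(1) by simp
  qed
  then have pR: "p \<in> ball z R" using p(1) by simp
  obtain r where r: "0 < r" "ball p r \<subseteq> cball z R"
    using pR open_contains_ball open_ball ball_subset_cball by (metis order_trans)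
  have "0 < u p" using zp \<phi>lo(1)[of p] pos by linarith
  have p\<Omega>: "p \<in> \<Omega>" using p(1) R(2) by auto
  have "1 \<le> norm (grad \<phi> p)"
    by (rule subsolution_touch(2)[OF \<Omega> p\<Omega> u(1) Ck_on_2_subset[OF rad(1)] r(1) _ \<open>0 < u p\<close>])
      (use p(2) r(2) in blast)+
  moreover have "norm (grad \<phi> p) = c * (dist z p / sqrt ((dist z p)\<^sup>2 + a\<^sup>2))"
    unfolding rad(2) g1_def using c
    by (simp add: power2_norm_eq_inner[symmetric] dist_norm norm_minus_commute)
  moreover have "dist z p / sqrt ((dist z p)\<^sup>2 + a\<^sup>2) \<le> 1"
  proof -
    have "dist z p \<le> sqrt ((dist z p)\<^sup>2 + a\<^sup>2)"
      using real_sqrt_le_mono[of "(dist z p)\<^sup>2" "(dist z p)\<^sup>2 + a\<^sup>2"] by simp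
    moreover have "0 < (dist z p)\<^sup>2 + a\<^sup>2" using a by (simp add: add_nonneg_pos)
    ultimately show ?thesis by (simp add: divide_le_eq_1)
  qed
  then have "c * (dist z p / sqrt ((dist z p)\<^sup>2 + a\<^sup>2)) \<le> c * 1" using c by (intro mult_left_mono) auto
  ultimately show False using c by simp
qed

subsection \<open>Convergence\<close>

definition ball_max :: "real \<Rightarrow> ('a::euclidean_space \<Rightarrow> real) \<Rightarrow> 'a \<Rightarrow> real" where
  "ball_max \<epsilon> u x = (SUP y\<in>cball x \<epsilon>. u y)"

lemma ball_max_attained:
  assumes "0 \<le> \<epsilon>" "continuous_on (cball x \<epsilon>) u"
  shows "\<exists>z\<in>cball x \<epsilon>. ball_max \<epsilon> u x = u z \<and> (\<forall>y\<in>cball x \<epsilon>. u y \<le> u z)"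
proof -
  obtain z where z: "z \<in> cball x \<epsilon>" "\<And>y. y \<in> cball x \<epsilon> \<Longrightarrow> u y \<le> u z"
    using continuous_attains_sup[OF compact_cball _ assms(2)] assms(1) by auto
  then have "ball_max \<epsilon> u x = u z"
    unfolding ball_max_def by (intro cSup_eq_maximum) auto
  then show ?thesis using z by blast
qed

lemma cball_double:
  assumes "y \<in> cball x \<epsilon>" shows "cball y \<epsilon> \<subseteq> cball x (2 * \<epsilon>)"
proof
  fix z assume "z \<in> cball y \<epsilon>"
  then show "z \<in> cball x (2 * \<epsilon>)" using assms dist_triangle[of x z y] by simp
qed

text \<open>A point at distance less than \<open>2 * \<epsilon>\<close> from \<open>x\<close> lies
  within \<open>\<epsilon>\<close> of its midpoint with \<open>x\<close>, and continuity adds the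
  sphere. Thus the open balls of the operator and the closed balls of \<open>ball_max\<close>
  combine to the full closed ball of radius \<open>2 * \<epsilon>\<close>.\<close>

lemma max_ball_eq:
  assumes e: "0 < \<epsilon>" and u: "continuous_on (cball x (2 * \<epsilon>)) u"
    and y: "y \<in> cball x (2 * \<epsilon>)" and b: "\<And>m. m \<in> ball x \<epsilon> \<Longrightarrow> ball_max \<epsilon> u m \<le> b"
  shows "u y \<le> b"
proof -
  have *: "u y \<le> b" if "y \<in> ball x (2 * \<epsilon>)" for y
  proof -
    let ?m = "x + (1 / 2) *\<^sub>R (y - x)"
    have "dist x ?m = dist x y / 2" by (simp add: dist_norm norm_minus_commute)
    then have m: "?m \<in> ball x \<epsilon>" using that by simp
    have "y - ?m = (1 / 2) *\<^sub>R (y - x)" by (simp add: algebra_simps) (simp add: scaleR_add_left[symmetric])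
    then have "dist ?m y = dist x y / 2" by (simp add: dist_norm norm_minus_commute)
    then have "y \<in> cball ?m \<epsilon>" using that by simp
    moreover have "continuous_on (cball ?m \<epsilon>) u"
      by (rule continuous_on_subset[OF u cball_double]) (use m in auto)
    ultimately show ?thesis using ball_max_attained[of \<epsilon> ?m u] b[OF m] e by force
  qed
  have cl: "closure (ball x (2 * \<epsilon>)) = cball x (2 * \<epsilon>)" using e by simp
  show ?thesis
    by (rule continuous_le_on_closure[of "ball x (2 * \<epsilon>)" u]) (use u y * cl in auto)
qed

lemma ball_max_bounded:
  assumes "0 < \<epsilon>" "continuous_on (cball x (2 * \<epsilon>)) u"
  shows "\<exists>B. \<forall>y\<in>ball x \<epsilon>. \<bar>ball_max \<epsilon> u y\<bar> \<le> B"
proof -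
  obtain B where B: "\<And>y. y \<in> cball x (2 * \<epsilon>) \<Longrightarrow> \<bar>u y\<bar> \<le> B"
    using continuous_bounded_cball[OF assms(2)] by blast
  have "\<bar>ball_max \<epsilon> u y\<bar> \<le> B" if y: "y \<in> ball x \<epsilon>" for y
  proof -
    have sub: "cball y \<epsilon> \<subseteq> cball x (2 * \<epsilon>)" by (rule cball_double) (use y in auto)
    obtain z where "z \<in> cball y \<epsilon>" "ball_max \<epsilon> u y = u z"
      using ball_max_attained[of \<epsilon> y u] continuous_on_subset[OF assms(2) sub] assms(1) by auto
    then show ?thesis using B[of z] sub by auto
  qed
  then show ?thesis by blast
qed

text \<open>A cone with vertex \<open>x\<close> and the height \<open>bsup\<close> on the sphere of
  radius \<open>2 * \<epsilon>\<close> is at most halfway up at the maximum point \<open>z\<close>,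
  and \<open>u x\<close> is below the ball maximum of every neighbour; this is the average. The
  paying branch is \<open>subsolution_growth\<close> at \<open>z\<close>, whose ball of radius
  \<open>\<epsilon>\<close> still lies in the larger ball.\<close>

lemma discrete_subsolution:
  fixes u :: "'a::euclidean_space \<Rightarrow> real"
  assumes \<Omega>: "open \<Omega>" and u: "viscosity_subsolution \<Omega> u" "continuous_on \<Omega> u"
    and e: "0 < \<epsilon>" and x: "cball x (2 * \<epsilon>) \<subseteq> \<Omega>"
  shows "ball_max \<epsilon> u x \<le> dpp \<epsilon> (ball_max \<epsilon> u) x"
proof -
  have cu: "continuous_on (cball x (2 * \<epsilon>)) u" by (rule continuous_on_subset[OF u(2) x])
  have near: "cball y \<epsilon> \<subseteq> cball x (2 * \<epsilon>)" if "y \<in> ball x \<epsilon>" for y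
    by (rule cball_double) (use that in auto)
  obtain B where B: "\<And>y. y \<in> ball x \<epsilon> \<Longrightarrow> \<bar>ball_max \<epsilon> u y\<bar> \<le> B"
    using ball_max_bounded[OF e cu] by blast
  let ?S = "bsup \<epsilon> (ball_max \<epsilon> u) x"
  have S: "u y \<le> ?S" if "y \<in> cball x (2 * \<epsilon>)" for y
    by (rule max_ball_eq[OF e cu that]) (rule bsup_upper[of x \<epsilon> "ball_max \<epsilon> u" B], use B in auto)
  have I: "u x \<le> binf \<epsilon> (ball_max \<epsilon> u) x"
  proof (rule binf_greatest[OF e])
    fix y assume y: "y \<in> ball x \<epsilon>"
    then have "x \<in> cball y \<epsilon>" by (auto simp: dist_commute)
    then show "u x \<le> ball_max \<epsilon> u y"
      using ball_max_attained[of \<epsilon> y u] continuous_on_subset[OF cu near[OF y]] e by force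
  qed
  obtain z where z: "z \<in> cball x \<epsilon>" "ball_max \<epsilon> u x = u z"
    using ball_max_attained[of \<epsilon> x u] continuous_on_subset[OF cu near[of x]] e by auto
  have z2: "z \<in> cball x (2 * \<epsilon>)" using z(1) e by auto
  have xS: "u x \<le> ?S" by (rule S) (use e in auto)
  have "u z \<le> (?S + u x) / 2 + m" if m: "0 < m" for m
  proof -
    \<comment> \<open>The summand \<open>m\<close> keeps the slope positive even if
      \<open>?S\<close> equals \<open>u x\<close>.\<close>
    define k where "k = (?S - u x + m) / (2 * \<epsilon>)"
    have k: "0 < k" "k * (2 * \<epsilon>) = ?S - u x + m" using xS m e unfolding k_def by auto
    have sphere: "u y \<le> u x + k * (2 * \<epsilon>)" if "dist x y = 2 * \<epsilon>" for y
    proof -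
      have "y \<in> cball x (2 * \<epsilon>)" using that by simp
      from S[OF this] show ?thesis using k(2) m by linarith
    qed
    have "u z \<le> u x + k * dist x z"
      by (rule subsolution_cone[OF \<Omega> u _ x k(1) sphere z2]) (use e in auto)
    also have "k * dist x z \<le> k * \<epsilon>" using z(1) k(1) by (intro mult_left_mono) auto
    finally show ?thesis using k(2) m by (simp add: field_simps)
  qed
  then have "u z \<le> (?S + u x) / 2" by (rule field_le_epsilon)
  then have "ball_max \<epsilon> u x \<le> (?S + binf \<epsilon> (ball_max \<epsilon> u) x) / 2" using I z(2) by argo
  moreover have "ball_max \<epsilon> u x \<le> max 0 (?S - \<epsilon>)"
  proof (cases "0 < u z")
    case True
    have "cball z \<epsilon> \<subseteq> cball x (2 * \<epsilon>)" by (rule cball_double[OF z(1)])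
    then obtain y where "y \<in> cball x (2 * \<epsilon>)" "u z + \<epsilon> \<le> u y"
      using subsolution_growth[OF \<Omega> u e _ True] x by blast
    then show ?thesis using S[of y] z(2) by auto
  qed (use z(2) in auto)
  ultimately show ?thesis unfolding dpp_def by simp
qed

text \<open>Cones from below give the tug-of-war branch if \<open>w\<close> is negative on the ball
  or their slope exceeds 1. If \<open>w\<close> is nonnegative somewhere on the ball, the
  oscillation bound \<open>c\<close> makes \<open>W x\<close> nonnegative. Then either the paying
  branch holds, or \<open>w\<close> drops by more than \<open>\<epsilon>\<close> from
  \<open>x\<close> to its minimum point and the slope exceeds 1 after all.\<close>

lemma discrete_supersolution:
  fixes w :: "'a::euclidean_space \<Rightarrow> real"
  assumes \<Omega>: "open \<Omega>" and w: "viscosity_supersolution \<Omega> w" "continuous_on \<Omega> w"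
    and e: "0 < \<epsilon>" and x: "cball x (2 * \<epsilon>) \<subseteq> \<Omega>"
    and osc: "\<And>y z. y \<in> cball x (2 * \<epsilon>) \<Longrightarrow> z \<in> cball x (2 * \<epsilon>) \<Longrightarrow> w y \<le> w z + c"
  defines "W \<equiv> \<lambda>y. c - ball_max \<epsilon> (\<lambda>y. - w y) y"
  shows "dpp \<epsilon> W x \<le> W x"
proof -
  let ?n = "\<lambda>y. - w y"
  have cn: "continuous_on (cball x (2 * \<epsilon>)) ?n"
    by (intro continuous_intros continuous_on_subset[OF w(2) x])
  have near: "cball y \<epsilon> \<subseteq> cball x (2 * \<epsilon>)" if "y \<in> ball x \<epsilon>" for y
    by (rule cball_double) (use that in auto)
  obtain B where B: "\<And>y. y \<in> ball x \<epsilon> \<Longrightarrow> \<bar>ball_max \<epsilon> ?n y\<bar> \<le> B"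
    using ball_max_bounded[OF e cn] by blast
  have WB: "\<bar>W y\<bar> \<le> \<bar>c\<bar> + B" if "y \<in> ball x \<epsilon>" for y using B[OF that] unfolding W_def by linarith
  define m where "m = binf \<epsilon> W x - c"
  have m: "m \<le> w y" if "y \<in> cball x (2 * \<epsilon>)" for y
  proof -
    have "- w y \<le> - m"
    proof (rule max_ball_eq[OF e cn that])
      fix q assume q: "q \<in> ball x \<epsilon>"
      have "binf \<epsilon> W x \<le> W q" by (rule binf_lower[of x \<epsilon> W, OF WB q])
      then show "ball_max \<epsilon> ?n q \<le> - m" unfolding W_def m_def by simp
    qed
    then show ?thesis by simp
  qed
  have S: "bsup \<epsilon> W x \<le> w x + c"
  proof (rule bsup_least[OF e])
    fix y assume y: "y \<in> ball x \<epsilon>"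
    then have "x \<in> cball y \<epsilon>" by (auto simp: dist_commute)
    then show "W y \<le> w x + c"
      using ball_max_attained[of \<epsilon> y ?n] continuous_on_subset[OF cn near[OF y]] e unfolding W_def by force
  qed
  obtain z where z: "z \<in> cball x \<epsilon>" "ball_max \<epsilon> ?n x = - w z" "\<And>y. y \<in> cball x \<epsilon> \<Longrightarrow> w z \<le> w y"
    using ball_max_attained[of \<epsilon> x ?n] continuous_on_subset[OF cn near[of x]] e by auto
  have Wx: "W x = w z + c" unfolding W_def z(2) by simp
  have z2: "z \<in> cball x (2 * \<epsilon>)" using z(1) e by auto
  have xz: "w z \<le> w x" by (rule z(3)) (use e in simp)
  have avg: "(w x + m) / 2 \<le> w z"
    if \<kappa>: "0 \<le> \<kappa>" "\<kappa> * \<epsilon> < w x - w z \<or> w x = w z" and alt: "\<kappa> = 1 \<or> (\<forall>y\<in>cball x (2 * \<epsilon>). w y < 0)" for \<kappa>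
  proof (rule ccontr)
    assume neg: "\<not> ?thesis"
    then have "w z < w x" using m[OF z2] xz by argo
    then have \<kappa>': "\<kappa> * \<epsilon> < w x - w z" using \<kappa>(2) by auto
    \<comment> \<open>Slopes above \<open>k1\<close> keep the cone below \<open>w\<close> on the
      sphere and are admissible for comparison; \<open>k2\<close> is the drop to the minimum point
      divided by \<open>\<epsilon>\<close>. Failure of the average inequality opens a gap between
      them, and a cone with slope in this gap forbids the drop.\<close>
    define k1 where "k1 = max \<kappa> ((w x - m) / (2 * \<epsilon>))"
    define k2 where "k2 = (w x - w z) / \<epsilon>"
    have "\<kappa> < k2" using \<kappa>' e unfolding k2_def by (simp add: field_simps)
    moreover have "(w x - m) / (2 * \<epsilon>) < k2"
    proof -
      have "w x - m < 2 * (w x - w z)" using neg by argo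
      then have "(w x - m) / (2 * \<epsilon>) < 2 * (w x - w z) / (2 * \<epsilon>)" using e by (intro divide_strict_right_mono) auto
      also have "\<dots> = k2" unfolding k2_def using e by (simp only: mult_divide_mult_cancel_left)
      finally show ?thesis .
    qed
    ultimately have "k1 < k2" unfolding k1_def by simp
    then obtain k where k: "k1 < k" "k < k2" using dense by blast
    have k0: "0 < k" "\<kappa> < k" "(w x - m) / (2 * \<epsilon>) < k" using k(1) \<kappa>(1) unfolding k1_def by auto
    have sphere: "w x - k * (2 * \<epsilon>) \<le> w y" if "dist x y = 2 * \<epsilon>" for y
    proof -
      have "w x - m \<le> k * (2 * \<epsilon>)" using k0(3) e by (simp add: pos_divide_less_eq)
      then show ?thesis using m[of y] that by simp
    qed
    have "w x - k * dist x z \<le> w z"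
      by (rule supersolution_cone[OF \<Omega> w _ x k0(1) _ sphere z2]) (use e k0(2) alt in auto)
    moreover have "k * dist x z \<le> k * \<epsilon>" using z(1) k0(1) by (intro mult_left_mono) auto
    moreover have "k * \<epsilon> < w x - w z" using k(2) e unfolding k2_def by (simp add: pos_less_divide_eq)
    ultimately show False by linarith
  qed
  have tug: "dpp \<epsilon> W x \<le> W x" if "(w x + m) / 2 \<le> w z"
  proof -
    have "(bsup \<epsilon> W x + binf \<epsilon> W x) / 2 \<le> W x" using that S Wx unfolding m_def by argo
    then show ?thesis unfolding dpp_def by (rule min.coboundedI1)
  qed
  show ?thesis
  proof (cases "\<forall>y\<in>cball x (2 * \<epsilon>). w y < 0")
    case True
    then show ?thesis using xz by (intro tug avg[of 0]) auto
  next
    case False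
    then obtain y where y: "y \<in> cball x (2 * \<epsilon>)" "0 \<le> w y" by force
    then have W0: "0 \<le> W x" using osc[OF y(1) z2] Wx by simp
    show ?thesis
    proof (cases "bsup \<epsilon> W x - \<epsilon> \<le> W x")
      case True
      then have "max 0 (bsup \<epsilon> W x - \<epsilon>) \<le> W x" using W0 by simp
      then show ?thesis unfolding dpp_def by (rule min.coboundedI2)
    next
      case False
      then show ?thesis using S Wx by (intro tug avg[of 1]) auto
    qed
  qed
qed

section \<open>Distance to viscosity solutions and passage to the limit\<close>

lemma lipschitz_outer_strip_mono:
  "L-lipschitz_on (outer_strip \<Omega> \<epsilon>0) F \<Longrightarrow> \<epsilon> \<le> \<epsilon>0 \<Longrightarrow> L-lipschitz_on (outer_strip \<Omega> \<epsilon>) F"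
  by (erule lipschitz_on_subset) (auto simp: outer_strip_def)

lemma near_frontier:
  fixes \<Omega> :: "'a::euclidean_space set"
  assumes "open \<Omega>" "x \<in> closure \<Omega>" "\<not> cball x r \<subseteq> \<Omega>" "0 \<le> r"
  shows "\<exists>q\<in>frontier \<Omega>. dist x q \<le> r"
proof (cases "x \<in> \<Omega>")
  case True
  obtain y where y: "y \<in> cball x r" "y \<notin> \<Omega>" using assms(3) by blast
  have "closed_segment x y \<inter> frontier \<Omega> \<noteq> {}"
    by (rule connected_Int_frontier) (use True y in auto)
  then obtain q where q: "q \<in> closed_segment x y" "q \<in> frontier \<Omega>" by auto
  have "closed_segment x y \<subseteq> cball x r" using y assms(4) by (intro closed_segment_subset) auto
  then show ?thesis using q by (intro bexI[of _ q]) auto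
next
  case False
  then have "x \<in> frontier \<Omega>" using assms by (simp add: frontier_def interior_open)
  then show ?thesis using assms(4) by (intro bexI[of _ x]) auto
qed

lemma closure_subset_strip:
  assumes "open \<Omega>" "0 < \<epsilon>"
  shows "closure \<Omega> \<subseteq> \<Omega> \<union> outer_strip \<Omega> \<epsilon>"
proof
  fix x assume "x \<in> closure \<Omega>"
  then have "x \<in> \<Omega> \<or> x \<in> frontier \<Omega>" using assms(1) by (auto simp: frontier_def interior_open)
  then show "x \<in> \<Omega> \<union> outer_strip \<Omega> \<epsilon>" using frontier_in_outer_strip[OF assms] by auto
qed

text \<open>Within \<open>2 * \<epsilon>\<close> of the boundary both functions are close to
  \<open>F\<close>: \<open>v\<close> by its almost Lipschitz bound, which accounts for
  \<open>3 * L * \<epsilon>\<close>, and \<open>u\<close> by its modulus. Elsewhere \<open>v\<close>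
  is enclosed between the ball maximum of \<open>u\<close> lowered by \<open>c\<close> and the ball
  minimum raised by \<open>c\<close>; replacing \<open>u\<close> by these costs another
  \<open>\<eta>\<close>. The modulus is taken at \<open>4 * \<epsilon>\<close>, the diameter of the
  balls whose oscillation enters the supersolution.\<close>

lemma dpp_solution_near_viscosity_solution:
  fixes \<Omega> :: "'a::euclidean_space set"
  assumes \<Omega>: "open \<Omega>" "bounded \<Omega>" and e: "0 < \<epsilon>" and L: "1 \<le> L"
    and F: "L-lipschitz_on (outer_strip \<Omega> \<epsilon>) F" and v: "dpp_solution \<Omega> F \<epsilon> v"
    and u: "viscosity_solution \<Omega> F u" and \<eta>: "0 \<le> \<eta>"
    and mod: "\<And>x y. x \<in> closure \<Omega> \<Longrightarrow> y \<in> closure \<Omega> \<Longrightarrow> dist x y \<le> 4 * \<epsilon> \<Longrightarrow> \<bar>u x - u y\<bar> \<le> \<eta>"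
    and x: "x \<in> closure \<Omega>"
  shows "\<bar>v x - u x\<bar> \<le> 3 * L * \<epsilon> + 2 * \<eta>"
proof -
  have cu: "continuous_on (closure \<Omega>) u" and su: "viscosity_subsolution \<Omega> u" "viscosity_supersolution \<Omega> u"
    and uF: "\<And>q. q \<in> frontier \<Omega> \<Longrightarrow> u q = F q"
    using u unfolding viscosity_solution_def by auto
  have cu': "continuous_on \<Omega> u" by (rule continuous_on_subset[OF cu closure_subset])
  have \<Omega>c: "\<Omega> \<subseteq> closure \<Omega>" by (rule closure_subset)
  define D where "D = {x. cball x (2 * \<epsilon>) \<subseteq> \<Omega>}"
  have D\<Omega>: "D \<subseteq> \<Omega>" unfolding D_def using e by force
  have bD: "bounded D" by (rule bounded_subset[OF \<Omega>(2) D\<Omega>])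
  define c where "c = 3 * L * \<epsilon> + 2 * \<eta>"
  have Le: "0 < L * \<epsilon>" using L e by simp
  have edge: "\<bar>v y - u y\<bar> \<le> 3 * L * \<epsilon> + \<eta>" if y: "y \<in> closure \<Omega>" "y \<notin> D" for y
  proof -
    obtain q where q: "q \<in> frontier \<Omega>" "dist y q \<le> 2 * \<epsilon>"
      using near_frontier[OF \<Omega>(1) y(1), of "2 * \<epsilon>"] y(2) e unfolding D_def by auto
    have qs: "q \<in> outer_strip \<Omega> \<epsilon>" by (rule frontier_in_outer_strip[OF \<Omega>(1) e q(1)])
    have ys: "y \<in> \<Omega> \<union> outer_strip \<Omega> \<epsilon>" using closure_subset_strip[OF \<Omega>(1) e] y(1) by blast
    have vq: "v q = F q" using v qs unfolding dpp_solution_def by simp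
    have "L * dist y q \<le> L * (2 * \<epsilon>)" using q(2) L by (intro mult_left_mono) auto
    then have "\<bar>v y - v q\<bar> \<le> 3 * (L * \<epsilon>)"
      using dpp_solution_almost_lipschitz[OF \<Omega> e L F v ys, of q]
        dpp_solution_almost_lipschitz[OF \<Omega> e L F v _ ys, of q] qs by (simp add: dist_commute)
    moreover have "q \<in> closure \<Omega>" using q(1) by (simp add: frontier_def)
    then have "\<bar>u y - u q\<bar> \<le> \<eta>" using mod[OF y(1), of q] q(2) e by simp
    ultimately show ?thesis using uF[OF q(1)] vq by (simp add: mult.assoc)
  qed
  have inside: "cball y \<epsilon> \<subseteq> \<Omega>" if "x \<in> D" "y \<in> ball x \<epsilon>" for x y
    using cball_double[of y x \<epsilon>] that unfolding D_def by auto
  have inside': "y \<in> closure \<Omega>" if "x \<in> D" "y \<in> ball x \<epsilon>" for x y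
  proof -
    have "y \<in> cball y \<epsilon>" using e by simp
    then show ?thesis using inside[OF that] \<Omega>c by blast
  qed
  have mx: "u y \<le> ball_max \<epsilon> u y" "ball_max \<epsilon> u y \<le> u y + \<eta>" if sub: "cball y \<epsilon> \<subseteq> \<Omega>" for y
  proof -
    obtain z where z: "z \<in> cball y \<epsilon>" "ball_max \<epsilon> u y = u z" "\<forall>q\<in>cball y \<epsilon>. u q \<le> u z"
      using ball_max_attained[of \<epsilon> y u] continuous_on_subset[OF cu' sub] e by auto
    show "u y \<le> ball_max \<epsilon> u y" using z e by simp
    have "y \<in> cball y \<epsilon>" using e by simp
    then have "y \<in> closure \<Omega>" "z \<in> closure \<Omega>" using sub z(1) \<Omega>c by blast+
    then show "ball_max \<epsilon> u y \<le> u y + \<eta>" using mod[of y z] z(1,2) e by auto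
  qed
  have mn: "- ball_max \<epsilon> (\<lambda>y. - u y) y \<le> u y" "u y - \<eta> \<le> - ball_max \<epsilon> (\<lambda>y. - u y) y" if "cball y \<epsilon> \<subseteq> \<Omega>" for y
  proof -
    have "continuous_on (cball y \<epsilon>) (\<lambda>y. - u y)" by (intro continuous_intros continuous_on_subset[OF cu' that])
    then obtain z where z: "z \<in> cball y \<epsilon>" "ball_max \<epsilon> (\<lambda>y. - u y) y = - u z" "\<forall>q\<in>cball y \<epsilon>. - u q \<le> - u z"
      using ball_max_attained[of \<epsilon> y "\<lambda>y. - u y"] e by auto
    show "- ball_max \<epsilon> (\<lambda>y. - u y) y \<le> u y" using z e by simp
    have "y \<in> cball y \<epsilon>" using e by simp
    then have "y \<in> closure \<Omega>" "z \<in> closure \<Omega>" using that z(1) \<Omega>c by blast+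
    then show "u y - \<eta> \<le> - ball_max \<epsilon> (\<lambda>y. - u y) y" using mod[of y z] z(1,2) e by auto
  qed
  obtain C where C: "\<And>x. \<bar>v x\<bar> \<le> C" using v unfolding dpp_solution_def by blast
  have "bounded (u ` closure \<Omega>)"
    by (intro compact_imp_bounded compact_continuous_image cu) (use \<Omega>(2) in \<open>simp add: compact_closure\<close>)
  then obtain B where B: "\<And>y. y \<in> closure \<Omega> \<Longrightarrow> \<bar>u y\<bar> \<le> B" unfolding bounded_iff by auto
  define K where "K = max C (B + \<eta> + c)"
  have c0: "0 \<le> c" unfolding c_def using Le \<eta> by simp
  have vK: "\<bar>v y\<bar> \<le> K" for y using C[of y] unfolding K_def by simp
  have uB: "\<bar>u y\<bar> \<le> B" if "x \<in> D" "y \<in> ball x \<epsilon>" for x y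
    by (rule B[OF inside'[OF that]])
  have uK: "\<bar>ball_max \<epsilon> u y - c\<bar> \<le> K" "\<bar>c - ball_max \<epsilon> (\<lambda>y. - u y) y\<bar> \<le> K" if "x \<in> D" "y \<in> ball x \<epsilon>" for x y
    using mx[OF inside[OF that]] mn[OF inside[OF that]] uB[OF that] c0 \<eta> unfolding K_def by linarith+
  have dv: "v y = dpp \<epsilon> v y" if "y \<in> D" for y using v D\<Omega> that unfolding dpp_solution_def by auto
  have edge': "\<bar>v y - u y\<bar> \<le> 3 * L * \<epsilon> + \<eta>" if "x \<in> D" "y \<in> ball x \<epsilon>" "y \<notin> D" for x y
    by (rule edge[OF inside'[OF that(1,2)] that(3)])
  show ?thesis
  proof (cases "x \<in> D")
    case False
    then show ?thesis using edge[OF x False] \<eta> by simp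
  next
    case True
    have self: "cball y \<epsilon> \<subseteq> \<Omega>" if "y \<in> D" for y using inside[OF that, of y] e by simp
    have "ball_max \<epsilon> u x - c \<le> v x"
    proof (rule dpp_comparison[OF e bD, where C=K])
      show "ball_max \<epsilon> u y - c \<le> dpp \<epsilon> (\<lambda>y. ball_max \<epsilon> u y - c) y" if y: "y \<in> D" for y
      proof -
        have "ball_max \<epsilon> u y \<le> dpp \<epsilon> (ball_max \<epsilon> u) y"
          by (rule discrete_subsolution[OF \<Omega>(1) su(1) cu' e]) (use y in \<open>simp add: D_def\<close>)
        also have "\<dots> \<le> dpp \<epsilon> (\<lambda>y. ball_max \<epsilon> u y - c) y + c"
        proof (rule dpp_mono[OF e c0, where C="K + c" and C'=K])
          show "\<bar>ball_max \<epsilon> u q\<bar> \<le> K + c" if "q \<in> ball y \<epsilon>" for q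
            using uK(1)[OF y that] c0 by linarith
          show "\<bar>ball_max \<epsilon> u q - c\<bar> \<le> K" if "q \<in> ball y \<epsilon>" for q by (rule uK(1)[OF y that])
        qed simp
        finally show ?thesis by simp
      qed
      show "ball_max \<epsilon> u y - c \<le> v y" if "x \<in> D" "y \<in> ball x \<epsilon>" "y \<notin> D" for x y
        using mx(2)[OF inside[OF that(1,2)]] edge'[OF that] unfolding c_def by linarith
    qed (use uK(1) vK dv True in auto)
    moreover have "v x \<le> c - ball_max \<epsilon> (\<lambda>y. - u y) x"
    proof (rule dpp_comparison[OF e bD, where C=K])
      show "dpp \<epsilon> (\<lambda>y. c - ball_max \<epsilon> (\<lambda>y. - u y) y) y \<le> c - ball_max \<epsilon> (\<lambda>y. - u y) y" if y: "y \<in> D" for y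
      proof (rule discrete_supersolution[OF \<Omega>(1) su(2) cu' e])
        show sub: "cball y (2 * \<epsilon>) \<subseteq> \<Omega>" using y by (simp add: D_def)
        fix p q assume pq: "p \<in> cball y (2 * \<epsilon>)" "q \<in> cball y (2 * \<epsilon>)"
        then have "dist p q \<le> 4 * \<epsilon>" using dist_triangle3[of p q y] by simp
        then have "\<bar>u p - u q\<bar> \<le> \<eta>" using pq sub \<Omega>c by (intro mod) auto
        then show "u p \<le> u q + c" using c0 Le \<eta> unfolding c_def by linarith
      qed
      show "v y \<le> c - ball_max \<epsilon> (\<lambda>y. - u y) y" if "x \<in> D" "y \<in> ball x \<epsilon>" "y \<notin> D" for x y
        using mn(2)[OF inside[OF that(1,2)]] edge'[OF that] unfolding c_def by linarith
    qed (use uK(2) vK dv True in auto)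
    ultimately have "\<bar>v x - u x\<bar> \<le> c" using mx(1)[OF self[OF True]] mn(1)[OF self[OF True]] by linarith
    then show ?thesis unfolding c_def .
  qed
qed

theorem dpp_solutions_converge:
  fixes \<Omega> :: "'a::euclidean_space set"
  assumes \<Omega>: "open \<Omega>" "bounded \<Omega>" and e0: "0 < \<epsilon>0" and L: "1 \<le> L"
    and F: "L-lipschitz_on (outer_strip \<Omega> \<epsilon>0) F"
    and v: "\<And>\<epsilon>. 0 < \<epsilon> \<Longrightarrow> \<epsilon> < \<epsilon>0 \<Longrightarrow> dpp_solution \<Omega> F \<epsilon> (v \<epsilon>)"
    and u: "viscosity_solution \<Omega> F u"
  shows "uniform_limit (closure \<Omega>) v u (at_right 0)"
proof (rule uniform_limitI)
  fix \<eta> :: real assume \<eta>: "0 < \<eta>"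
  have "continuous_on (closure \<Omega>) u" using u unfolding viscosity_solution_def by blast
  then have "uniformly_continuous_on (closure \<Omega>) u"
    using \<Omega>(2) by (intro compact_uniformly_continuous) (simp_all add: compact_closure)
  then obtain d where d: "0 < d" "\<And>x y. x \<in> closure \<Omega> \<Longrightarrow> y \<in> closure \<Omega> \<Longrightarrow> dist x y < d \<Longrightarrow> \<bar>u x - u y\<bar> < \<eta> / 8"
    using \<eta> unfolding uniformly_continuous_on_def dist_real_def
    by (metis dist_commute divide_pos_pos zero_less_numeral abs_minus_commute)
  define \<delta> where "\<delta> = Min {\<epsilon>0, d / 8, \<eta> / (8 * L)}"
  have \<delta>: "0 < \<delta>" unfolding \<delta>_def using e0 d(1) \<eta> L by simp
  have \<delta>': "\<delta> \<le> \<epsilon>0" "\<delta> \<le> d / 8" "\<delta> \<le> \<eta> / (8 * L)" unfolding \<delta>_def by (rule Min_le; simp)+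
  have "dist (v \<epsilon> x) (u x) < \<eta>" if \<epsilon>: "0 < \<epsilon>" "\<epsilon> < \<delta>" and x: "x \<in> closure \<Omega>" for \<epsilon> x
  proof -
    have "\<bar>v \<epsilon> x - u x\<bar> \<le> 3 * L * \<epsilon> + 2 * (\<eta> / 8)"
    proof (rule dpp_solution_near_viscosity_solution[OF \<Omega> \<epsilon>(1) L lipschitz_outer_strip_mono[OF F] v[OF \<epsilon>(1)] u _ _ x])
      show "\<bar>u x - u y\<bar> \<le> \<eta> / 8" if "x \<in> closure \<Omega>" "y \<in> closure \<Omega>" "dist x y \<le> 4 * \<epsilon>" for x y
        using d(2)[OF that(1,2)] that(3) \<epsilon> \<delta>' d(1) by simp
    qed (use \<epsilon> \<delta>' \<eta> in auto)
    moreover have "L * \<epsilon> \<le> L * (\<eta> / (8 * L))" using \<epsilon> \<delta>'(3) L by (intro mult_left_mono) auto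
    then have "L * \<epsilon> \<le> \<eta> / 8" using L by simp
    ultimately show ?thesis using \<eta> unfolding dist_real_def by argo
  qed
  then show "\<forall>\<^sub>F \<epsilon> in at_right 0. \<forall>x\<in>closure \<Omega>. dist (v \<epsilon> x) (u x) < \<eta>"
    unfolding eventually_at_right_field using \<delta> by blast
qed

text \<open>Only existence is extracted here, so a convergent subsequence suffices; the whole family
  is handled by comparison with the limit.\<close>

theorem viscosity_solution_exists:
  fixes \<Omega> :: "'a::euclidean_space set"
  assumes \<Omega>: "open \<Omega>" "bounded \<Omega>" "\<Omega> \<noteq> {}" and e0: "0 < \<epsilon>0" and L: "1 \<le> L"
    and F: "L-lipschitz_on (outer_strip \<Omega> \<epsilon>0) F"
    and v: "\<And>\<epsilon>. 0 < \<epsilon> \<Longrightarrow> \<epsilon> < \<epsilon>0 \<Longrightarrow> dpp_solution \<Omega> F \<epsilon> (v \<epsilon>)"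
  shows "\<exists>u. viscosity_solution \<Omega> F u"
proof -
  define K where "K = closure \<Omega>"
  have K: "compact K" "K \<noteq> {}" "\<Omega> \<subseteq> K" "frontier \<Omega> \<subseteq> K"
    unfolding K_def using \<Omega> closure_subset by (auto simp: compact_closure frontier_def)
  \<comment> \<open>The offset 2 keeps already the first step size strictly below
    \<open>\<epsilon>0\<close>.\<close>
  define \<epsilon> where "\<epsilon> n = \<epsilon>0 / real (n + 2)" for n :: nat
  have \<epsilon>: "0 < \<epsilon> n" "\<epsilon> n < \<epsilon>0" for n unfolding \<epsilon>_def using e0 by (auto simp: field_simps add_pos_nonneg)
  have \<epsilon>lim: "\<epsilon> \<longlonglongrightarrow> 0" unfolding \<epsilon>_def[abs_def]
    by (rule LIMSEQ_ignore_initial_segment[OF lim_const_over_n])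
  define w where "w n = v (\<epsilon> n)" for n
  have sol: "dpp_solution \<Omega> F (\<epsilon> n) (w n)" for n unfolding w_def using v \<epsilon> by blast
  have Fn: "L-lipschitz_on (outer_strip \<Omega> (\<epsilon> n)) F" for n
    using lipschitz_outer_strip_mono[OF F] \<epsilon>(2)[of n] by simp
  have Ks: "K \<subseteq> \<Omega> \<union> outer_strip \<Omega> (\<epsilon> n)" for n unfolding K_def by (rule closure_subset_strip[OF \<Omega>(1) \<epsilon>(1)])
  have lip: "w n y \<le> w n x + L * dist x y + L * \<epsilon> n" if "x \<in> K" "y \<in> K" for n x y
    using dpp_solution_almost_lipschitz[OF \<Omega>(1,2) \<epsilon>(1) L Fn sol] Ks that by blast
  obtain q where q: "q \<in> frontier \<Omega>" using frontier_nonempty[OF \<Omega>(2,3)] by blast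
  then have qK: "q \<in> K" using K(4) by blast
  have wF: "w n x = F x" if "x \<in> frontier \<Omega>" for n x
    using sol[of n] frontier_in_outer_strip[OF \<Omega>(1) \<epsilon>(1) that] unfolding dpp_solution_def by blast
  define b where "b = diameter K"
  have b: "dist x y \<le> b" if "x \<in> K" "y \<in> K" for x y
    unfolding b_def using diameter_bounded_bound[OF compact_imp_bounded[OF K(1)] that] .
  define B where "B = \<bar>F q\<bar> + L * b + L * \<epsilon>0"
  have L\<epsilon>: "L * \<epsilon> n \<le> L * \<epsilon>0" "0 \<le> L * \<epsilon> n" for n using \<epsilon>[of n] L by (auto intro: mult_left_mono)
  have Lb: "L * dist x y \<le> L * b" if "x \<in> K" "y \<in> K" for x y using b[OF that] L by (intro mult_left_mono) auto
  have wB: "\<bar>w n x\<bar> \<le> B" if x: "x \<in> K" for n x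
    using lip[OF x qK, of n] lip[OF qK x, of n] wF[OF q, of n] Lb[OF x qK] Lb[OF qK x] L\<epsilon>[of n]
    unfolding B_def by linarith
  text \<open>The functions \<open>w n\<close> need not be continuous; \<open>g n\<close> are their largest \<open>L\<close>-Lipschitz minorants.\<close>
  define g where "g n x = (INF y\<in>K. w n y + L * dist x y)" for n x
  have bdd: "bdd_below ((\<lambda>y. w n y + L * dist x y) ` K)" for n x
  proof (rule bdd_belowI2)
    fix y assume "y \<in> K"
    moreover have "0 \<le> L * dist x y" using L by simp
    ultimately show "- B \<le> w n y + L * dist x y" using wB[of y n] by linarith
  qed
  have g_upper: "g n x \<le> w n x" if "x \<in> K" for n x
    using cINF_lower[OF bdd that, of n x] unfolding g_def by simp
  have g_lower: "w n x - L * \<epsilon> n \<le> g n x" if "x \<in> K" for n x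
    unfolding g_def
  proof (rule cINF_greatest[OF K(2)])
    fix y assume "y \<in> K"
    then show "w n x - L * \<epsilon> n \<le> w n y + L * dist x y"
      using lip[OF \<open>y \<in> K\<close> that, of n] by (simp add: dist_commute)
  qed
  have g_lip: "g n x \<le> g n y + L * dist x y" for n x y
  proof -
    have "g n x - L * dist x y \<le> g n y"
      unfolding g_def[of n y]
    proof (rule cINF_greatest[OF K(2)])
      fix z assume z: "z \<in> K"
      have "g n x \<le> w n z + L * dist x z" unfolding g_def by (rule cINF_lower[OF bdd z])
      moreover have "L * dist x z \<le> L * (dist x y + dist y z)" using L dist_triangle by (intro mult_left_mono) auto
      ultimately show "g n x - L * dist x y \<le> w n z + L * dist y z" by (simp add: algebra_simps)
    qed
    then show ?thesis by simp
  qed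
  have gB: "norm (g n x) \<le> B + L * \<epsilon>0" if "x \<in> K" for n x
    using g_upper[OF that, of n] g_lower[OF that, of n] wB[OF that, of n] L\<epsilon>[of n] by simp
  have equi: "\<exists>d>0. \<forall>n y. y \<in> K \<and> norm (x - y) < d \<longrightarrow> norm (g n x - g n y) < e"
    if "x \<in> K" "0 < e" for x e
  proof (intro exI[of _ "e / L"] conjI allI impI)
    show "0 < e / L" using that L by simp
    fix n y assume y: "y \<in> K \<and> norm (x - y) < e / L"
    then have "L * dist x y < e" using L by (simp add: dist_norm field_simps)
    then show "norm (g n x - g n y) < e" using g_lip[of n x y] g_lip[of n y x] by (simp add: dist_commute)
  qed
  obtain u k where u: "continuous_on K u" and k: "strict_mono (k :: nat \<Rightarrow> nat)"
    and conv: "\<And>e. 0 < e \<Longrightarrow> \<exists>N. \<forall>n x. n \<ge> N \<and> x \<in> K \<longrightarrow> norm (g (k n) x - u x) < e"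
    using Arzela_Ascoli[OF K(1) gB equi] by blast
  have \<epsilon>k: "(\<lambda>n. \<epsilon> (k n)) \<longlonglongrightarrow> 0" using LIMSEQ_subseq_LIMSEQ[OF \<epsilon>lim k] by (simp add: comp_def)
  have lim: "uniform_limit K (\<lambda>n. w (k n)) u sequentially"
  proof (rule uniform_limitI)
    fix e :: real assume e: "0 < e"
    obtain N where N: "\<And>n x. n \<ge> N \<Longrightarrow> x \<in> K \<Longrightarrow> norm (g (k n) x - u x) < e / 2"
      using conv[of "e / 2"] e by auto
    have "(\<lambda>n. L * \<epsilon> (k n)) \<longlonglongrightarrow> L * 0" by (intro tendsto_intros \<epsilon>k)
    then have "\<forall>\<^sub>F n in sequentially. L * \<epsilon> (k n) < e / 2" using e by (intro order_tendstoD(2)[of _ "L * 0"]) auto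
    then show "\<forall>\<^sub>F n in sequentially. \<forall>x\<in>K. dist (w (k n) x) (u x) < e"
      using eventually_ge_at_top[of N]
    proof eventually_elim
      case (elim n)
      show ?case
      proof
        fix x assume x: "x \<in> K"
        show "dist (w (k n) x) (u x) < e"
          using N[OF elim(2) x] g_upper[OF x, of "k n"] g_lower[OF x, of "k n"] elim(1)
          unfolding dist_real_def real_norm_def by argo
      qed
    qed
  qed
  have lim\<Omega>: "uniform_limit \<Omega> (\<lambda>n. w (k n)) u sequentially" by (rule uniform_limit_on_subset[OF lim K(3)])
  have u\<Omega>: "continuous_on \<Omega> u" by (rule continuous_on_subset[OF u K(3)])
  have "\<forall>n. \<exists>C. \<forall>x. \<bar>w (k n) x\<bar> \<le> C" using sol unfolding dpp_solution_def by blast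
  then obtain C where C: "\<And>n x. \<bar>w (k n) x\<bar> \<le> C n" by metis
  have dw: "w (k n) x = dpp (\<epsilon> (k n)) (w (k n)) x" if "x \<in> \<Omega>" for n x
    using sol[of "k n"] that unfolding dpp_solution_def by blast
  have "viscosity_subsolution \<Omega> u"
    by (rule limit_viscosity_subsolution[OF \<Omega>(1) u\<Omega> \<epsilon>(1) \<epsilon>k C lim\<Omega>]) (use dw in auto)
  moreover have "viscosity_supersolution \<Omega> u"
    by (rule limit_viscosity_supersolution[OF \<Omega>(1) u\<Omega> \<epsilon>(1) \<epsilon>k C lim\<Omega>]) (use dw in auto)
  moreover have "u x = F x" if x: "x \<in> frontier \<Omega>" for x
  proof -
    have "(\<lambda>n. w (k n) x) \<longlonglongrightarrow> u x" by (rule tendsto_uniform_limitI[OF lim]) (use x K(4) in blast)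
    then show ?thesis using LIMSEQ_const_iff[of "F x" "u x"] by (simp add: wF[OF x])
  qed
  ultimately show ?thesis using u unfolding viscosity_solution_def K_def by blast
qed

theorem theorem1p5:
  fixes \<Omega> :: "'a::euclidean_space set" and F :: "'a \<Rightarrow> real" and \<epsilon>0 :: real
  assumes "regular_domain \<Omega>" and "bounded \<Omega>"
    and "\<epsilon>0 > 0" and "\<exists>L. L-lipschitz_on (outer_strip \<Omega> \<epsilon>0) F"
  shows "\<exists>v u. (\<forall>\<epsilon>. 0 < \<epsilon> \<and> \<epsilon> < \<epsilon>0 \<longrightarrow> is_game_value \<Omega> F \<epsilon> (v \<epsilon>)) \<and>
    viscosity_solution \<Omega> F u \<and>
    (\<forall>w. viscosity_solution \<Omega> F w \<longrightarrow> (\<forall>x\<in>closure \<Omega>. w x = u x)) \<and>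
    uniform_limit (closure \<Omega>) v u (at_right 0)"
proof -
  have \<Omega>: "open \<Omega>" "bounded \<Omega>" "\<Omega> \<noteq> {}" using assms unfolding regular_domain_def by auto
  obtain L0 where L0: "L0-lipschitz_on (outer_strip \<Omega> \<epsilon>0) F" using assms(4) by blast
  \<comment> \<open>The barriers need slope at least 1, so that a move up the cone covers its
    cost.\<close>
  define L where "L = max L0 1"
  have L: "1 \<le> L" unfolding L_def by simp
  have F: "L-lipschitz_on (outer_strip \<Omega> \<epsilon>0) F" by (rule lipschitz_on_le[OF L0]) (simp add: L_def)
  have "\<exists>v. is_game_value \<Omega> F \<epsilon> v \<and> dpp_solution \<Omega> F \<epsilon> v" if "0 < \<epsilon>" "\<epsilon> < \<epsilon>0" for \<epsilon>
    using game_value_dpp[OF \<Omega> that(1) lipschitz_outer_strip_mono[OF F]] that(2)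
    unfolding dpp_solution_def by (metis less_imp_le)
  then obtain v where v: "\<And>\<epsilon>. 0 < \<epsilon> \<Longrightarrow> \<epsilon> < \<epsilon>0 \<Longrightarrow> is_game_value \<Omega> F \<epsilon> (v \<epsilon>)"
    "\<And>\<epsilon>. 0 < \<epsilon> \<Longrightarrow> \<epsilon> < \<epsilon>0 \<Longrightarrow> dpp_solution \<Omega> F \<epsilon> (v \<epsilon>)" by metis
  obtain u where u: "viscosity_solution \<Omega> F u"
    using viscosity_solution_exists[OF \<Omega> assms(3) L F v(2)] by blast
  note conv = dpp_solutions_converge[OF \<Omega>(1,2) assms(3) L F v(2)]
  \<comment> \<open>Every viscosity solution is a limit of the same family \<open>v\<close>, and
    limits are unique.\<close>
  have "w x = u x" if "viscosity_solution \<Omega> F w" "x \<in> closure \<Omega>" for w x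
    by (rule tendsto_unique[OF _ tendsto_uniform_limitI[OF conv[OF _ _ that(1)] that(2)]
          tendsto_uniform_limitI[OF conv[OF _ _ u] that(2)]]) auto
  then show ?thesis using v(1) u conv[OF _ _ u] by blast
qed

end
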